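(* Let $d\ge 3$ be a fixed integer, and let $p$ be an odd prime number such that $\gcd(p,d)=1$. Let $A$ be the adjacency matrix of a random $d$-regular graph (directed or undirected) on $n$ vertices. Then, as a random matrix in $\mathbb F_p$, $$\mathbb P(A\text{ is singular in }\mathbb F_p)\le \frac{1+o(1)}{p-1},$$ for $n$ sufficiently large.
   Context: Random $d$-regular graphs are taken from the configuration model. To each vertex $k\in\{1,\dots,n\}$ associate a fiber $F_k$ of $d$ points (disjoint fibers, $nd$ points in total). Directed: choose a permutation $\mathcal P$ of the $nd$ points uniformly at random; for each vertex $k$ and each point $k'\in F_k$, add a directed edge from $k$ to $\ell$ if $\mathcal P(k')\in F_\ell$. Then $A_{k\ell}$ is the number of directed edges from $k$ to $\ell$, i.e. $A_{k\ell}=\#\{k'\in F_k:\mathcal P(k')\in F_\ell\}$. Undirected ($nd$ even): choose a perfect pairing $\mathcal P$ of the $nd$ points uniformly at random, join paired points by an edge, and collapse each fiber $F_k$ to the vertex $k$. Then $A_{k\ell}$ is the number of edges between $k$ and $\ell$, with $A_{k\ell}=\#\{(k',\ell')\in F_k\times F_\ell:\{k',\ell'\}\in\mathcal P\}$ (so each loop contributes $2$ to the diagonal). The integer matrix $A$ is viewed over $\mathbb F_p$ by reducing its entries mod $p$. *)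

theory Defs
  imports
    "HOL-Probability.Probability_Mass_Function"
    "HOL-Combinatorics.Permutations"
    "HOL-Library.Disjoint_Sets"
    "Jordan_Normal_Form.Matrix"
    "Berlekamp_Zassenhaus.Finite_Field"
begin

text \<open>
  The configuration model. Vertices are \<open>0, \<dots>, n - 1\<close>, and the fiber of the vertex \<open>k\<close> consists
  of the \<open>d\<close> points \<open>(k, 0), \<dots>, (k, d - 1)\<close>.
\<close>

definition fiber :: "nat \<Rightarrow> nat \<Rightarrow> (nat \<times> nat) set" where
  "fiber d k = {k} \<times> {..<d}"

definition points :: "nat \<Rightarrow> nat \<Rightarrow> (nat \<times> nat) set" where
  "points n d = (\<Union>k<n. fiber d k)"

definition directed_adj :: "nat \<Rightarrow> nat \<Rightarrow> (nat \<times> nat \<Rightarrow> nat \<times> nat) \<Rightarrow> int mat" where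
  "directed_adj n d P =
     mat n n (\<lambda>(k, l). int (card {x \<in> fiber d k. P x \<in> fiber d l}))"

definition directed_model :: "nat \<Rightarrow> nat \<Rightarrow> int mat pmf" where
  "directed_model n d =
     map_pmf (directed_adj n d) (pmf_of_set {P. P permutes points n d})"

definition perfect_pairings :: "'a set \<Rightarrow> 'a set set set" where
  "perfect_pairings X = {M. partition_on X M \<and> (\<forall>e\<in>M. card e = 2)}"

text \<open>
  The entries count ordered pairs of points: a loop contributes 2 to the diagonal, and pairs
  \<open>(x, x)\<close> do not contribute, because \<open>{x, x}\<close> has cardinality 1.
\<close>

definition undirected_adj :: "nat \<Rightarrow> nat \<Rightarrow> (nat \<times> nat) set set \<Rightarrow> int mat" where
  "undirected_adj n d M =
     mat n n (\<lambda>(k, l). int (card {(x, y) \<in> fiber d k \<times> fiber d l. {x, y} \<in> M}))"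

text \<open>Only meaningful for even \<open>n * d\<close>: otherwise there is no perfect pairing.\<close>

definition undirected_model :: "nat \<Rightarrow> nat \<Rightarrow> int mat pmf" where
  "undirected_model n d =
     map_pmf (undirected_adj n d) (pmf_of_set (perfect_pairings (points n d)))"

text \<open>
  Singularity over the prime field with \<open>CARD('p)\<close> elements, the entries being reduced modulo
  \<open>CARD('p)\<close> by the canonical map \<open>of_int\<close>.
\<close>

definition singular_mod :: "'p::prime_card itself \<Rightarrow> int mat \<Rightarrow> bool" where
  "singular_mod _ A \<longleftrightarrow> \<not> invertible_mat (map_mat of_int A :: 'p mod_ring mat)"

text \<open>Both uniform distributions are taken over finite nonempty sets.\<close>

lemma points_eq: "points n d = {..<n} \<times> {..<d}"
  by (auto simp: points_def fiber_def)

lemma finite_points: "finite (points n d)"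
  by (simp add: points_eq)

lemma finite_permutations_points: "finite {P. P permutes points n d}"
  by (intro finite_permutations finite_points)

lemma permutations_points_nonempty: "{P. P permutes points n d} \<noteq> {}"
  using permutes_id by blast

lemma finite_perfect_pairings:
  assumes "finite X"
  shows "finite (perfect_pairings X)"
proof (rule finite_subset)
  show "perfect_pairings X \<subseteq> Pow (Pow X)"
    by (auto simp: perfect_pairings_def partition_on_def)
  show "finite (Pow (Pow X))"
    using assms by simp
qed

lemma perfect_pairings_nonempty:
  assumes "finite X" "even (card X)"
  shows "perfect_pairings X \<noteq> {}"
  using assms
proof (induction "card X" arbitrary: X rule: less_induct)
  case less
  show ?case
  proof (cases "X = {}")
    case True
    have "{} \<in> perfect_pairings X"
      using True by (simp add: perfect_pairings_def partition_on_def)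
    then show ?thesis by blast
  next
    case False
    then have "card X \<noteq> 0" using less.prems by simp
    with less.prems have "2 \<le> card X" by presburger
    then obtain e where e: "e \<subseteq> X" "card e = 2"
      using obtain_subset_with_card_n by metis
    have fe: "finite e" using e less.prems finite_subset by blast
    have c: "card (X - e) = card X - 2"
      using e fe by (simp add: card_Diff_subset)
    have "perfect_pairings (X - e) \<noteq> {}"
      using less.hyps[of "X - e"] c \<open>2 \<le> card X\<close> less.prems by simp
    then obtain M where M: "partition_on (X - e) M" "\<forall>f\<in>M. card f = 2"
      by (auto simp: perfect_pairings_def)
    have "e \<noteq> {}" using e by auto
    then have "partition_on (e \<union> (X - e)) (insert e M)"
      using M(1) by (auto simp: partition_on_def disjoint_def)
    moreover have "e \<union> (X - e) = X" using e by blast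
    ultimately have "insert e M \<in> perfect_pairings X"
      using M e by (simp add: perfect_pairings_def)
    then show ?thesis by blast
  qed
qed

lemma perfect_pairings_points_nonempty:
  assumes "even (n * d)"
  shows "perfect_pairings (points n d) \<noteq> {}"
  using assms by (intro perfect_pairings_nonempty finite_points) (simp add: points_eq)

end

theory Submission
  imports
    Defs
    "HOL-Analysis.Analysis"
    "HOL-Real_Asymp.Real_Asymp"
    "Jordan_Normal_Form.Determinant"
begin

text \<open>
  A singular matrix has at least \<open>p - 1\<close> nonzero kernel vectors, so it suffices that the expected
  number of nonzero kernel vectors is at most \<open>1 + o(1)\<close>. By Fourier inversion over \<open>F_p\<close> this number
  is \<open>p^(-n)\<close> times the sum over \<open>u\<close> and \<open>v \<noteq> 0\<close> of \<open>E(u, v)\<close>, the expectation of \<open>\<omega> (u\<^sup>T A v)\<close> for a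
  nontrivial additive character \<open>\<omega>\<close>. All row and column sums of \<open>A\<close> are \<open>d\<close>, a unit, so the constant
  \<open>u\<close> contribute \<open>1 + o(1)\<close> and the constant \<open>v \<noteq> 0\<close> nothing. The remaining pairs are negligible, for three reasons.

  If \<open>u\<close> differs from a constant in \<open>k\<close> places, where \<open>k \<le> \<delta> n\<close>, then by Cauchy-Schwarz and Parseval the
  average of \<open>\<bar>E(u, v)\<bar>\<close> over \<open>v\<close> is at most the square root of the probability that two independent
  copies of \<open>u\<^sup>T A\<close> agree. Then no fiber is hit exactly once, hence at most \<open>k d\<close> fibers are hit, and this gives
  \<open>(C k / n)^(k d / 2)\<close>, which beats the number of such \<open>u\<close> because \<open>d \<ge> 3\<close>. The roles of \<open>u\<close> and \<open>v\<close> can be exchanged.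

  If both \<open>u\<close> and \<open>v\<close> differ from every constant in more than \<open>\<delta> n\<close> places, random swaps of the
  images of disjoint pairs of points show that \<open>E(u, v)\<close> is exponentially small.

  Finally, \<open>\<bar>E(u, v)\<bar>\<close> is at most \<open>(m / p^n)^(-d / 2)\<close> up to polynomial factors, where \<open>m\<close> is the number of
  pairs of the same type as \<open>(u, v)\<close>: this is an uncertainty principle for the character matrix
  restricted to type classes. As \<open>d \<ge> 3\<close>, the last two bounds together make the contribution of
  each type class exponentially small, and there are only polynomially many classes.
\<close>

section \<open>Averages over permutations and type classes\<close>

text \<open>Both models are averages over a set of permutations of the points: a perfect pairing is
  read as a fixed-point-free involution, and its undirected matrix is the directed matrix of that
  involution. So the first moment and the summation over words are treated for a general set
  \<open>\<Omega>\<close>, and only the three estimates are specific to a model. A matching offers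
  no free permutation to average over; one is obtained by fixing the matching and relabelling the
  points at random. The relevant types are then those of the joint word of u and v, and the near
  regime has to pay for points of the support that are matched to each other. Oddness of p is used
  once: the phase of an undirected swap is a symmetric form on pairs of letters, whose value at (x,
  y) with itself is 2xy. That d/2 exceeds 1 matters twice: the near sum has terms of order (C k /
  n)^((d/2 - 1) k), and a small exponential gain can be traded for a bound linear in the type
  weight, the only form that can be summed over all pairs.\<close>

definition avg :: "'a set \<Rightarrow> ('a \<Rightarrow> 'b) \<Rightarrow> 'b :: real_normed_field" where
  "avg A f = sum f A / of_nat (card A)"

lemma avg_cong: "(\<And>x. x \<in> A \<Longrightarrow> f x = g x) \<Longrightarrow> avg A f = avg A g"
  by (simp add: avg_def cong: sum.cong)

lemma norm_avg_le: "norm (avg A f) \<le> avg A (\<lambda>x. norm (f x))"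
  by (simp add: avg_def norm_divide divide_right_mono norm_sum)

lemma avg_mono: "(\<And>x. x \<in> A \<Longrightarrow> f x \<le> g x) \<Longrightarrow> avg A f \<le> (avg A g :: real)"
  by (simp add: avg_def divide_right_mono sum_mono)

lemma avg_const: "finite A \<Longrightarrow> A \<noteq> {} \<Longrightarrow> avg A (\<lambda>_. c) = c"
  by (simp add: avg_def)

lemma avg_le_const:
  "finite A \<Longrightarrow> A \<noteq> {} \<Longrightarrow> (\<And>x. x \<in> A \<Longrightarrow> f x \<le> c) \<Longrightarrow> avg A f \<le> (c :: real)"
  using avg_mono[of A f "\<lambda>_. c"] by (simp add: avg_const)

lemma avg_nonneg: "(\<And>x. x \<in> A \<Longrightarrow> 0 \<le> f x) \<Longrightarrow> 0 \<le> (avg A f :: real)"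
  by (simp add: avg_def sum_nonneg)

lemma avg_mult_left: "avg A (\<lambda>x. c * f x) = c * avg A f"
  by (simp add: avg_def sum_distrib_left)

lemma avg_mult_right: "avg A (\<lambda>x. f x * c) = avg A f * c"
  by (simp add: avg_def sum_distrib_right)

lemma avg_add: "avg A (\<lambda>x. f x + g x) = avg A f + avg A g"
  by (simp add: avg_def sum.distrib add_divide_distrib)

lemma sum_avg: "(\<Sum>x\<in>B. avg A (f x)) = avg A (\<lambda>a. \<Sum>x\<in>B. f x a)"
  unfolding avg_def sum_divide_distrib[symmetric] by (subst sum.swap) simp

lemma avg_swap: "avg A (\<lambda>a. avg B (\<lambda>b. f a b)) = avg B (\<lambda>b. avg A (\<lambda>a. f a b))"
  unfolding avg_def sum_divide_distrib[symmetric] by (subst sum.swap) (simp add: field_simps)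

lemma avg_reindex: "bij_betw h A B \<Longrightarrow> avg A (\<lambda>x. f (h x)) = avg B f"
  by (simp add: avg_def bij_betw_same_card sum.reindex_bij_betw)

text \<open>Symmetrization at no cost: when every \<open>f b\<close> arises from \<open>g\<close> by
  a change of variables preserving the average, b may be randomized as well. Conjugation of
  matchings and re-pairing of their halves enter this way.\<close>

lemma avg_invariant:
  assumes "finite B" "B \<noteq> {}" "\<And>b. b \<in> B \<Longrightarrow> avg A (\<lambda>a. f b a) = avg A g"
  shows "avg A g = avg A (\<lambda>a. avg B (\<lambda>b. f b a))"
proof -
  have "avg A (\<lambda>a. avg B (\<lambda>b. f b a)) = avg B (\<lambda>b. avg A g)"
    using assms(3) by (subst avg_swap) (rule avg_cong)
  then show ?thesis by (simp add: avg_const assms)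
qed

lemma avg_sqrt_le:
  assumes "finite A" "A \<noteq> {}" "\<And>x. x \<in> A \<Longrightarrow> 0 \<le> f x"
  shows "avg A (\<lambda>x. sqrt (f x)) \<le> sqrt (avg A f)"
proof -
  have c: "card A > 0" using assms by (simp add: card_gt_0_iff)
  have "(\<Sum>x\<in>A. sqrt (f x) * 1)\<^sup>2 \<le> (\<Sum>x\<in>A. (sqrt (f x))\<^sup>2) * (\<Sum>x\<in>A. 1\<^sup>2)"
    by (rule Cauchy_Schwarz_ineq_sum)
  then have "(\<Sum>x\<in>A. sqrt (f x))\<^sup>2 \<le> sum f A * card A"
    using assms by simp
  then have "(avg A (\<lambda>x. sqrt (f x)))\<^sup>2 \<le> avg A f"
    using c by (simp add: avg_def power_divide field_simps power2_eq_square)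
  then show ?thesis by (rule real_le_rsqrt)
qed

section \<open>Random permutations, permuted words and their types\<close>

abbreviation perms :: "'a set \<Rightarrow> ('a \<Rightarrow> 'a) set" where
  "perms X \<equiv> {\<sigma>. \<sigma> permutes X}"

text \<open>The notation \<open>inv\<close> is taken by HOL-Algebra.\<close>

abbreviation iperm :: "('a \<Rightarrow> 'a) \<Rightarrow> 'a \<Rightarrow> 'a" where
  "iperm \<equiv> Hilbert_Choice.inv"

text \<open>Composing with the inverse of one fixed solution embeds the solutions into the
  permutations of \<open>X - D\<close>. Only an upper bound, since y need not extend to a
  permutation.\<close>

lemma perm_restrict_card:
  assumes "finite X" "D \<subseteq> X"
  shows "card {\<sigma>. \<sigma> permutes X \<and> restrict \<sigma> D = y} \<le> fact (card X - card D)"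
proof (cases "{\<sigma>. \<sigma> permutes X \<and> restrict \<sigma> D = y} = {}")
  case False
  then obtain \<tau> where \<tau>: "\<tau> permutes X" "restrict \<tau> D = y" by blast
  have "card {\<sigma>. \<sigma> permutes X \<and> restrict \<sigma> D = y} \<le> card (perms (X - D))"
  proof (rule card_inj_on_le[where f = "\<lambda>\<sigma>. iperm \<tau> \<circ> \<sigma>"])
    show "inj_on (\<lambda>\<sigma>. iperm \<tau> \<circ> \<sigma>) {\<sigma>. \<sigma> permutes X \<and> restrict \<sigma> D = y}"
      by (rule inj_on_inverseI[where g = "\<lambda>\<pi>. \<tau> \<circ> \<pi>"])
        (simp only: o_assoc permutes_inv_o[OF \<tau>(1)] id_comp)
    show "(\<lambda>\<sigma>. iperm \<tau> \<circ> \<sigma>) ` {\<sigma>. \<sigma> permutes X \<and> restrict \<sigma> D = y} \<subseteq> (perms (X - D))"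
    proof clarify
      fix \<sigma> assume s: "\<sigma> permutes X" "y = restrict \<sigma> D"
      have "iperm \<tau> (\<sigma> x) = x" if "x \<in> D" for x
      proof -
        have "\<sigma> x = \<tau> x" using fun_cong[OF s(2)[unfolded \<tau>(2)[symmetric]], of x] that by simp
        then show ?thesis using permutes_inverses(2)[OF \<tau>(1)] by simp
      qed
      then show "iperm \<tau> \<circ> \<sigma> permutes (X - D)"
        using permutes_compose[OF s(1) permutes_inv[OF \<tau>(1)]] assms
        by (elim permutes_superset) auto
    qed
  qed (use assms in \<open>simp add: finite_permutations\<close>)
  also have "\<dots> = fact (card X - card D)"
    using assms by (subst card_permutations[OF refl]) (auto simp: card_Diff_subset finite_subset)
  finally show ?thesis .
qed (simp only: card.empty le0)

lemma finite_perms [simp]: "finite X \<Longrightarrow> finite (perms X)"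
  by (rule finite_permutations)

lemma ex_permutes [simp]: "\<exists>\<sigma>. \<sigma> permutes X"
  using permutes_id by blast

lemma perms_nonempty: "(perms X) \<noteq> {}"
  by simp

text \<open>Trades a random permutation for counting over all functions from D to X, at the price of
  a ratio of factorials. The gain is that sums over functions factor over disjoint parts of
  D.\<close>

lemma avg_restrict_perm_le:
  fixes F :: "('a \<Rightarrow> 'a) \<Rightarrow> real"
  assumes "finite X" "D \<subseteq> X" "\<And>y. F y \<ge> 0"
  shows "avg (perms X) (\<lambda>\<sigma>. F (restrict \<sigma> D)) \<le>
         fact (card X - card D) / fact (card X) * (\<Sum>y\<in>D \<rightarrow>\<^sub>E X. F y)"
proof -
  have fD: "finite D" using assms finite_subset by blast
  have "(\<Sum>\<sigma> | \<sigma> permutes X. F (restrict \<sigma> D)) =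
      (\<Sum>y\<in>D \<rightarrow>\<^sub>E X. \<Sum>\<sigma> | \<sigma> \<in> (perms X) \<and> restrict \<sigma> D = y. F (restrict \<sigma> D))"
    using assms fD by (intro sum.group[symmetric]) (auto simp: finite_PiE permutes_in_image)
  also have "\<dots> = (\<Sum>y\<in>D \<rightarrow>\<^sub>E X. real (card {\<sigma>. \<sigma> permutes X \<and> restrict \<sigma> D = y}) * F y)"
    by (intro sum.cong) auto
  also have "\<dots> \<le> (\<Sum>y\<in>D \<rightarrow>\<^sub>E X. fact (card X - card D) * F y)"
  proof (intro sum_mono mult_right_mono assms)
    fix y
    show "real (card {\<sigma>. \<sigma> permutes X \<and> restrict \<sigma> D = y}) \<le> fact (card X - card D)"
      using perm_restrict_card[OF assms(1,2), of y] by (metis of_nat_fact of_nat_le_iff)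
  qed
  also have "\<dots> = fact (card X - card D) * (\<Sum>y\<in>D \<rightarrow>\<^sub>E X. F y)"
    by (rule sum_distrib_left[symmetric])
  finally show ?thesis
    unfolding avg_def card_permutations[OF refl assms(1)] of_nat_fact times_divide_eq_left
    by (rule divide_right_mono) simp
qed

text \<open>The reciprocal of the multinomial coefficient of the type of the word \<open>w\<close>.\<close>

definition type_weight :: "'x set \<Rightarrow> ('x \<Rightarrow> 'c::finite) \<Rightarrow> real" where
  "type_weight X w = (\<Prod>c\<in>UNIV. fact (card {x\<in>X. w x = c})) / fact (card X)"

lemma type_weight_pos: "type_weight X w > 0"
  by (simp add: type_weight_def prod_pos)

lemma type_weight_nonneg [simp]: "0 \<le> type_weight X w"
  by (rule less_imp_le[OF type_weight_pos])

lemma type_weight_cong: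
  assumes "\<And>x. x \<in> X \<Longrightarrow> w x = w' x"
  shows "type_weight X w = type_weight X w'"
  unfolding type_weight_def using assms by (simp cong: conj_cong)

text \<open>The solutions are empty or a coset of the stabilizer of w, and a stabilizing permutation
  is determined by its restrictions to the letter classes.\<close>

lemma card_perm_word_le:
  fixes w :: "'x \<Rightarrow> 'c::finite"
  assumes "finite X"
  shows "card {\<sigma>. \<sigma> permutes X \<and> (\<forall>x\<in>X. w (\<sigma> x) = \<gamma> x)} \<le> (\<Prod>c\<in>UNIV. fact (card {x\<in>X. w x = c}))"
    (is "card ?A \<le> _")
proof (cases "?A = {}")
  case False
  define L where "L c = {x\<in>X. w x = c}" for c
  have fL: "finite (L c)" for c using assms by (simp add: L_def)
  define Stab where "Stab = {\<pi>. \<pi> permutes X \<and> (\<forall>x\<in>X. w (\<pi> x) = w x)}"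
  have fS: "finite Stab"
    by (rule finite_subset[OF _ finite_perms[OF assms]]) (auto simp: Stab_def)
  from False obtain \<tau> where \<tau>: "\<tau> permutes X" "\<And>x. x \<in> X \<Longrightarrow> w (\<tau> x) = \<gamma> x" by blast
  have "card ?A \<le> card Stab"
  proof (rule card_inj_on_le[where f = "\<lambda>\<sigma>. \<sigma> \<circ> iperm \<tau>", OF _ _ fS])
    show "inj_on (\<lambda>\<sigma>. \<sigma> \<circ> iperm \<tau>) ?A"
      by (rule inj_on_inverseI[where g = "\<lambda>\<pi>. \<pi> \<circ> \<tau>"])
        (simp only: o_assoc[symmetric] permutes_inv_o[OF \<tau>(1)] comp_id)
    show "(\<lambda>\<sigma>. \<sigma> \<circ> iperm \<tau>) ` ?A \<subseteq> Stab"
    proof (rule image_subsetI)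
      fix \<sigma> assume "\<sigma> \<in> ?A"
      then have s: "\<sigma> permutes X" "\<forall>x\<in>X. w (\<sigma> x) = \<gamma> x" by auto
      have "w (\<sigma> (iperm \<tau> x)) = w x" if "x \<in> X" for x
      proof -
        from that have "iperm \<tau> x \<in> X" using \<tau>(1) by (meson permutes_in_image permutes_inv)
        then show ?thesis
        using s(2) \<tau>(2)[of "iperm \<tau> x"] permutes_inverses(1)[OF \<tau>(1)] by simp
      qed
      then show "\<sigma> \<circ> iperm \<tau> \<in> Stab"
        using permutes_compose[OF permutes_inv[OF \<tau>(1)] s(1)] by (simp add: Stab_def)
    qed
  qed
  also have "\<dots> \<le> card (PiE UNIV (\<lambda>c. (perms (L c))))"
  proof (rule card_inj_on_le[where f = "\<lambda>\<pi> c x. if x \<in> L c then \<pi> x else x"])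
    show "inj_on (\<lambda>\<pi> c x. if x \<in> L c then \<pi> x else x) Stab"
    proof (rule inj_onI)
      fix \<pi> \<rho> assume st: "\<pi> \<in> Stab" "\<rho> \<in> Stab"
        and eq: "(\<lambda>c x. if x \<in> L c then \<pi> x else x) = (\<lambda>c x. if x \<in> L c then \<rho> x else x)"
      have "\<pi> x = \<rho> x" for x
      proof (cases "x \<in> X")
        case True
        with fun_cong[OF fun_cong[OF eq, of "w x"], of x] show ?thesis by (simp add: L_def)
      next
        case False
        then show ?thesis using st by (simp add: Stab_def permutes_def)
      qed
      then show "\<pi> = \<rho>" ..
    qed
    show "(\<lambda>\<pi> c x. if x \<in> L c then \<pi> x else x) ` Stab \<subseteq> PiE UNIV (\<lambda>c. (perms (L c)))"
    proof (intro image_subsetI PiE_I)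
      fix \<pi> c assume "\<pi> \<in> Stab"
      then have p: "\<pi> permutes X" "\<And>x. x \<in> X \<Longrightarrow> w (\<pi> x) = w x" by (auto simp: Stab_def)
      have "\<pi> ` L c \<subseteq> L c" using p by (auto simp: L_def permutes_in_image)
      moreover have "inj_on \<pi> (L c)" using p(1) by (meson permutes_inj_on)
      ultimately have "bij_betw \<pi> (L c) (L c)"
        using fL by (simp add: bij_betw_def endo_inj_surj)
      then have "bij_betw (\<lambda>x. if x \<in> L c then \<pi> x else x) (L c) (L c)"
        by (simp cong: bij_betw_cong)
      then show "(\<lambda>x. if x \<in> L c then \<pi> x else x) \<in> (perms (L c))"
        by (intro CollectI bij_imp_permutes) simp_all
    qed auto
    show "finite (PiE UNIV (\<lambda>c. (perms (L c))))"
      using fL by (intro finite_PiE) auto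
  qed
  also have "\<dots> = (\<Prod>c\<in>UNIV. fact (card (L c)))"
    using fL by (simp add: card_PiE card_permutations[OF refl])
  finally show ?thesis by (simp add: L_def)
qed (simp only: card.empty le0)

text \<open>A random rearrangement of w takes each value with probability at most the reciprocal of
  the class size. The sum keeps words of all types because the full sum factors over
  positions.\<close>

lemma avg_word_le:
  fixes w :: "'x \<Rightarrow> 'c::finite" and F :: "('x \<Rightarrow> 'c) \<Rightarrow> real"
  assumes "finite X" "\<And>\<gamma>. F \<gamma> \<ge> 0"
  shows "avg (perms X) (\<lambda>\<sigma>. F (restrict (w \<circ> \<sigma>) X)) \<le>
         type_weight X w * (\<Sum>\<gamma>\<in>X \<rightarrow>\<^sub>E UNIV. F \<gamma>)"
proof -
  have "(\<Sum>\<sigma> | \<sigma> permutes X. F (restrict (w \<circ> \<sigma>) X)) =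
      (\<Sum>\<gamma>\<in>X \<rightarrow>\<^sub>E UNIV. \<Sum>\<sigma> | \<sigma> \<in> (perms X) \<and> restrict (w \<circ> \<sigma>) X = \<gamma>. F (restrict (w \<circ> \<sigma>) X))"
    using assms by (intro sum.group[symmetric]) (auto simp: finite_PiE)
  also have "\<dots> = (\<Sum>\<gamma>\<in>X \<rightarrow>\<^sub>E UNIV. real (card {\<sigma>. \<sigma> permutes X \<and> restrict (w \<circ> \<sigma>) X = \<gamma>}) * F \<gamma>)"
    by (intro sum.cong) auto
  also have "\<dots> \<le> (\<Sum>\<gamma>\<in>X \<rightarrow>\<^sub>E UNIV. (\<Prod>c\<in>UNIV. fact (card {x\<in>X. w x = c})) * F \<gamma>)"
  proof (intro sum_mono mult_right_mono assms)
    fix \<gamma> :: "'x \<Rightarrow> 'c"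
    have "card {\<sigma>. \<sigma> permutes X \<and> restrict (w \<circ> \<sigma>) X = \<gamma>} \<le>
        card {\<sigma>. \<sigma> permutes X \<and> (\<forall>x\<in>X. w (\<sigma> x) = \<gamma> x)}"
    proof (rule card_mono)
      show "finite {\<sigma>. \<sigma> permutes X \<and> (\<forall>x\<in>X. w (\<sigma> x) = \<gamma> x)}"
        by (rule finite_subset[OF _ finite_perms[OF assms(1)]]) blast
    qed auto
    also have "\<dots> \<le> (\<Prod>c\<in>UNIV. fact (card {x\<in>X. w x = c}))"
      by (rule card_perm_word_le[OF assms(1)])
    finally have "real (card {\<sigma>. \<sigma> permutes X \<and> restrict (w \<circ> \<sigma>) X = \<gamma>}) \<le>
        real (\<Prod>c\<in>UNIV. fact (card {x\<in>X. w x = c}))"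
      by (rule of_nat_mono)
    then show "real (card {\<sigma>. \<sigma> permutes X \<and> restrict (w \<circ> \<sigma>) X = \<gamma>}) \<le>
        (\<Prod>c\<in>UNIV. fact (card {x\<in>X. w x = c}))"
      by (simp only: of_nat_prod of_nat_fact)
  qed
  also have "\<dots> = (\<Prod>c\<in>UNIV. fact (card {x\<in>X. w x = c})) * (\<Sum>\<gamma>\<in>X \<rightarrow>\<^sub>E UNIV. F \<gamma>)"
    by (rule sum_distrib_left[symmetric])
  finally show ?thesis
    unfolding avg_def card_permutations[OF refl assms(1)] of_nat_fact type_weight_def times_divide_eq_left
    by (rule divide_right_mono) simp
qed

text \<open>Each type class contributes exactly 1, so the sum counts the types, of which there are
  polynomially many. Appending a letter multiplies the sum by (n + q) / (n + 1), and Bernoulli's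
  inequality makes the product telescope.\<close>

lemma sum_type_weight_le:
  fixes X :: "'x set"
  assumes "finite X"
  shows "(\<Sum>w\<in>X \<rightarrow>\<^sub>E (UNIV :: 'c::finite set). type_weight X w) \<le> (real (card X) + 1) ^ CARD('c)"
  using assms
proof (induction X)
  case empty
  then show ?case by (simp add: type_weight_def)
next
  case (insert a X)
  let ?n = "card X" and ?q = "CARD('c)" and ?W = "X \<rightarrow>\<^sub>E (UNIV :: 'c set)"
  have upd: "type_weight (insert a X) (w(a := c)) =
      type_weight X w * ((real (card {x\<in>X. w x = c}) + 1) / (real ?n + 1))" for w :: "'x \<Rightarrow> 'c" and c
  proof -
    have *: "{x \<in> insert a X. (w(a := c)) x = e} =
        (if e = c then insert a {x\<in>X. w x = c} else {x\<in>X. w x = e})" for e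
      using insert.hyps by auto
    have "(\<Prod>e\<in>UNIV. fact (card {x \<in> insert a X. (w(a := c)) x = e}) :: real) =
       (\<Prod>e\<in>UNIV. fact (card {x\<in>X. w x = e}) * (if e = c then real (card {x\<in>X. w x = c}) + 1 else 1))"
      unfolding * using insert.hyps by (intro prod.cong refl) (simp add: algebra_simps)
    also have "\<dots> = (\<Prod>e\<in>UNIV. fact (card {x\<in>X. w x = e})) * (real (card {x\<in>X. w x = c}) + 1)"
      by (simp add: prod.distrib)
    finally show ?thesis
      using insert.hyps by (simp add: type_weight_def field_simps)
  qed
  have cnt: "(\<Sum>c\<in>UNIV. real (card {x\<in>X. w x = c})) = real ?n" for w :: "'x \<Rightarrow> 'c"
    using sum.group[OF insert.hyps(1) finite, of w UNIV "\<lambda>_. 1::real"] by simp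
  have "(\<Sum>w\<in>insert a X \<rightarrow>\<^sub>E (UNIV :: 'c set). type_weight (insert a X) w) =
      (\<Sum>z\<in>(UNIV :: 'c set) \<times> ?W. type_weight (insert a X) ((snd z)(a := fst z)))"
    unfolding PiE_insert_eq
    using inj_combinator[OF insert.hyps(2), of "\<lambda>_. UNIV :: 'c set"]
    by (subst sum.reindex) (simp_all add: split_def o_def)
  also have "\<dots> = (\<Sum>w\<in>?W. \<Sum>c\<in>UNIV. type_weight (insert a X) (w(a := c)))"
    by (subst sum.swap) (simp add: sum.cartesian_product split_def)
  also have "\<dots> = (\<Sum>w\<in>?W. type_weight X w * ((real ?n + real ?q) / (real ?n + 1)))"
    by (simp only: upd sum_distrib_left[symmetric] sum_divide_distrib[symmetric] sum.distrib cnt) simp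
  also have "\<dots> = (\<Sum>w\<in>?W. type_weight X w) * ((real ?n + real ?q) / (real ?n + 1))"
    by (rule sum_distrib_right[symmetric])
  also have "\<dots> \<le> (real ?n + 1) ^ ?q * ((real ?n + 2) / (real ?n + 1)) ^ ?q"
  proof (intro mult_mono insert.IH)
    have "1 + real ?q * (1 / (real ?n + 1)) \<le> (1 + 1 / (real ?n + 1)) ^ ?q"
      by (rule Bernoulli_inequality) (rule order_trans[of _ 0], auto)
    moreover have "1 + 1 / (real ?n + 1) = (real ?n + 2) / (real ?n + 1)" by (simp add: field_simps)
    moreover have "(real ?n + real ?q) / (real ?n + 1) \<le> 1 + real ?q * (1 / (real ?n + 1))"
      by (simp add: field_simps)
    ultimately show "(real ?n + real ?q) / (real ?n + 1) \<le> ((real ?n + 2) / (real ?n + 1)) ^ ?q"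
      by simp
  qed auto
  also have "\<dots> = (real (card (insert a X)) + 1) ^ ?q"
    using insert.hyps by (simp add: power_mult_distrib[symmetric] add.commute)
  finally show ?case .
qed

lemma choose_mult_le: "(a choose b) * (c choose e) \<le> (a + c) choose (b + e)"
proof -
  have "(a choose b) * (c choose (b + e - b)) \<le> (\<Sum>k\<le>b + e. (a choose k) * (c choose (b + e - k)))"
    by (rule member_le_sum) auto
  then show ?thesis by (simp add: vandermonde)
qed

lemma prod_choose_le:
  "finite C \<Longrightarrow> (\<Prod>c\<in>C. (f c choose g c)) \<le> (\<Sum>c\<in>C. f c) choose (\<Sum>c\<in>C. g c)"
proof (induction C rule: finite_induct)
  case (insert x C)
  have "(\<Prod>c\<in>insert x C. (f c choose g c)) \<le> (f x choose g x) * ((\<Sum>c\<in>C. f c) choose (\<Sum>c\<in>C. g c))"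
    using insert by simp
  also have "\<dots> \<le> (\<Sum>c\<in>insert x C. f c) choose (\<Sum>c\<in>insert x C. g c)"
    using insert choose_mult_le by simp
  finally show ?case .
qed simp

text \<open>Writing d words of type \<kappa> one after another gives a word of type d \<kappa>, so
  multinomial coefficients are supermultiplicative. This carries weights from the points back to the
  vertices.\<close>

lemma type_weight_blowup:
  fixes w :: "'x \<Rightarrow> 'c::finite"
  assumes "finite I"
  shows "type_weight (I \<times> {..<d}) (\<lambda>x. w (fst x)) \<le> type_weight I w ^ d"
proof -
  define \<kappa> where "\<kappa> c = card {x\<in>I. w x = c}" for c
  have n: "(\<Sum>c\<in>UNIV. \<kappa> c) = card I"
    using sum.group[OF assms finite, of w UNIV "\<lambda>_. 1::nat"] by (simp add: \<kappa>_def)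
  have "{x \<in> I \<times> {..<d}. w (fst x) = c} = {x\<in>I. w x = c} \<times> {..<d}" for c by auto
  then have k: "card {x \<in> I \<times> {..<d}. w (fst x) = c} = d * \<kappa> c" for c
    by (simp add: \<kappa>_def card_cartesian_product)
  \<comment> \<open>In this normalization the induction step multiplies by
    \<open>Suc d * m choose m\<close>, on the left for each letter class and on the right for the
    total; Vandermonde's identity compares the two.\<close>
  have "(\<Prod>c\<in>UNIV. fact (d * \<kappa> c) / fact (\<kappa> c) ^ d :: real) \<le> fact (d * card I) / fact (card I) ^ d"
  proof (induction d)
    case (Suc d)
    have step: "fact (Suc d * m) / fact m ^ Suc d = (fact (d * m) / fact m ^ d) * real (Suc d * m choose m)" for m
    proof -
      have "fact m * fact (Suc d * m - m) * (Suc d * m choose m) = (fact (Suc d * m) :: nat)"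
        by (rule binomial_fact_lemma) simp
      then have "real (fact (Suc d * m)) = real (fact m * fact (d * m) * (Suc d * m choose m))"
        by simp
      then show ?thesis by simp
    qed
    have "(\<Prod>c\<in>UNIV. fact (Suc d * \<kappa> c) / fact (\<kappa> c) ^ Suc d :: real) =
       (\<Prod>c\<in>UNIV. fact (d * \<kappa> c) / fact (\<kappa> c) ^ d) * real (\<Prod>c\<in>UNIV. Suc d * \<kappa> c choose \<kappa> c)"
      unfolding step prod.distrib by simp
    also have "\<dots> \<le> (fact (d * card I) / fact (card I) ^ d) * real (Suc d * card I choose card I)"
    proof (intro mult_mono Suc.IH)
      have "(\<Prod>c\<in>UNIV. Suc d * \<kappa> c choose \<kappa> c) \<le> (\<Sum>c\<in>UNIV. Suc d * \<kappa> c) choose (\<Sum>c\<in>UNIV. \<kappa> c)"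
        by (rule prod_choose_le) simp
      also have "(\<Sum>c\<in>UNIV. Suc d * \<kappa> c) = Suc d * card I"
        by (simp only: sum_distrib_left[symmetric] n)
      finally show "real (\<Prod>c\<in>UNIV. Suc d * \<kappa> c choose \<kappa> c) \<le> real (Suc d * card I choose card I)"
        by (simp only: n of_nat_le_iff)
    qed (auto intro!: prod_nonneg)
    also have "\<dots> = fact (Suc d * card I) / fact (card I) ^ Suc d" by (rule step[symmetric])
    finally show ?case .
  qed simp
  then have "(\<Prod>c\<in>UNIV. fact (d * \<kappa> c)) / (\<Prod>c\<in>UNIV. fact (\<kappa> c)) ^ d \<le>
      (fact (d * card I) / fact (card I) ^ d :: real)"
    by (simp add: prod_dividef prod_power_distrib)
  moreover have "(\<Prod>c\<in>UNIV. fact (\<kappa> c) :: real) > 0" by (simp add: prod_pos)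
  ultimately have "(\<Prod>c\<in>UNIV. fact (d * \<kappa> c)) / fact (d * card I) \<le>
      ((\<Prod>c\<in>UNIV. fact (\<kappa> c)) / fact (card I) :: real) ^ d"
    by (simp add: field_simps)
  then show ?thesis
    by (simp add: type_weight_def k \<kappa>_def[symmetric] card_cartesian_product mult.commute)
qed

section \<open>Uncertainty principle and random swaps\<close>

lemma avg_mult_avg: "avg A f * avg B g = avg A (\<lambda>x. avg B (\<lambda>y. f x * g y))"
  by (simp only: avg_mult_left avg_mult_right)

lemma cnj_avg: "cnj (avg A f) = avg A (\<lambda>x. cnj (f x))"
  by (simp add: avg_def)

text \<open>Parseval: expanding the squared norm produces two independent copies x and y, and
  orthogonality over B retains the pairs with \<open>R x y\<close>. A second moment becomes a
  collision probability.\<close>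

lemma sum_norm_avg_sq:
  assumes "\<And>x y. x \<in> A \<Longrightarrow> y \<in> A \<Longrightarrow>
      (\<Sum>a\<in>B. f a x * cnj (f a y)) = (if R x y then of_real C else 0)"
  shows "(\<Sum>a\<in>B. (norm (avg A (f a)))\<^sup>2) = C * avg A (\<lambda>x. avg A (\<lambda>y. of_bool (R x y)))"
proof -
  have "complex_of_real (\<Sum>a\<in>B. (norm (avg A (f a)))\<^sup>2) = (\<Sum>a\<in>B. avg A (f a) * cnj (avg A (f a)))"
    by (simp only: of_real_sum complex_norm_square)
  also have "\<dots> = (\<Sum>a\<in>B. avg A (\<lambda>x. avg A (\<lambda>y. f a x * cnj (f a y))))"
    by (simp only: cnj_avg avg_mult_avg)
  also have "\<dots> = avg A (\<lambda>x. avg A (\<lambda>y. \<Sum>a\<in>B. f a x * cnj (f a y)))"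
    by (simp only: sum_avg)
  also have "\<dots> = avg A (\<lambda>x. avg A (\<lambda>y. of_real (C * of_bool (R x y))))"
    by (intro avg_cong) (simp add: assms)
  also have "\<dots> = of_real (C * avg A (\<lambda>x. avg A (\<lambda>y. of_bool (R x y))))"
    by (simp add: avg_def sum_distrib_left sum_divide_distrib)
  finally show ?thesis by (simp only: of_real_eq_iff)
qed

lemma sum_le_sqrt_sum_sq:
  fixes f :: "'a \<Rightarrow> real"
  shows "(\<Sum>a\<in>B. f a) \<le> sqrt (card B * (\<Sum>a\<in>B. (f a)\<^sup>2))"
proof (rule real_le_rsqrt)
  show "(\<Sum>a\<in>B. f a)\<^sup>2 \<le> card B * (\<Sum>a\<in>B. (f a)\<^sup>2)"
    using Cauchy_Schwarz_ineq_sum[of "\<lambda>_. 1" f B] by simp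
qed

lemma perms_comp_right:
  assumes "\<tau> permutes X"
  shows "avg (perms X) (\<lambda>\<sigma>. f (\<sigma> \<circ> \<tau>)) = avg (perms X) f"
proof (rule avg_reindex)
  show "bij_betw (\<lambda>\<sigma>. \<sigma> \<circ> \<tau>) (perms X) (perms X)"
    by (rule bij_betwI[where g = "\<lambda>\<sigma>. \<sigma> \<circ> iperm \<tau>"])
      (auto simp: o_assoc[symmetric] permutes_inv_o[OF assms] intro!: permutes_compose assms permutes_inv)
qed

lemma prod_perm_reindex:
  assumes "\<tau> permutes X"
  shows "(\<Prod>x\<in>X. f (\<tau> x)) = (\<Prod>x\<in>X. f x)"
  using prod.permute[OF assms, of f] by (simp add: o_def)

text \<open>The average depends on \<alpha> only through its type, so a single value is bounded by
  the square mass over all words times the weight of \<alpha>. Parseval turns this mass into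
  \<open>CARD('c) ^ card I\<close> times the probability that two random arrangements of \<beta>
  coincide, which is at most the weight of \<beta>.\<close>

lemma uncertainty:
  fixes \<psi> :: "'c::finite \<Rightarrow> 'c \<Rightarrow> complex" and I :: "'i set"
  assumes fin: "finite I"
    and orth: "\<And>b b'. (\<Sum>a\<in>UNIV. \<psi> a b * cnj (\<psi> a b')) = (if b = b' then of_nat CARD('c) else 0)"
  shows "norm (avg (perms I) (\<lambda>\<pi>. \<Prod>i\<in>I. \<psi> (\<alpha> i) (\<beta> (\<pi> i)))) \<le>
    sqrt (real CARD('c) ^ card I * type_weight I \<alpha> * type_weight I \<beta>)"
proof -
  let ?P = "perms I"
  define G where "G a = avg ?P (\<lambda>\<pi>. \<Prod>i\<in>I. \<psi> (a i) (\<beta> (\<pi> i)))" for a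
  have inv: "G (restrict (\<alpha> \<circ> \<tau>) I) = G \<alpha>" if "\<tau> permutes I" for \<tau>
  proof -
    have "G (restrict (\<alpha> \<circ> \<tau>) I) = avg ?P (\<lambda>\<pi>. \<Prod>i\<in>I. \<psi> (\<alpha> (\<tau> i)) (\<beta> ((\<pi> \<circ> \<tau>) i)))"
      unfolding G_def by (subst perms_comp_right[OF that, symmetric]) (simp cong: prod.cong)
    also have "\<dots> = G \<alpha>"
      unfolding G_def o_def
      by (subst prod_perm_reindex[OF that, of "\<lambda>i. \<psi> (\<alpha> i) (\<beta> (_ i))"]) simp
    finally show ?thesis .
  qed
  have "(norm (G \<alpha>))\<^sup>2 = avg ?P (\<lambda>\<tau>. (norm (G \<alpha>))\<^sup>2)"
    by (rule avg_const[symmetric]) (simp_all add: fin)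
  also have "\<dots> = avg ?P (\<lambda>\<tau>. (norm (G (restrict (\<alpha> \<circ> \<tau>) I)))\<^sup>2)"
    by (intro avg_cong) (simp add: inv)
  also have "\<dots> \<le> type_weight I \<alpha> * (\<Sum>a\<in>I \<rightarrow>\<^sub>E UNIV. (norm (G a))\<^sup>2)"
    by (rule avg_word_le[OF fin]) simp
  also have "(\<Sum>a\<in>I \<rightarrow>\<^sub>E UNIV. (norm (G a))\<^sup>2) = real CARD('c) ^ card I *
      avg ?P (\<lambda>\<pi>. avg ?P (\<lambda>\<pi>'. of_bool (restrict (\<beta> \<circ> \<pi>) I = restrict (\<beta> \<circ> \<pi>') I)))"
    unfolding G_def
  proof (rule sum_norm_avg_sq)
    fix \<pi> \<pi>'
    have "(\<Sum>a\<in>I \<rightarrow>\<^sub>E UNIV. (\<Prod>i\<in>I. \<psi> (a i) (\<beta> (\<pi> i))) * cnj (\<Prod>i\<in>I. \<psi> (a i) (\<beta> (\<pi>' i)))) =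
       (\<Sum>a\<in>I \<rightarrow>\<^sub>E UNIV. \<Prod>i\<in>I. \<psi> (a i) (\<beta> (\<pi> i)) * cnj (\<psi> (a i) (\<beta> (\<pi>' i))))"
      by (simp add: prod.distrib)
    also have "\<dots> = (\<Prod>i\<in>I. \<Sum>a\<in>UNIV. \<psi> a (\<beta> (\<pi> i)) * cnj (\<psi> a (\<beta> (\<pi>' i))))"
      using fin by (intro prod_sum_PiE[symmetric]) auto
    also have "\<dots> = (\<Prod>i\<in>I. if \<beta> (\<pi> i) = \<beta> (\<pi>' i) then of_nat CARD('c) else 0)"
      by (simp only: orth)
    also have "\<dots> = (if restrict (\<beta> \<circ> \<pi>) I = restrict (\<beta> \<circ> \<pi>') I then of_nat CARD('c) ^ card I else 0)"
    proof (cases "\<forall>i\<in>I. \<beta> (\<pi> i) = \<beta> (\<pi>' i)")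
      case True
      then have "restrict (\<beta> \<circ> \<pi>) I = restrict (\<beta> \<circ> \<pi>') I" by (auto simp: fun_eq_iff)
      with True show ?thesis by simp
    next
      case False
      then obtain i where i: "i \<in> I" "\<beta> (\<pi> i) \<noteq> \<beta> (\<pi>' i)" by blast
      then have "restrict (\<beta> \<circ> \<pi>) I \<noteq> restrict (\<beta> \<circ> \<pi>') I"
        by (metis comp_apply restrict_apply')
      moreover have "(\<Prod>i\<in>I. if \<beta> (\<pi> i) = \<beta> (\<pi>' i) then of_nat CARD('c) else 0 :: complex) = 0"
        using i fin by (intro prod_zero bexI[of _ i]) simp_all
      ultimately show ?thesis by simp
    qed
    finally show "(\<Sum>a\<in>I \<rightarrow>\<^sub>E UNIV. (\<Prod>i\<in>I. \<psi> (a i) (\<beta> (\<pi> i))) * cnj (\<Prod>i\<in>I. \<psi> (a i) (\<beta> (\<pi>' i)))) =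
       (if restrict (\<beta> \<circ> \<pi>) I = restrict (\<beta> \<circ> \<pi>') I then complex_of_real (real CARD('c) ^ card I) else 0)"
      by simp
  qed
  finally have main: "(norm (G \<alpha>))\<^sup>2 \<le> type_weight I \<alpha> * (real CARD('c) ^ card I *
      avg ?P (\<lambda>\<pi>. avg ?P (\<lambda>\<pi>'. of_bool (restrict (\<beta> \<circ> \<pi>) I = restrict (\<beta> \<circ> \<pi>') I))))" .
  have "avg ?P (\<lambda>\<pi>. avg ?P (\<lambda>\<pi>'. of_bool (restrict (\<beta> \<circ> \<pi>) I = restrict (\<beta> \<circ> \<pi>') I)))
      \<le> type_weight I \<beta>"
  proof (rule avg_le_const)
    fix \<pi> assume "\<pi> \<in> ?P"
    have "avg ?P (\<lambda>\<pi>'. of_bool (restrict (\<beta> \<circ> \<pi>) I = restrict (\<beta> \<circ> \<pi>') I)) \<le>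
       type_weight I \<beta> * (\<Sum>\<gamma>\<in>I \<rightarrow>\<^sub>E UNIV. of_bool (restrict (\<beta> \<circ> \<pi>) I = \<gamma>))"
      by (rule avg_word_le[OF fin, where F = "\<lambda>\<gamma>. of_bool (restrict (\<beta> \<circ> \<pi>) I = \<gamma>)"]) simp
    also have "(\<Sum>\<gamma>\<in>I \<rightarrow>\<^sub>E UNIV. of_bool (restrict (\<beta> \<circ> \<pi>) I = \<gamma>) :: real) = 1"
      using fin by (simp add: of_bool_def finite_PiE)
    finally show "avg ?P (\<lambda>\<pi>'. of_bool (restrict (\<beta> \<circ> \<pi>) I = restrict (\<beta> \<circ> \<pi>') I)) \<le> type_weight I \<beta>"
      by (simp only: mult_1_right)
  qed (simp_all add: fin)
  then have "type_weight I \<alpha> * (real CARD('c) ^ card I *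
      avg ?P (\<lambda>\<pi>. avg ?P (\<lambda>\<pi>'. of_bool (restrict (\<beta> \<circ> \<pi>) I = restrict (\<beta> \<circ> \<pi>') I))))
      \<le> type_weight I \<alpha> * (real CARD('c) ^ card I * type_weight I \<beta>)"
    by (intro mult_left_mono) (simp_all add: type_weight_pos less_imp_le)
  with main have "(norm (G \<alpha>))\<^sup>2 \<le> real CARD('c) ^ card I * type_weight I \<alpha> * type_weight I \<beta>"
    by (simp only: mult_ac)
  then show ?thesis
    unfolding G_def[symmetric] by (rule real_le_rsqrt)
qed

text \<open>Precomposing with \<open>t q\<close> preserves the uniform law and multiplies H by
  \<open>z q\<close>, so H may be replaced by the mean of both versions. The third assumption leaves
  the factors already created unchanged under later swaps.\<close>

lemma avg_perms_swap:
  fixes H :: "('x \<Rightarrow> 'x) \<Rightarrow> complex" and t :: "nat \<Rightarrow> 'x \<Rightarrow> 'x"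
  assumes "\<And>q. q < Q \<Longrightarrow> t q permutes X"
    and "\<And>q \<sigma>. q < Q \<Longrightarrow> \<sigma> permutes X \<Longrightarrow> H (\<sigma> \<circ> t q) = H \<sigma> * z q \<sigma>"
    and "\<And>q r \<sigma>. q < Q \<Longrightarrow> r < q \<Longrightarrow> \<sigma> permutes X \<Longrightarrow> z r (\<sigma> \<circ> t q) = z r \<sigma>"
  shows "avg (perms X) H = avg (perms X) (\<lambda>\<sigma>. H \<sigma> * (\<Prod>q<Q. (1 + z q \<sigma>) / 2))"
proof -
  let ?P = "perms X"
  have "m \<le> Q \<Longrightarrow> avg ?P H = avg ?P (\<lambda>\<sigma>. H \<sigma> * (\<Prod>q<m. (1 + z q \<sigma>) / 2))" for m
  proof (induction m)
    case (Suc m)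
    let ?g = "\<lambda>\<sigma>. H \<sigma> * (\<Prod>q<m. (1 + z q \<sigma>) / 2)"
    have m: "m < Q" using Suc by simp
    have "avg ?P ?g = avg ?P (\<lambda>\<sigma>. ?g (\<sigma> \<circ> t m))"
      by (rule perms_comp_right[OF assms(1)[OF m], symmetric])
    also have "\<dots> = avg ?P (\<lambda>\<sigma>. ?g \<sigma> * z m \<sigma>)"
      using assms(2,3)[OF m] by (intro avg_cong) (simp cong: prod.cong_simp)
    finally have "avg ?P ?g = 1 / 2 * (avg ?P ?g + avg ?P (\<lambda>\<sigma>. ?g \<sigma> * z m \<sigma>))" by simp
    also have "\<dots> = avg ?P (\<lambda>\<sigma>. 1 / 2 * (?g \<sigma> + ?g \<sigma> * z m \<sigma>))"
      by (simp only: avg_mult_left avg_add)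
    also have "\<dots> = avg ?P (\<lambda>\<sigma>. ?g \<sigma> * ((1 + z m \<sigma>) / 2))"
      by (intro avg_cong) (simp add: algebra_simps)
    finally show ?case using Suc by (simp add: mult.assoc)
  qed simp
  then show ?thesis by blast
qed

section \<open>Disjoint blocks and sampling without replacement\<close>

lemma sum_PiE_Un:
  assumes "A \<inter> B = {}"
  shows "(\<Sum>y\<in>A \<union> B \<rightarrow>\<^sub>E T. F (restrict y A) (restrict y B)) = (\<Sum>a\<in>A \<rightarrow>\<^sub>E T. \<Sum>b\<in>B \<rightarrow>\<^sub>E T. F a b)"
  unfolding sum.cartesian_product
proof (rule sum.reindex_bij_witness[where i = "\<lambda>z x. if x \<in> A then fst z x else snd z x"
      and j = "\<lambda>y. (restrict y A, restrict y B)"])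
  fix y assume "y \<in> A \<union> B \<rightarrow>\<^sub>E T"
  then show "(\<lambda>x. if x \<in> A then fst (restrict y A, restrict y B) x else snd (restrict y A, restrict y B) x) = y"
    by (auto simp: fun_eq_iff dest: PiE_arb)
next
  fix z assume "z \<in> (A \<rightarrow>\<^sub>E T) \<times> (B \<rightarrow>\<^sub>E T)"
  then have z: "fst z \<in> A \<rightarrow>\<^sub>E T" "snd z \<in> B \<rightarrow>\<^sub>E T" by auto
  have "restrict (\<lambda>x. if x \<in> A then fst z x else snd z x) A = fst z"
    using PiE_arb[OF z(1)] by (auto simp: fun_eq_iff)
  moreover have "restrict (\<lambda>x. if x \<in> A then fst z x else snd z x) B = snd z"
    using PiE_arb[OF z(2)] assms by (auto simp: fun_eq_iff)
  ultimately show "(restrict (\<lambda>x. if x \<in> A then fst z x else snd z x) A,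
      restrict (\<lambda>x. if x \<in> A then fst z x else snd z x) B) = z" by (simp add: prod_eq_iff)
  show "(\<lambda>x. if x \<in> A then fst z x else snd z x) \<in> A \<union> B \<rightarrow>\<^sub>E T"
    using z by (intro PiE_I) (auto dest: PiE_mem PiE_arb)
qed auto

lemma sum_PiE_blocks:
  fixes f :: "'i \<Rightarrow> ('x \<Rightarrow> 'y) \<Rightarrow> 'r::comm_semiring_1"
  assumes "finite I" "disjoint_family_on B I"
  shows "(\<Sum>y\<in>(\<Union>i\<in>I. B i) \<rightarrow>\<^sub>E T. \<Prod>i\<in>I. f i (restrict y (B i))) =
    (\<Prod>i\<in>I. \<Sum>y\<in>B i \<rightarrow>\<^sub>E T. f i y)"
  using assms
proof (induction I)
  case (insert a I)
  let ?U = "\<Union>i\<in>I. B i"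
  have dis: "B a \<inter> ?U = {}" "disjoint_family_on B I"
    using insert.prems insert.hyps by (auto simp: disjoint_family_on_def)
  have "(\<Sum>y\<in>(\<Union>i\<in>insert a I. B i) \<rightarrow>\<^sub>E T. \<Prod>i\<in>insert a I. f i (restrict y (B i))) =
     (\<Sum>y\<in>B a \<union> ?U \<rightarrow>\<^sub>E T. f a (restrict y (B a)) * (\<Prod>i\<in>I. f i (restrict (restrict y ?U) (B i))))"
  proof (intro sum.cong)
    fix y :: "'x \<Rightarrow> 'y"
    have "restrict (restrict y ?U) (B i) = restrict y (B i)" if "i \<in> I" for i
      using that by (auto simp: fun_eq_iff restrict_def)
    then show "(\<Prod>i\<in>insert a I. f i (restrict y (B i))) =
        f a (restrict y (B a)) * (\<Prod>i\<in>I. f i (restrict (restrict y ?U) (B i)))"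
      using insert.hyps by (simp cong: prod.cong_simp)
  qed simp
  also have "\<dots> = (\<Sum>y\<in>B a \<rightarrow>\<^sub>E T. \<Sum>y'\<in>?U \<rightarrow>\<^sub>E T. f a y * (\<Prod>i\<in>I. f i (restrict y' (B i))))"
    by (rule sum_PiE_Un[OF dis(1)])
  also have "\<dots> = (\<Sum>y\<in>B a \<rightarrow>\<^sub>E T. f a y) * (\<Sum>y'\<in>?U \<rightarrow>\<^sub>E T. \<Prod>i\<in>I. f i (restrict y' (B i)))"
    by (simp add: sum_product)
  also have "\<dots> = (\<Prod>i\<in>insert a I. \<Sum>y\<in>B i \<rightarrow>\<^sub>E T. f i y)"
    unfolding insert.IH[OF dis(2)] by (rule prod.insert[symmetric, OF insert.hyps])
  finally show ?case .
qed simp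

text \<open>Once the permutation is replaced by an arbitrary function, the blocks are independent,
  and each meets its targets with probability at least \<open>\<gamma> ^ r\<close>, which saves a
  factor \<rho>. The factorial ratio is the cost of sampling without replacement.\<close>

lemma avg_perm_blocks_le:
  fixes X :: "'x set" and B :: "nat \<Rightarrow> 'x set" and \<gamma> \<rho> :: real
  assumes fin: "finite X" and dis: "disjoint_family_on B {..<Q}"
    and sub: "\<And>q. q < Q \<Longrightarrow> B q \<subseteq> X" and card: "\<And>q. q < Q \<Longrightarrow> card (B q) = r"
    and T: "\<And>b. T b \<subseteq> X" "\<And>b. \<gamma> * card X \<le> card (T b)" and \<gamma>: "0 \<le> \<gamma>" and \<rho>: "0 \<le> \<rho>" "\<rho> \<le> 1"
  shows "avg (perms X) (\<lambda>\<sigma>. \<Prod>q<Q. if \<forall>b\<in>B q. \<sigma> b \<in> T b then \<rho> else 1) \<le>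
    fact (card X - r * Q) / fact (card X) * real (card X) ^ (r * Q) * (1 - (1 - \<rho>) * \<gamma> ^ r) ^ Q"
proof -
  let ?N = "card X"
  define D where "D = (\<Union>q\<in>{..<Q}. B q)"
  have fB: "finite (B q)" if "q < Q" for q using sub[OF that] fin finite_subset by blast
  have cD: "card D = r * Q"
    unfolding D_def using dis fB card
    by (subst card_UN_disjoint') (auto simp: mult.commute)
  define f where "f q y = (if \<forall>b\<in>B q. y b \<in> T b then \<rho> else 1)" for q and y :: "'x \<Rightarrow> 'x"
  have one: "0 \<le> (\<Sum>y\<in>B q \<rightarrow>\<^sub>E X. f q y) \<and> (\<Sum>y\<in>B q \<rightarrow>\<^sub>E X. f q y) \<le> real ?N ^ r * (1 - (1 - \<rho>) * \<gamma> ^ r)" if q: "q < Q" for q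
  proof
    show "0 \<le> (\<Sum>y\<in>B q \<rightarrow>\<^sub>E X. f q y)"
      using \<rho> by (intro sum_nonneg) (auto simp: f_def)
    have fP: "finite (B q \<rightarrow>\<^sub>E X)" using fB[OF q] fin by (simp add: finite_PiE)
    have sub': "PiE (B q) T \<subseteq> B q \<rightarrow>\<^sub>E X" using T(1) by (intro PiE_mono) auto
    have "(\<Sum>y\<in>B q \<rightarrow>\<^sub>E X. f q y) = (\<Sum>y\<in>B q \<rightarrow>\<^sub>E X. 1 - (1 - \<rho>) * of_bool (y \<in> PiE (B q) T))"
      by (intro sum.cong) (auto simp: f_def PiE_iff)
    also have "\<dots> = real (card (B q \<rightarrow>\<^sub>E X)) - (1 - \<rho>) * real (card (PiE (B q) T))"
      using fP sub' by (simp add: sum_subtractf sum_distrib_left[symmetric] of_bool_def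
        sum.If_cases Int_absorb1 Int_absorb2)
    also have "real (card (B q \<rightarrow>\<^sub>E X)) = real ?N ^ r"
      using card[OF q] fB[OF q] by (simp add: card_PiE)
    also have "real (card (PiE (B q) T)) = (\<Prod>b\<in>B q. real (card (T b)))"
      using fB[OF q] by (simp add: card_PiE)
    finally have "(\<Sum>y\<in>B q \<rightarrow>\<^sub>E X. f q y) = real ?N ^ r - (1 - \<rho>) * (\<Prod>b\<in>B q. real (card (T b)))" .
    moreover have "(\<gamma> * ?N) ^ r \<le> (\<Prod>b\<in>B q. real (card (T b)))"
      unfolding card[OF q, symmetric] prod_constant[symmetric] using T(2) \<gamma> by (intro prod_mono) auto
    ultimately have "(\<Sum>y\<in>B q \<rightarrow>\<^sub>E X. f q y) \<le> real ?N ^ r - (1 - \<rho>) * (\<gamma> * ?N) ^ r"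
      using \<rho> by (simp add: mult_left_mono)
    then show "(\<Sum>y\<in>B q \<rightarrow>\<^sub>E X. f q y) \<le> real ?N ^ r * (1 - (1 - \<rho>) * \<gamma> ^ r)"
      by (simp add: power_mult_distrib algebra_simps)
  qed
  have "avg (perms X) (\<lambda>\<sigma>. \<Prod>q<Q. if \<forall>b\<in>B q. \<sigma> b \<in> T b then \<rho> else 1) =
      avg (perms X) (\<lambda>\<sigma>. \<Prod>q<Q. f q (restrict (restrict \<sigma> D) (B q)))"
    by (intro avg_cong prod.cong refl) (auto simp: f_def D_def)
  also have "\<dots> \<le> fact (?N - card D) / fact ?N * (\<Sum>y\<in>D \<rightarrow>\<^sub>E X. \<Prod>q<Q. f q (restrict y (B q)))"
    using sub \<rho> by (intro avg_restrict_perm_le[OF fin, where F = "\<lambda>y. \<Prod>q<Q. f q (restrict y (B q))"])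
       (auto simp: D_def f_def intro!: prod_nonneg)
  also have "(\<Sum>y\<in>D \<rightarrow>\<^sub>E X. \<Prod>q<Q. f q (restrict y (B q))) = (\<Prod>q<Q. \<Sum>y\<in>B q \<rightarrow>\<^sub>E X. f q y)"
    unfolding D_def by (rule sum_PiE_blocks) (use dis in auto)
  also have "\<dots> \<le> (\<Prod>q<Q. real ?N ^ r * (1 - (1 - \<rho>) * \<gamma> ^ r))"
    using one by (intro prod_mono) auto
  also have "\<dots> = real ?N ^ (r * Q) * (1 - (1 - \<rho>) * \<gamma> ^ r) ^ Q"
    by (simp add: power_mult_distrib power_mult)
  finally show ?thesis by (simp add: cD divide_right_mono mult_left_mono mult.assoc)
qed

lemma fact_ratio_ge: "m \<le> N \<Longrightarrow> real (N - m) ^ m * fact (N - m) \<le> fact N"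
proof (induction m)
  case (Suc m)
  have s: "N - m = Suc (N - Suc m)" using Suc by simp
  have "real (N - Suc m) ^ Suc m * fact (N - Suc m) \<le> real (N - m) ^ Suc m * fact (N - Suc m)"
    by (intro mult_right_mono power_mono) auto
  also have "\<dots> = real (N - m) ^ m * fact (N - m)"
    unfolding s by simp
  also have "\<dots> \<le> fact N" using Suc by simp
  finally show ?case .
qed simp

text \<open>Every factor of the falling factorial is at least N - m, and N / (N - m) is at most 1 +
  2 m / N. The exponent is quadratic in m: if m is a small multiple of N, it is a small multiple of
  m and can be absorbed by a gain exponential in m.\<close>

lemma fact_ratio_exp_le:
  assumes "2 * m \<le> N" "0 < N"
  shows "fact (N - m) / fact N * real N ^ m \<le> exp (2 * real m ^ 2 / N)"
proof -
  have pos: "real (N - m) > 0" using assms by linarith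
  have "fact (N - m) / fact N \<le> 1 / real (N - m) ^ m"
    using fact_ratio_ge[of m N] assms pos by (simp add: field_simps)
  then have "fact (N - m) / fact N * real N ^ m \<le> 1 / real (N - m) ^ m * real N ^ m"
    by (rule mult_right_mono) simp
  also have "\<dots> = (real N / real (N - m)) ^ m" by (simp add: power_divide)
  also have "\<dots> \<le> (1 + 2 * real m / N) ^ m"
  proof (rule power_mono)
    have "real N * real N \<le> (real N + 2 * real m) * (real N - real m)"
      using assms mult_left_mono[of "2 * real m" "real N" "real m"] by (simp add: algebra_simps)
    then show "real N / real (N - m) \<le> 1 + 2 * real m / N"
      using assms pos by (simp add: field_simps of_nat_diff)
  qed simp
  also have "\<dots> \<le> exp (2 * real m / N) ^ m"
    by (intro power_mono) auto
  also have "\<dots> = exp (2 * real m ^ 2 / N)"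
    by (simp add: exp_of_nat_mult[symmetric] power2_eq_square field_simps)
  finally show ?thesis .
qed

section \<open>Collisions of near-constant words\<close>

lemma power_over_fact_le_exp: "real k ^ k / fact k \<le> exp (real k)"
proof -
  have "real k ^ k / fact k = (\<Sum>i\<in>{k}. inverse (fact i) * real k ^ i)"
    by (simp add: field_simps)
  also have "\<dots> \<le> (\<Sum>i. inverse (fact i) * real k ^ i)"
    by (rule sum_le_suminf[OF summable_exp]) auto
  finally show ?thesis by (simp add: exp_def divide_inverse mult.commute scaleR_conv_of_real)
qed

lemma binomial_le_exp_power: "real (n choose k) \<le> (exp 1 * n / k) ^ k"
proof (cases "k = 0")
  case False
  have "(n choose k) * fact k \<le> n ^ k" by (rule binomial_fact_pow)
  then have "real (n choose k) * fact k \<le> real n ^ k"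
    by (metis of_nat_fact of_nat_le_iff of_nat_mult of_nat_power)
  then have "real (n choose k) \<le> real n ^ k / fact k" by (simp add: field_simps)
  also have "\<dots> = (real n / k) ^ k * (real k ^ k / fact k)"
    using False by (simp add: power_divide)
  also have "\<dots> \<le> (real n / k) ^ k * exp (real k)"
    by (intro mult_left_mono power_over_fact_le_exp) simp
  also have "\<dots> = (exp 1 * n / k) ^ k"
    by (simp add: exp_of_nat_mult[symmetric] power_mult_distrib power_divide)
  finally show ?thesis .
qed simp

text \<open>A value in L hit only once by f and g together would receive \<open>u x\<close> on one
  side and 0 on the other. So every value is hit at least twice, out of \<open>2 * card O'\<close>
  hits. Both maps send the points outside \<open>O'\<close> outside L, where they do not enter the
  sums.\<close>

lemma no_single_hit:
  fixes u :: "'s \<Rightarrow> 'a::ab_group_add"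
  assumes fin: "finite S" and nz: "\<And>x. x \<in> S \<Longrightarrow> u x \<noteq> 0"
    and eq: "\<And>l. l \<in> L \<Longrightarrow> (\<Sum>x | x \<in> S \<and> f x = l. u x) = (\<Sum>x | x \<in> S \<and> g x = l. u x)"
    and f: "\<And>x. x \<in> S \<Longrightarrow> f x \<in> L \<longleftrightarrow> x \<in> O'" and g: "\<And>x. x \<in> S \<Longrightarrow> g x \<in> L \<longleftrightarrow> x \<in> O'" and sub: "O' \<subseteq> S"
  shows "card (f ` O' \<union> g ` O') \<le> card O'"
proof -
  let ?R = "f ` O' \<union> g ` O'"
  have fO: "finite O'" using sub fin finite_subset by blast
  have "2 \<le> card {x \<in> O'. f x = l} + card {x \<in> O'. g x = l}" if l: "l \<in> ?R" for l
  proof (rule ccontr)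
    assume "\<not> ?thesis"
    moreover have lL: "l \<in> L" using l f g sub by blast
    have sets: "{x \<in> S. f x = l} = {x \<in> O'. f x = l}" "{x \<in> S. g x = l} = {x \<in> O'. g x = l}"
      using f g sub lL by auto
    have "{x \<in> O'. f x = l} \<noteq> {} \<or> {x \<in> O'. g x = l} \<noteq> {}" using l by auto
    then have "card {x \<in> O'. f x = l} + card {x \<in> O'. g x = l} \<noteq> 0"
      using fO by auto
    ultimately consider "card {x \<in> O'. f x = l} = 1" "card {x \<in> O'. g x = l} = 0"
      | "card {x \<in> O'. f x = l} = 0" "card {x \<in> O'. g x = l} = 1" by linarith
    then show False
    proof cases
      case 1
      then obtain x where x: "{x \<in> O'. f x = l} = {x}" by (auto simp: card_1_singleton_iff)
      have e: "{x \<in> O'. g x = l} = {}" using 1(2) fO by simp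
      have "u x = 0" using eq[OF lL] unfolding sets x e by simp
      moreover have "x \<in> S" using x sub by auto
      ultimately show False using nz by simp
    next
      case 2
      then obtain x where x: "{x \<in> O'. g x = l} = {x}" by (auto simp: card_1_singleton_iff)
      have e: "{x \<in> O'. f x = l} = {}" using 2(1) fO by simp
      have "u x = 0" using eq[OF lL] unfolding sets x e by simp
      moreover have "x \<in> S" using x sub by auto
      ultimately show False using nz by simp
    qed
  qed
  then have "(\<Sum>l\<in>?R. 2) \<le> (\<Sum>l\<in>?R. card {x \<in> O'. f x = l} + card {x \<in> O'. g x = l})"
    by (intro sum_mono) auto
  also have "\<dots> = card O' + card O'"
    using sum.group[OF fO, of ?R f "\<lambda>_. 1::nat"] sum.group[OF fO, of ?R g "\<lambda>_. 1::nat"] fO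
    by (simp add: sum.distrib)
  finally show ?thesis by simp
qed

lemma avg_image_subset_le:
  fixes Y :: "'x set"
  assumes "finite Y" "T \<subseteq> Y" "D \<subseteq> Y" "2 * card D \<le> card Y"
  shows "avg (perms Y) (\<lambda>\<pi>. of_bool (\<pi> ` D \<subseteq> T)) \<le> (2 * real (card T) / card Y) ^ card D"
proof (cases "card D = 0")
  case True
  then have "D = {}" using assms finite_subset by fastforce
  then show ?thesis by (intro avg_le_const) (simp_all add: assms)
next
  case False
  let ?j = "card D" and ?N = "card Y"
  have fD: "finite D" using assms finite_subset by blast
  \<comment> \<open>The source of the factor 2: at every choice at least half of Y is still
    available.\<close>
  have N: "real (?N - ?j) \<ge> real ?N / 2" "real (?N - ?j) > 0" "?j \<le> ?N" "?N > 0"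
    using assms(4) False by linarith+
  have "avg (perms Y) (\<lambda>\<pi>. of_bool (\<pi> ` D \<subseteq> T)) =
      avg (perms Y) (\<lambda>\<pi>. of_bool (restrict \<pi> D \<in> D \<rightarrow>\<^sub>E T) :: real)"
    by (intro avg_cong) (auto simp: PiE_iff image_subset_iff)
  also have "\<dots> \<le> fact (?N - ?j) / fact ?N * (\<Sum>y\<in>D \<rightarrow>\<^sub>E Y. of_bool (y \<in> D \<rightarrow>\<^sub>E T))"
    by (rule avg_restrict_perm_le[OF assms(1,3), where F = "\<lambda>y. of_bool (y \<in> D \<rightarrow>\<^sub>E T)"]) simp
  also have "(\<Sum>y\<in>D \<rightarrow>\<^sub>E Y. of_bool (y \<in> D \<rightarrow>\<^sub>E T)) = real (card (D \<rightarrow>\<^sub>E T))"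
  proof -
    have "D \<rightarrow>\<^sub>E T \<subseteq> D \<rightarrow>\<^sub>E Y" using assms by (intro PiE_mono) auto
    then show ?thesis using assms fD
      by (simp add: of_bool_def sum.If_cases finite_PiE Int_absorb1 Int_absorb2)
  qed
  also have "\<dots> = real (card T) ^ ?j" using fD by (simp add: card_PiE)
  also have "fact (?N - ?j) / fact ?N * real (card T) ^ ?j \<le> 1 / real (?N - ?j) ^ ?j * real (card T) ^ ?j"
    using fact_ratio_ge[OF N(3)] N(2) by (intro mult_right_mono) (simp_all add: field_simps)
  also have "\<dots> = (real (card T) / real (?N - ?j)) ^ ?j" by (simp add: power_divide)
  also have "\<dots> \<le> (2 * real (card T) / ?N) ^ ?j"
  proof (rule power_mono)
    have "real (card T) / real (?N - ?j) \<le> real (card T) / (real ?N / 2)"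
      using N by (intro divide_left_mono) auto
    then show "real (card T) / real (?N - ?j) \<le> 2 * real (card T) / ?N" by (simp add: mult.commute)
  qed simp
  finally show ?thesis .
qed

text \<open>Union bound over the sets \<open>L'\<close> of j fibers containing both images. With l
  fibers there are at most (e l / j)^j such sets, each of probability at most (2 j / l)^(2 j). A
  single copy would only match the entropy of the choice of \<open>L'\<close>; two copies beat
  it.\<close>

lemma avg_common_fibers_le:
  fixes L :: "'v set" and O' :: "('v \<times> nat) set"
  assumes fin: "finite L" and sub: "O' \<subseteq> L \<times> {..<d}" and d: "2 \<le> d" and j: "card O' \<le> card L"
  defines "Y \<equiv> L \<times> {..<d}"
  shows "avg (perms Y) (\<lambda>\<pi>. avg (perms Y)
      (\<lambda>\<pi>'. of_bool (card (fst ` \<pi> ` O' \<union> fst ` \<pi>' ` O') \<le> card O')))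
    \<le> (4 * exp 1 * card O' / card L) ^ card O'"
proof -
  let ?j = "card O'" and ?l = "card L" and ?P = "perms Y"
  define LL where "LL = {L'. L' \<subseteq> L \<and> card L' = ?j}"
  define b :: "'v set \<Rightarrow> _ \<Rightarrow> real" where "b L' \<pi> = of_bool (\<pi> ` O' \<subseteq> L' \<times> {..<d})" for L' \<pi>
  have fLL: "finite LL" using fin by (simp add: LL_def)
  have fY: "finite Y" using fin by (simp add: Y_def)
  have cY: "card Y = ?l * d" by (simp add: Y_def card_cartesian_product)
  have le: "of_bool (card (fst ` \<pi> ` O' \<union> fst ` \<pi>' ` O') \<le> ?j) \<le> (\<Sum>L'\<in>LL. b L' \<pi> * b L' \<pi>')"
    if p: "\<pi> \<in> ?P" "\<pi>' \<in> ?P" for \<pi> \<pi>'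
  proof (cases "card (fst ` \<pi> ` O' \<union> fst ` \<pi>' ` O') \<le> ?j")
    case True
    have in_Y: "\<pi> x \<in> Y" "\<pi>' x \<in> Y" if "x \<in> O'" for x
      using that sub p unfolding Y_def by (metis mem_Collect_eq permutes_in_image subsetD)+
    then have "fst ` \<pi> ` O' \<union> fst ` \<pi>' ` O' \<subseteq> L" unfolding Y_def mem_Times_iff by auto
    \<comment> \<open>The images may occupy fewer than j fibers and are padded to exactly j, which
      is possible as \<open>card O' \<le> card L\<close>.\<close>
    then obtain L' where L': "fst ` \<pi> ` O' \<union> fst ` \<pi>' ` O' \<subseteq> L'" "L' \<subseteq> L" "card L' = ?j"
      using exists_subset_between[OF True j _ fin] by blast
    have "b L' \<pi> * b L' \<pi>' = 1"
      using L'(1) in_Y unfolding b_def Y_def mem_Times_iff by (auto simp: image_subset_iff mem_Times_iff)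
    moreover have "L' \<in> LL" using L' by (simp add: LL_def)
    ultimately have "1 \<le> (\<Sum>L'\<in>LL. b L' \<pi> * b L' \<pi>')"
      using member_le_sum[of L' LL "\<lambda>L'. b L' \<pi> * b L' \<pi>'"] fLL by (simp add: b_def)
    then show ?thesis by simp
  next
    case False
    then show ?thesis by (simp add: b_def sum_nonneg)
  qed
  have "avg ?P (\<lambda>\<pi>. avg ?P (\<lambda>\<pi>'. of_bool (card (fst ` \<pi> ` O' \<union> fst ` \<pi>' ` O') \<le> ?j)))
     \<le> avg ?P (\<lambda>\<pi>. avg ?P (\<lambda>\<pi>'. \<Sum>L'\<in>LL. b L' \<pi> * b L' \<pi>'))"
    by (intro avg_mono le)
  also have "\<dots> = (\<Sum>L'\<in>LL. avg ?P (b L') * avg ?P (b L'))"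
    by (simp only: sum_avg[symmetric] avg_mult_avg)
  also have "\<dots> \<le> (\<Sum>L'\<in>LL. (2 * ?j / ?l) ^ ?j * (2 * ?j / ?l) ^ ?j)"
  proof (intro sum_mono)
    fix L' assume "L' \<in> LL"
    then have L': "L' \<times> {..<d} \<subseteq> Y" "card (L' \<times> {..<d}) = ?j * d"
      by (auto simp: LL_def Y_def card_cartesian_product)
    have "2 * ?j \<le> card Y"
      unfolding cY using j d by (metis mult.commute mult_le_mono)
    then have "avg ?P (b L') \<le> (2 * real (?j * d) / (?l * d)) ^ ?j"
      using avg_image_subset_le[OF fY L'(1), of O'] sub unfolding b_def cY L'(2) by (simp add: Y_def)
    also have "\<dots> = (2 * ?j / ?l) ^ ?j" using d by simp
    finally have "avg ?P (b L') \<le> (2 * ?j / ?l) ^ ?j" .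
    moreover have "0 \<le> avg ?P (b L')" by (intro avg_nonneg) (simp add: b_def)
    ultimately show "avg ?P (b L') * avg ?P (b L') \<le> (2 * ?j / ?l) ^ ?j * (2 * ?j / ?l) ^ ?j"
      by (intro mult_mono) auto
  qed
  also have "\<dots> = real (?l choose ?j) * ((2 * ?j / ?l) ^ ?j * (2 * ?j / ?l) ^ ?j)"
    using n_subsets[OF fin, of ?j] by (simp add: LL_def)
  also have "\<dots> \<le> (exp 1 * ?l / ?j) ^ ?j * ((2 * ?j / ?l) ^ ?j * (2 * ?j / ?l) ^ ?j)"
    by (intro mult_right_mono binomial_le_exp_power) simp
  also have "\<dots> = (4 * exp 1 * ?j / ?l) ^ ?j"
  proof (cases "?j = 0")
    case False
    with j have "?l \<noteq> 0" by linarith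
    with False have "exp 1 * ?l / ?j * (2 * ?j / ?l * (2 * ?j / ?l)) = 4 * exp 1 * ?j / ?l"
      by (simp add: field_simps)
    then show ?thesis by (simp only: power_mult_distrib[symmetric])
  qed simp
  finally show ?thesis .
qed

text \<open>An injective character, so that the field is a prime field. Injectivity turns a nonzero
  exponent into a value other than 1, which drives both orthogonality and the gain from a
  swap.\<close>

locale additive_character =
  fixes \<omega> :: "'a::{finite,field} \<Rightarrow> complex"
  assumes chi_add: "\<omega> (x + y) = \<omega> x * \<omega> y"
    and chi_eq_1: "\<omega> x = 1 \<Longrightarrow> x = 0"
    and norm_chi: "norm (\<omega> x) = 1"
begin

lemma chi_0: "\<omega> 0 = 1"
proof -
  have "\<omega> 0 * \<omega> 0 = \<omega> 0 * 1" using chi_add[of 0 0] by simp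
  moreover have "\<omega> 0 \<noteq> 0" using norm_chi[of 0] by auto
  ultimately show ?thesis using mult_left_cancel by blast
qed

lemma chi_uminus: "\<omega> (- x) = cnj (\<omega> x)"
proof -
  have "\<omega> (- x) * \<omega> x = 1" by (simp add: chi_add[symmetric] chi_0)
  moreover have "cnj (\<omega> x) * \<omega> x = 1"
    using complex_norm_square[of "\<omega> x"] by (simp add: norm_chi mult.commute)
  moreover have "\<omega> x \<noteq> 0" using norm_chi[of x] by auto
  ultimately show ?thesis by (metis mult_right_cancel)
qed

lemma chi_diff: "\<omega> (x - y) = \<omega> x * cnj (\<omega> y)"
  using chi_add[of x "- y"] by (simp add: chi_uminus)

lemma chi_sum: "\<omega> (\<Sum>x\<in>A. f x) = (\<Prod>x\<in>A. \<omega> (f x))"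
  by (induction A rule: infinite_finite_induct) (simp_all add: chi_0 chi_add)

lemma sum_chi: "(\<Sum>y\<in>UNIV. \<omega> (x * y)) = (if x = 0 then of_nat CARD('a) else 0)"
proof (cases "x = 0")
  case True
  then show ?thesis by (simp add: chi_0)
next
  case False
  let ?T = "\<Sum>y\<in>UNIV. \<omega> (x * y)"
  have "?T = (\<Sum>y\<in>UNIV. \<omega> (x * (y + 1)))"
    by (rule sum.reindex_bij_witness[of _ "\<lambda>y. y + 1" "\<lambda>y. y - 1"]) auto
  also have "\<dots> = \<omega> x * ?T" by (simp add: distrib_left chi_add sum_distrib_left mult.commute)
  finally have "(1 - \<omega> x) * ?T = 0" by (simp add: algebra_simps)
  moreover have "\<omega> x \<noteq> 1" using False chi_eq_1 by blast
  ultimately show ?thesis using False by simp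
qed

lemma sum_words_chi:
  assumes "finite V"
  shows "(\<Sum>v\<in>V \<rightarrow>\<^sub>E UNIV. \<omega> (\<Sum>l\<in>V. w l * v l)) =
    (if \<forall>l\<in>V. w l = 0 then of_real (real CARD('a) ^ card V) else 0)"
proof -
  have "(\<Sum>v\<in>V \<rightarrow>\<^sub>E UNIV. \<omega> (\<Sum>l\<in>V. w l * v l)) = (\<Prod>l\<in>V. \<Sum>y\<in>UNIV. \<omega> (w l * y))"
    unfolding chi_sum using assms by (intro prod_sum_PiE[symmetric]) auto
  also have "\<dots> = (\<Prod>l\<in>V. if w l = 0 then of_nat CARD('a) else 0)"
    by (simp only: sum_chi)
  also have "\<dots> = (if \<forall>l\<in>V. w l = 0 then of_real (real CARD('a) ^ card V) else 0)"
  proof (cases "\<forall>l\<in>V. w l = 0")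
    case False
    then have "(\<Prod>l\<in>V. if w l = 0 then of_nat CARD('a) else 0 :: complex) = 0"
      using assms by (intro prod_zero) auto
    then show ?thesis using False by simp
  qed simp
  finally show ?thesis .
qed

text \<open>Parseval over v turns the sum of squares into the event that two copies of u^T A agree;
  \<open>no_single_hit\<close> confines their images to few fibers, and Cauchy-Schwarz over the
  words v returns to first powers. S is the support of the weights, and \<open>g x\<close> is the
  point to which the permutation is applied: x itself for permutations, its partner for matchings.
  Only the fibers over L are rearranged, so j counts the randomized points.\<close>

lemma sum_words_near_constant:
  fixes u :: "'s \<Rightarrow> 'a" and g :: "'s \<Rightarrow> 'v \<times> nat"
  assumes fV: "finite V" and LV: "L \<subseteq> V" and fS: "finite S" and nz: "\<And>x. x \<in> S \<Longrightarrow> u x \<noteq> 0"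
    and inj: "inj_on g S" and g: "g ` S \<subseteq> V \<times> {..<d}" and d: "2 \<le> d"
  defines "Y \<equiv> L \<times> {..<d}"
  defines "j \<equiv> card {x\<in>S. g x \<in> Y}"
  assumes j: "j \<le> card L"
  shows "(\<Sum>v\<in>V \<rightarrow>\<^sub>E UNIV. norm (avg (perms Y) (\<lambda>\<pi>. \<Prod>x\<in>S. \<omega> (u x * v (fst (\<pi> (g x)))))))
    \<le> real CARD('a) ^ card V * sqrt ((4 * exp 1 * j / card L) ^ j)"
proof -
  let ?P = "perms Y"
  define O' where "O' = g ` {x\<in>S. g x \<in> Y}"
  \<comment> \<open>\<open>W \<pi> l\<close> is the coefficient of \<open>v l\<close> in the
    exponent, that is, entry l of the row vector u^T A.\<close>
  define W where "W \<pi> l = (\<Sum>x | x \<in> S \<and> fst (\<pi> (g x)) = l. u x)"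
    for \<pi> :: "'v \<times> nat \<Rightarrow> 'v \<times> nat" and l :: 'v
  have fL: "finite L" using LV fV finite_subset by blast
  have cO: "card O' = j"
    unfolding O'_def j_def by (rule card_image) (rule inj_on_subset[OF inj], auto)
  have inV: "fst (\<pi> (g x)) \<in> V" if "\<pi> \<in> ?P" "x \<in> S" for \<pi> x
  proof (cases "g x \<in> Y")
    case True
    then have "\<pi> (g x) \<in> Y" using that by (simp add: permutes_in_image)
    then show ?thesis using LV by (auto simp: Y_def)
  next
    case False
    then have "\<pi> (g x) = g x" using that by (simp add: permutes_not_in)
    then show ?thesis using g that by force
  qed
  have inL: "fst (\<pi> (g x)) \<in> L \<longleftrightarrow> x \<in> {x\<in>S. g x \<in> Y}" if "\<pi> \<in> ?P" "x \<in> S" for \<pi> x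
  proof (cases "g x \<in> Y")
    case True
    then have "\<pi> (g x) \<in> Y" using that by (simp add: permutes_in_image)
    then show ?thesis using True that by (auto simp: Y_def)
  next
    case False
    then have "\<pi> (g x) = g x" using that by (simp add: permutes_not_in)
    then show ?thesis using False g that by (force simp: Y_def)
  qed
  have phase: "(\<Prod>x\<in>S. \<omega> (u x * v (fst (\<pi> (g x))))) = \<omega> (\<Sum>l\<in>V. W \<pi> l * v l)" if "\<pi> \<in> ?P" for \<pi> v
  proof -
    have "(\<Sum>x\<in>S. u x * v (fst (\<pi> (g x)))) = (\<Sum>l\<in>V. \<Sum>x | x \<in> S \<and> fst (\<pi> (g x)) = l. u x * v (fst (\<pi> (g x))))"
      using inV[OF that] by (intro sum.group[symmetric] fS fV) auto
    also have "\<dots> = (\<Sum>l\<in>V. W \<pi> l * v l)"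
      unfolding W_def sum_distrib_right by (intro sum.cong) auto
    finally show ?thesis by (simp only: chi_sum[symmetric])
  qed
  let ?f = "\<lambda>v \<pi>. \<Prod>x\<in>S. \<omega> (u x * v (fst (\<pi> (g x))))"
  have "(\<Sum>v\<in>V \<rightarrow>\<^sub>E UNIV. (norm (avg ?P (?f v)))\<^sup>2) =
     real CARD('a) ^ card V * avg ?P (\<lambda>\<pi>. avg ?P (\<lambda>\<pi>'. of_bool (\<forall>l\<in>V. W \<pi> l = W \<pi>' l)))"
  proof (rule sum_norm_avg_sq)
    fix \<pi> \<pi>' assume p: "\<pi> \<in> ?P" "\<pi>' \<in> ?P"
    have "?f v \<pi> * cnj (?f v \<pi>') = \<omega> (\<Sum>l\<in>V. (W \<pi> l - W \<pi>' l) * v l)" for v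
      unfolding phase[OF p(1)] phase[OF p(2)] chi_diff[symmetric]
      by (simp add: sum_subtractf left_diff_distrib)
    then show "(\<Sum>v\<in>V \<rightarrow>\<^sub>E UNIV. ?f v \<pi> * cnj (?f v \<pi>')) =
       (if \<forall>l\<in>V. W \<pi> l = W \<pi>' l then of_real (real CARD('a) ^ card V) else 0)"
      by (simp only: sum_words_chi[OF fV] right_minus_eq)
  qed
  also have "\<dots> \<le> real CARD('a) ^ card V * (4 * exp 1 * j / card L) ^ j"
  proof (rule mult_left_mono)
    have "avg ?P (\<lambda>\<pi>. avg ?P (\<lambda>\<pi>'. of_bool (\<forall>l\<in>V. W \<pi> l = W \<pi>' l))) \<le>
      avg ?P (\<lambda>\<pi>. avg ?P (\<lambda>\<pi>'. of_bool (card (fst ` \<pi> ` O' \<union> fst ` \<pi>' ` O') \<le> card O') :: real))"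
    proof (intro avg_mono)
      fix \<pi> \<pi>' assume p: "\<pi> \<in> ?P" "\<pi>' \<in> ?P"
      have "card (fst ` \<pi> ` O' \<union> fst ` \<pi>' ` O') \<le> card O'" if eq: "\<forall>l\<in>V. W \<pi> l = W \<pi>' l"
      proof -
        have "card ((\<lambda>x. fst (\<pi> (g x))) ` {x\<in>S. g x \<in> Y} \<union> (\<lambda>x. fst (\<pi>' (g x))) ` {x\<in>S. g x \<in> Y}) \<le>
            card {x\<in>S. g x \<in> Y}"
        proof (rule no_single_hit[OF fS nz, where L = L])
          fix l assume "l \<in> L"
          then show "(\<Sum>x | x \<in> S \<and> fst (\<pi> (g x)) = l. u x) = (\<Sum>x | x \<in> S \<and> fst (\<pi>' (g x)) = l. u x)"
            using eq LV unfolding W_def by blast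
        qed (use inL[OF p(1)] inL[OF p(2)] in auto)
        then show ?thesis unfolding cO j_def[symmetric] unfolding O'_def image_image .
      qed
      then show "of_bool (\<forall>l\<in>V. W \<pi> l = W \<pi>' l) \<le>
          (of_bool (card (fst ` \<pi> ` O' \<union> fst ` \<pi>' ` O') \<le> card O') :: real)" by simp
    qed
    also have "\<dots> \<le> (4 * exp 1 * card O' / card L) ^ card O'"
      unfolding Y_def using j cO by (intro avg_common_fibers_le[OF fL _ d]) (auto simp: O'_def Y_def)
    finally show "avg ?P (\<lambda>\<pi>. avg ?P (\<lambda>\<pi>'. of_bool (\<forall>l\<in>V. W \<pi> l = W \<pi>' l))) \<le> (4 * exp 1 * j / card L) ^ j"
      by (simp add: cO)
  qed simp
  finally have sq: "(\<Sum>v\<in>V \<rightarrow>\<^sub>E UNIV. (norm (avg ?P (?f v)))\<^sup>2) \<le> real CARD('a) ^ card V * (4 * exp 1 * j / card L) ^ j" .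
  have cP: "real (card (V \<rightarrow>\<^sub>E (UNIV :: 'a set))) = real CARD('a) ^ card V" using fV by (simp add: card_PiE)
  have "(\<Sum>v\<in>V \<rightarrow>\<^sub>E UNIV. norm (avg ?P (?f v))) \<le>
      sqrt (real CARD('a) ^ card V * (\<Sum>v\<in>V \<rightarrow>\<^sub>E UNIV. (norm (avg ?P (?f v)))\<^sup>2))"
    using sum_le_sqrt_sum_sq[of "\<lambda>v. norm (avg ?P (?f v))" "V \<rightarrow>\<^sub>E UNIV"] unfolding cP .
  also have "\<dots> \<le> sqrt (real CARD('a) ^ card V * (real CARD('a) ^ card V * (4 * exp 1 * j / card L) ^ j))"
    using sq by (intro real_sqrt_le_mono mult_left_mono) auto
  also have "\<dots> = real CARD('a) ^ card V * sqrt ((4 * exp 1 * j / card L) ^ j)"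
    by (simp add: real_sqrt_mult mult.assoc[symmetric] del: real_sqrt_power)
  finally show ?thesis .
qed

end

section \<open>The first moment\<close>

abbreviation words :: "nat \<Rightarrow> (nat \<Rightarrow> 'a) set" where
  "words n \<equiv> {..<n} \<rightarrow>\<^sub>E UNIV"

definition nonconst_words :: "nat \<Rightarrow> (nat \<Rightarrow> 'a) set" where
  "nonconst_words n = {u \<in> words n. \<forall>c. \<exists>l<n. u l \<noteq> c}"

lemma finite_words [simp]: "finite (words n :: (nat \<Rightarrow> 'a::finite) set)"
  by (simp add: finite_PiE)

lemma words_eq_const: "u \<in> words n \<Longrightarrow> (\<And>l. l < n \<Longrightarrow> u l = c) \<Longrightarrow> u = restrict (\<lambda>_. c) {..<n}"
  by (auto simp: fun_eq_iff restrict_def dest: PiE_arb)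

lemma words_split:
  "words n = nonconst_words n \<union> range (\<lambda>c. restrict (\<lambda>_. c) {..<n})"
proof (intro equalityI subsetI)
  fix u :: "nat \<Rightarrow> 'a" assume "u \<in> words n"
  then show "u \<in> nonconst_words n \<union> range (\<lambda>c. restrict (\<lambda>_. c) {..<n})"
    using words_eq_const[of u n] by (auto simp: nonconst_words_def)
qed (auto simp: nonconst_words_def split: if_splits)

lemma words_disjoint:
  "nonconst_words n \<inter> range (\<lambda>c. restrict (\<lambda>_. c) {..<n}) = {}"
  by (auto simp: nonconst_words_def)

lemma sum_words_split:
  fixes f :: "(nat \<Rightarrow> 'a::finite) \<Rightarrow> 'b::comm_monoid_add"
  assumes "0 < n"
  shows "(\<Sum>u\<in>words n. f u) = (\<Sum>u\<in>nonconst_words n. f u) + (\<Sum>c\<in>UNIV. f (restrict (\<lambda>_. c) {..<n}))"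
proof -
  \<comment> \<open>For \<open>n = 0\<close> all constant words would coincide.\<close>
  have inj: "inj (\<lambda>c::'a. restrict (\<lambda>_. c) {..<n})"
    using assms by (auto intro!: injI simp: fun_eq_iff restrict_def split: if_splits)
  have fin: "finite (nonconst_words n :: (nat \<Rightarrow> 'a) set)"
    by (rule finite_subset[OF _ finite_words[of n]]) (auto simp: nonconst_words_def)
  show ?thesis
    unfolding words_split
    by (subst sum.union_disjoint) (simp_all add: fin words_disjoint sum.reindex[OF inj] o_def)
qed

lemma sum_points: "(\<Sum>x\<in>points n d. f x) = (\<Sum>k<n. \<Sum>j<d. f (k, j))"
  unfolding points_eq by (simp add: sum.cartesian_product)

text \<open>The kernel of the adjacency matrix without the matrix: entry k of A v sums v over the
  endpoints of the d edges leaving fiber k, see \<open>directed_adj_mult\<close>.\<close>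

definition kernel_words :: "nat \<Rightarrow> nat \<Rightarrow> (nat \<times> nat \<Rightarrow> nat \<times> nat) \<Rightarrow> (nat \<Rightarrow> 'a::field) set" where
  "kernel_words n d P = {v \<in> words n. \<forall>k<n. (\<Sum>j<d. v (fst (P (k, j)))) = 0}"

section \<open>Phases, correlations and Fourier inversion\<close>

context additive_character
begin

text \<open>This is \<open>\<omega>\<close> of u^T A v, as a product over points instead of matrix
  entries: x stands for the edge from \<open>fst x\<close> to \<open>fst (P x)\<close>.\<close>

definition phase :: "nat \<Rightarrow> nat \<Rightarrow> (nat \<Rightarrow> 'a) \<Rightarrow> (nat \<Rightarrow> 'a) \<Rightarrow> (nat \<times> nat \<Rightarrow> nat \<times> nat) \<Rightarrow> complex" where
  "phase n d u v P = (\<Prod>x\<in>points n d. \<omega> (u (fst x) * v (fst (P x))))"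

text \<open>The expectation E(u, v), with \<open>\<Omega>\<close> the set of all permutations or the
  set of all matchings.\<close>

definition corr :: "(nat \<times> nat \<Rightarrow> nat \<times> nat) set \<Rightarrow> nat \<Rightarrow> nat \<Rightarrow> (nat \<Rightarrow> 'a) \<Rightarrow> (nat \<Rightarrow> 'a) \<Rightarrow> complex" where
  "corr \<Omega> n d u v = avg \<Omega> (phase n d u v)"

lemma norm_phase: "norm (phase n d u v P) = 1"
  by (simp add: phase_def norm_chi flip: prod_norm)

lemma norm_corr_le_1: "finite \<Omega> \<Longrightarrow> \<Omega> \<noteq> {} \<Longrightarrow> norm (corr \<Omega> n d u v) \<le> 1"
  unfolding corr_def
  by (rule order_trans[OF norm_avg_le]) (simp add: norm_phase avg_const)

lemma phase_rows: "phase n d u v P = \<omega> (\<Sum>k<n. (\<Sum>j<d. v (fst (P (k, j)))) * u k)"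
  unfolding phase_def chi_sum[symmetric] sum_points
  by (simp add: sum_distrib_left mult.commute)

lemma sum_phase_eq_kernel:
  assumes "v \<in> words n"
  shows "(\<Sum>u\<in>words n. phase n d u v P) = of_real (real CARD('a) ^ n * of_bool (v \<in> kernel_words n d P))"
  unfolding phase_rows by (subst sum_words_chi) (use assms in \<open>auto simp: kernel_words_def\<close>)

lemma phase_const_right:
  assumes "P permutes points n d"
  shows "phase n d u (restrict (\<lambda>_. c) {..<n}) P = \<omega> (\<Sum>k<n. (of_nat d * c) * u k)"
proof -
  have "(\<Sum>j<d. restrict (\<lambda>_. c) {..<n} (fst (P (k, j)))) = of_nat d * c" if "k < n" for k
  proof -
    have "fst (P (k, j)) < n" if "j < d" for j
      using permutes_in_image[OF assms, of "(k, j)"] \<open>k < n\<close> that by (auto simp: points_eq mem_Times_iff)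
    then show ?thesis by simp
  qed
  then show ?thesis unfolding phase_rows by simp
qed

text \<open>Inverting P transposes the matrix. For a set closed under inverses this makes u and v
  interchangeable.\<close>

lemma phase_inv:
  assumes "P permutes points n d"
  shows "phase n d u v (iperm P) = phase n d v u P"
proof -
  have "phase n d u v (iperm P) =
      (\<Prod>x\<in>points n d. \<omega> (u (fst (P x)) * v (fst (iperm P (P x)))))"
    unfolding phase_def
    by (rule prod_perm_reindex[OF assms, symmetric, where f = "\<lambda>x. \<omega> (u (fst x) * v (fst (iperm P x)))"])
  also have "\<dots> = phase n d v u P"
    by (simp add: phase_def permutes_inverses[OF assms] mult.commute)
  finally show ?thesis .
qed

lemma phase_const_left:
  assumes "P permutes points n d"
  shows "phase n d (restrict (\<lambda>_. c) {..<n}) v P = \<omega> (\<Sum>k<n. (of_nat d * c) * v k)"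
  using phase_const_right[OF permutes_inv[OF assms], of v c] phase_inv[OF assms, of v] by simp

lemma corr_commute:
  assumes "\<And>P. P \<in> \<Omega> \<Longrightarrow> P permutes points n d"
    and "\<And>P. P \<in> \<Omega> \<Longrightarrow> iperm P \<in> \<Omega>"
  shows "corr \<Omega> n d u v = corr \<Omega> n d v u"
proof -
  have b: "bij_betw iperm \<Omega> \<Omega>"
    by (rule bij_betwI[where g = iperm]) (auto simp: permutes_inv_inv[OF assms(1)] assms(2))
  have "corr \<Omega> n d u v = avg \<Omega> (\<lambda>P. phase n d u v (iperm P))"
    unfolding corr_def by (rule avg_reindex[OF b, symmetric])
  also have "\<dots> = corr \<Omega> n d v u"
    unfolding corr_def by (intro avg_cong phase_inv assms)
  finally show ?thesis .
qed

text \<open>All column sums are d, so the constant contributes a deterministic factor of norm 1 that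
  depends on v only. This lets u be replaced by its deviation from a constant.\<close>

lemma norm_corr_shift:
  assumes P: "\<And>P. P \<in> \<Omega> \<Longrightarrow> P permutes points n d"
  shows "norm (corr \<Omega> n d (\<lambda>l. u l - c) v) = norm (corr \<Omega> n d u v)"
proof -
  have "phase n d (\<lambda>l. u l - c) v P = cnj (\<omega> (\<Sum>k<n. (of_nat d * c) * v k)) * phase n d u v P" if "P \<in> \<Omega>" for P
  proof -
    have "fst x < n" if "x \<in> points n d" for x using that by (auto simp: points_eq)
    then have "phase n d (restrict (\<lambda>_. c) {..<n}) v P = (\<Prod>x\<in>points n d. \<omega> (c * v (fst (P x))))"
      by (simp add: phase_def)
    then have c: "cnj (\<omega> (\<Sum>k<n. (of_nat d * c) * v k)) = (\<Prod>x\<in>points n d. cnj (\<omega> (c * v (fst (P x)))))"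
      unfolding phase_const_left[OF P[OF that], symmetric] by simp
    have "phase n d (\<lambda>l. u l - c) v P =
        (\<Prod>x\<in>points n d. cnj (\<omega> (c * v (fst (P x)))) * \<omega> (u (fst x) * v (fst (P x))))"
      unfolding phase_def by (intro prod.cong refl) (simp add: left_diff_distrib chi_diff)
    then show ?thesis unfolding c by (simp add: phase_def prod.distrib)
  qed
  then have "corr \<Omega> n d (\<lambda>l. u l - c) v = cnj (\<omega> (\<Sum>k<n. (of_nat d * c) * v k)) * corr \<Omega> n d u v"
    unfolding corr_def avg_mult_left[symmetric] by (intro avg_cong) simp
  then show ?thesis by (simp add: norm_mult norm_chi)
qed

text \<open>Summing the phase over u detects \<open>A v = 0\<close>. The term 1 comes from the
  constant u; the term q^2 / q^n, with q the field size, covers the pairs of constants that are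
  missing when v is restricted to nonconstant words.\<close>

theorem first_moment:
  assumes fin: "finite \<Omega>" and ne: "\<Omega> \<noteq> {}" and P: "\<And>P. P \<in> \<Omega> \<Longrightarrow> P permutes points n d"
    and d: "(of_nat d :: 'a) \<noteq> 0" and n: "0 < n"
  shows "avg \<Omega> (\<lambda>P. real (card {v \<in> kernel_words n d P. \<exists>l<n. v l \<noteq> (0::'a)})) \<le>
    1 + real CARD('a) ^ 2 / real CARD('a) ^ n +
    (\<Sum>u\<in>nonconst_words n. \<Sum>v\<in>nonconst_words n. norm (corr \<Omega> n d u v)) / real CARD('a) ^ n"
proof -
  let ?q = "real CARD('a)" and ?N = "nonconst_words n :: (nat \<Rightarrow> 'a) set"
  let ?c = "\<lambda>c::'a. restrict (\<lambda>_. c) {..<n}"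
  let ?W = "words n :: (nat \<Rightarrow> 'a) set"
  define W0 where "W0 = {v \<in> ?W. \<exists>l<n. v l \<noteq> 0}"
  have fW0: "finite W0" by (simp add: W0_def)
  have row: "(\<Sum>u\<in>?W. corr \<Omega> n d u v) = of_real (?q ^ n * avg \<Omega> (\<lambda>P. of_bool (v \<in> kernel_words n d P)))"
    if "v \<in> ?W" for v
  proof -
    have "(\<Sum>u\<in>?W. corr \<Omega> n d u v) = avg \<Omega> (\<lambda>P. of_real (?q ^ n * of_bool (v \<in> kernel_words n d P)))"
      unfolding corr_def sum_avg using that by (intro avg_cong sum_phase_eq_kernel)
    also have "\<dots> = of_real (?q ^ n * avg \<Omega> (\<lambda>P. of_bool (v \<in> kernel_words n d P)))"
      by (simp add: avg_def sum_distrib_left)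
    finally show ?thesis .
  qed
  have const_left: "corr \<Omega> n d (?c c) v = \<omega> (\<Sum>k<n. (of_nat d * c) * v k)" for c v
  proof -
    have "corr \<Omega> n d (?c c) v = avg \<Omega> (\<lambda>_. \<omega> (\<Sum>k<n. (of_nat d * c) * v k))"
      unfolding corr_def by (intro avg_cong phase_const_left P)
    then show ?thesis using fin ne by (simp add: avg_const)
  qed
  have const_right: "corr \<Omega> n d u (?c c) = \<omega> (\<Sum>k<n. (of_nat d * c) * u k)" for c u
  proof -
    have "corr \<Omega> n d u (?c c) = avg \<Omega> (\<lambda>_. \<omega> (\<Sum>k<n. (of_nat d * c) * u k))"
      unfolding corr_def by (intro avg_cong phase_const_right P)
    then show ?thesis using fin ne by (simp add: avg_const)
  qed
  have sum_const: "(\<Sum>w\<in>?W. \<omega> (\<Sum>k<n. (of_nat d * c) * w k)) = (if c = 0 then of_real (?q ^ n) else 0)" for c :: 'a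
    using n d by (subst sum_words_chi) auto
  have W0: "(\<Sum>v\<in>W0. f v) = (\<Sum>v\<in>?N. f v) + (\<Sum>c\<in>UNIV - {0}. f (?c c))" for f :: "(nat \<Rightarrow> 'a) \<Rightarrow> complex"
  proof -
    have "?W = insert (?c 0) W0"
      using words_eq_const[of _ n 0] by (auto simp: W0_def split: if_splits)
    moreover have "?c 0 \<notin> W0" by (simp add: W0_def)
    ultimately have "(\<Sum>v\<in>?W. f v) = f (?c 0) + (\<Sum>v\<in>W0. f v)" using fW0 by simp
    moreover have "(\<Sum>c\<in>UNIV. f (?c c)) = f (?c 0) + (\<Sum>c\<in>UNIV - {0}. f (?c c))"
      by (rule sum.remove) auto
    ultimately show ?thesis unfolding sum_words_split[OF n] by (simp add: add_ac)
  qed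
  have "of_real (?q ^ n * avg \<Omega> (\<lambda>P. real (card {v \<in> kernel_words n d P. \<exists>l<n. v l \<noteq> (0::'a)}))) =
      (\<Sum>v\<in>W0. \<Sum>u\<in>?W. corr \<Omega> n d u v)"
  proof -
    have "real (card {v \<in> kernel_words n d P. \<exists>l<n. v l \<noteq> (0::'a)}) = (\<Sum>v\<in>W0. of_bool (v \<in> kernel_words n d P))" for P
    proof -
      have "{v \<in> kernel_words n d P. \<exists>l<n. v l \<noteq> (0::'a)} = {v \<in> W0. v \<in> kernel_words n d P}"
        by (auto simp: W0_def kernel_words_def)
      then show ?thesis using fW0 by (simp add: of_bool_def sum.If_cases Int_def)
    qed
    then have "?q ^ n * avg \<Omega> (\<lambda>P. real (card {v \<in> kernel_words n d P. \<exists>l<n. v l \<noteq> (0::'a)})) =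
        (\<Sum>v\<in>W0. ?q ^ n * avg \<Omega> (\<lambda>P. of_bool (v \<in> kernel_words n d P)))"
      by (simp only: sum_avg sum_distrib_left[symmetric])
    moreover have "(\<Sum>v\<in>W0. \<Sum>u\<in>?W. corr \<Omega> n d u v) =
        (\<Sum>v\<in>W0. of_real (?q ^ n * avg \<Omega> (\<lambda>P. of_bool (v \<in> kernel_words n d P))))"
      by (intro sum.cong row) (auto simp: W0_def)
    ultimately show ?thesis by (simp only: of_real_sum)
  qed
  \<comment> \<open>A nonzero constant v contributes nothing: the exponent is a unit times the sum
    of the entries of u, which cancels over all u.\<close>
  also have "\<dots> = (\<Sum>v\<in>?N. \<Sum>u\<in>?W. corr \<Omega> n d u v)"
    unfolding W0 const_right sum_const by simp
  also have "\<dots> = (\<Sum>v\<in>?N. \<Sum>u\<in>?N. corr \<Omega> n d u v) + (\<Sum>v\<in>?N. \<Sum>c\<in>UNIV. corr \<Omega> n d (?c c) v)"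
    unfolding sum_words_split[OF n] by (rule sum.distrib)
  also have "(\<Sum>v\<in>?N. \<Sum>c\<in>UNIV. corr \<Omega> n d (?c c) v) =
      of_real (?q ^ n) - (\<Sum>c\<in>UNIV. \<Sum>c'\<in>UNIV. corr \<Omega> n d (?c c) (?c c'))"
  proof -
    have "(\<Sum>v\<in>?N. \<Sum>c\<in>UNIV. corr \<Omega> n d (?c c) v) = (\<Sum>c\<in>UNIV. \<Sum>v\<in>?N. corr \<Omega> n d (?c c) v)"
      by (rule sum.swap)
    also have "\<dots> = (\<Sum>c\<in>UNIV. (\<Sum>v\<in>?W. corr \<Omega> n d (?c c) v) - (\<Sum>c'\<in>UNIV. corr \<Omega> n d (?c c) (?c c')))"
      unfolding sum_words_split[OF n] by simp
    also have "\<dots> = (\<Sum>c\<in>UNIV. (\<Sum>v\<in>?W. corr \<Omega> n d (?c c) v)) - (\<Sum>c\<in>UNIV. \<Sum>c'\<in>UNIV. corr \<Omega> n d (?c c) (?c c'))"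
      by (rule sum_subtractf)
    also have "(\<Sum>c\<in>UNIV. (\<Sum>v\<in>?W. corr \<Omega> n d (?c c) v)) = of_real (?q ^ n)"
      unfolding const_left sum_const by simp
    finally show ?thesis .
  qed
  finally have eq: "complex_of_real (?q ^ n * avg \<Omega> (\<lambda>P. real (card {v \<in> kernel_words n d P. \<exists>l<n. v l \<noteq> (0::'a)}))) =
     (\<Sum>v\<in>?N. \<Sum>u\<in>?N. corr \<Omega> n d u v) +
     (of_real (?q ^ n) - (\<Sum>c\<in>UNIV. \<Sum>c'\<in>UNIV. corr \<Omega> n d (?c c) (?c c')))" .
  have "?q ^ n * avg \<Omega> (\<lambda>P. real (card {v \<in> kernel_words n d P. \<exists>l<n. v l \<noteq> (0::'a)})) \<le>
     norm (complex_of_real (?q ^ n * avg \<Omega> (\<lambda>P. real (card {v \<in> kernel_words n d P. \<exists>l<n. v l \<noteq> (0::'a)}))))"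
    by (simp only: norm_of_real abs_ge_self)
  also have "\<dots> \<le> (\<Sum>v\<in>?N. \<Sum>u\<in>?N. norm (corr \<Omega> n d u v)) + (?q ^ n + (\<Sum>c\<in>(UNIV::'a set). \<Sum>c'\<in>(UNIV::'a set). 1))"
    unfolding eq
  proof (intro order_trans[OF norm_triangle_ineq] add_mono order_trans[OF norm_triangle_ineq4])
    show "norm (\<Sum>v\<in>?N. \<Sum>u\<in>?N. corr \<Omega> n d u v) \<le> (\<Sum>v\<in>?N. \<Sum>u\<in>?N. norm (corr \<Omega> n d u v))"
      by (intro order_trans[OF norm_sum] sum_mono norm_sum)
    show "norm (\<Sum>c\<in>(UNIV::'a set). \<Sum>c'\<in>UNIV. corr \<Omega> n d (?c c) (?c c')) \<le> (\<Sum>c\<in>(UNIV::'a set). \<Sum>c'\<in>(UNIV::'a set). 1)"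
      by (intro order_trans[OF norm_sum] sum_mono norm_corr_le_1 fin ne)
    show "norm (complex_of_real (?q ^ n)) \<le> ?q ^ n" by (simp add: norm_power)
  qed
  also have "(\<Sum>v\<in>?N. \<Sum>u\<in>?N. norm (corr \<Omega> n d u v)) = (\<Sum>u\<in>?N. \<Sum>v\<in>?N. norm (corr \<Omega> n d u v))"
    by (rule sum.swap)
  finally have "?q ^ n * avg \<Omega> (\<lambda>P. real (card {v \<in> kernel_words n d P. \<exists>l<n. v l \<noteq> (0::'a)})) \<le>
     (\<Sum>u\<in>?N. \<Sum>v\<in>?N. norm (corr \<Omega> n d u v)) + (?q ^ n + ?q\<^sup>2)"
    by (simp add: power2_eq_square)
  then have "avg \<Omega> (\<lambda>P. real (card {v \<in> kernel_words n d P. \<exists>l<n. v l \<noteq> (0::'a)})) \<le>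
     ((\<Sum>u\<in>?N. \<Sum>v\<in>?N. norm (corr \<Omega> n d u v)) + (?q ^ n + ?q\<^sup>2)) / ?q ^ n"
    by (subst pos_le_divide_eq) (simp_all add: mult.commute)
  then show ?thesis by (simp add: add_divide_distrib)
qed

end

section \<open>Summation over non-constant words\<close>

abbreviation deviation :: "nat \<Rightarrow> 'a \<Rightarrow> (nat \<Rightarrow> 'a) \<Rightarrow> nat" where
  "deviation n c u \<equiv> card {l. l < n \<and> u l \<noteq> c}"

lemma card_deviation_le:
  fixes c :: "'a::finite"
  shows "card {u \<in> words n. deviation n c u = k} \<le> (n choose k) * CARD('a) ^ k"
proof -
  define KK where "KK = {K. K \<subseteq> {..<n} \<and> card K = k}"
  have fKK: "finite KK" by (simp add: KK_def)
  let ?h = "\<lambda>K g l. if l \<in> K then g l else if l < n then c else undefined"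
  have "{u \<in> words n. deviation n c u = k} \<subseteq> (\<Union>K\<in>KK. ?h K ` (K \<rightarrow>\<^sub>E (UNIV :: 'a set)))"
  proof
    fix u assume u: "u \<in> {u \<in> words n. deviation n c u = k}"
    let ?K = "{l. l < n \<and> u l \<noteq> c}"
    have "?K \<in> KK" using u by (auto simp: KK_def)
    moreover have "u = ?h ?K (restrict u ?K)"
    proof
      fix l show "u l = ?h ?K (restrict u ?K) l" using u PiE_arb[of u "{..<n}" _ l] by auto
    qed
    moreover have "restrict u ?K \<in> ?K \<rightarrow>\<^sub>E (UNIV :: 'a set)" by simp
    ultimately show "u \<in> (\<Union>K\<in>KK. ?h K ` (K \<rightarrow>\<^sub>E (UNIV :: 'a set)))" by blast
  qed
  then have "card {u \<in> words n. deviation n c u = k} \<le> card (\<Union>K\<in>KK. ?h K ` (K \<rightarrow>\<^sub>E (UNIV :: 'a set)))"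
    by (rule card_mono[rotated])
      (auto simp: fKK KK_def intro!: finite_UN_I finite_imageI finite_PiE intro: finite_subset[of _ "{..<n}"])
  also have "\<dots> \<le> (\<Sum>K\<in>KK. card (?h K ` (K \<rightarrow>\<^sub>E (UNIV :: 'a set))))"
    by (rule card_UN_le[OF fKK])
  also have "\<dots> \<le> (\<Sum>K\<in>KK. CARD('a) ^ k)"
  proof (rule sum_mono)
    fix K assume "K \<in> KK"
    then have K: "finite K" "card K = k" by (auto simp: KK_def intro: finite_subset)
    have "card (?h K ` (K \<rightarrow>\<^sub>E (UNIV :: 'a set))) \<le> card (K \<rightarrow>\<^sub>E (UNIV :: 'a set))"
      by (rule card_image_le) (simp add: K finite_PiE)
    then show "card (?h K ` (K \<rightarrow>\<^sub>E (UNIV :: 'a set))) \<le> CARD('a) ^ k" by (simp add: K card_PiE)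
  qed
  also have "\<dots> = (n choose k) * CARD('a) ^ k"
    using n_subsets[of "{..<n}" k] by (simp add: KK_def)
  finally show ?thesis .
qed

text \<open>With x = k / n, the count of words gives at most (e q / x)^k and, as d is at least 3,
  the last factor at most (B x)^(3k/2), which leaves (C sqrt x)^k. One factor sqrt x is kept for the
  decay 1 / sqrt n; the other k - 1 factors are at most 1/4.\<close>

lemma near_term_le:
  fixes B \<delta> q :: real
  assumes d: "3 \<le> d" and B: "0 < B" and q: "1 \<le> q" and \<delta>: "B * \<delta> \<le> 1" "exp 1 * q * B * sqrt B * sqrt \<delta> \<le> 1 / 4"
    and k: "1 \<le> k" "real k \<le> \<delta> * n"
  shows "(n choose k) * q ^ k * sqrt (B * k / n) ^ (d * k) \<le> 4 * (exp 1 * q * B * sqrt B) / sqrt n * (1 / 2) ^ k"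
proof -
  define C where "C = exp 1 * q * B * sqrt B"
  define x where "x = real k / n"
  have n: "0 < n" using k by (cases "n = 0") auto
  have x: "0 < x" "x \<le> \<delta>" using k n by (auto simp: x_def field_simps)
  have C: "0 < C" using B q by (simp add: C_def)
  have "B * x \<le> 1" using x B \<delta>(1) mult_left_mono[of x \<delta> B] by linarith
  then have "sqrt (B * x) ^ (d * k) \<le> sqrt (B * x) ^ (3 * k)"
    using B x d by (intro power_decreasing) auto
  also have "\<dots> = (sqrt (B * x) * sqrt (B * x) * sqrt (B * x)) ^ k"
    by (simp only: power_mult power3_eq_cube)
  also have "\<dots> = (B * x * (sqrt B * sqrt x)) ^ k"
    using B x by (simp add: real_sqrt_mult[symmetric])
  finally have 1: "sqrt (B * x) ^ (d * k) \<le> (B * x * (sqrt B * sqrt x)) ^ k" .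
  have "(n choose k) * q ^ k * sqrt (B * x) ^ (d * k) \<le> (exp 1 * n / k) ^ k * q ^ k * (B * x * (sqrt B * sqrt x)) ^ k"
    using B x q by (intro mult_mono binomial_le_exp_power 1) auto
  also have "\<dots> = (C * sqrt x) ^ k"
  proof -
    have "exp 1 * n / k * q * (B * x * (sqrt B * sqrt x)) = C * sqrt x"
      using n k by (simp add: C_def x_def)
    then show ?thesis by (simp only: power_mult_distrib[symmetric])
  qed
  also have "\<dots> = C * sqrt x * (C * sqrt x) ^ (k - 1)"
    using k by (simp add: power_eq_if)
  also have "\<dots> \<le> C * sqrt x * (1 / 4) ^ (k - 1)"
  proof (intro mult_left_mono power_mono)
    have "C * sqrt x \<le> C * sqrt \<delta>" using x C by simp
    then show "C * sqrt x \<le> 1 / 4" using \<delta>(2)[folded C_def] by linarith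
  qed (use C x in auto)
  \<comment> \<open>The factor sqrt k is bounded by 2^k, which raises the geometric ratio from 1/4
    to 1/2.\<close>
  also have "\<dots> \<le> C * (2 ^ k / sqrt n) * (1 / 4) ^ (k - 1)"
  proof (intro mult_right_mono mult_left_mono)
    have "sqrt k \<le> real k" using k by (intro real_le_lsqrt) (auto simp: power2_eq_square)
    also have "real k \<le> 2 ^ k" using less_exp[of k] by (metis less_imp_le of_nat_le_iff of_nat_numeral of_nat_power)
    finally show "sqrt x \<le> 2 ^ k / sqrt n" by (simp add: x_def real_sqrt_divide divide_right_mono)
  qed (use C in auto)
  also have "\<dots> = 4 * C / sqrt n * (1 / 2) ^ k"
  proof -
    have "(1 / 4 :: real) ^ (k - 1) = 4 * (1 / 4) ^ k" using k by (simp add: power_eq_if)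
    moreover have "2 ^ k * (1 / 4) ^ k = (1 / 2 :: real) ^ k" by (simp flip: power_mult_distrib)
    moreover have "C * (2 ^ k / sqrt n) * (4 * (1 / 4) ^ k) = 4 * C / sqrt n * (2 ^ k * (1 / 4) ^ k)" by simp
    ultimately show ?thesis by (simp only:)
  qed
  finally show ?thesis by (simp add: C_def x_def)
qed

lemma sum_half_powers_le: "(\<Sum>k=1..m. (1 / 2) ^ k) \<le> (1 :: real)"
proof -
  have "(\<Sum>k=1..m. (1 / 2) ^ k) = 1 - (1 / 2 :: real) ^ m"
    by (induction m) (simp_all add: sum.cl_ivl_Suc)
  then show ?thesis by simp
qed

lemma sum_near_words_le:
  fixes f :: "(nat \<Rightarrow> 'a::finite) \<Rightarrow> real" and B \<delta> :: real
  defines "q \<equiv> real CARD('a)"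
  assumes d: "3 \<le> d" and B: "0 < B" and \<delta>: "B * \<delta> \<le> 1" "exp 1 * q * B * sqrt B * sqrt \<delta> \<le> 1 / 4"
    and f0: "\<And>u. 0 \<le> f u"
    and f: "\<And>u c. u \<in> words n \<Longrightarrow> 1 \<le> deviation n c u \<Longrightarrow> deviation n c u \<le> \<delta> * n \<Longrightarrow>
       f u \<le> q ^ n * sqrt (B * deviation n c u / n) ^ (d * deviation n c u)"
  shows "(\<Sum>u | u \<in> words n \<and> (\<exists>c. 1 \<le> deviation n c u \<and> deviation n c u \<le> \<delta> * n). f u) \<le>
     q ^ n * (q * (4 * (exp 1 * q * B * sqrt B) / sqrt n))"
proof -
  define m where "m = nat \<lfloor>\<delta> * n\<rfloor>"
  let ?near = "{u :: nat \<Rightarrow> 'a. u \<in> words n \<and> (\<exists>c. 1 \<le> deviation n c u \<and> deviation n c u \<le> \<delta> * n)}"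
  have km: "k \<le> m" if "real k \<le> \<delta> * n" for k using that by (simp add: m_def le_nat_floor)
  have mk: "real k \<le> \<delta> * n" if "k \<le> m" "1 \<le> k" for k
  proof -
    have "0 < m" using that by simp
    then have "real m \<le> \<delta> * n" unfolding m_def by (simp add: of_nat_nat)
    with that show ?thesis by linarith
  qed
  \<comment> \<open>A word near several constants is counted once for each of them, which only
    increases the sum.\<close>
  let ?b = "\<lambda>c k u. of_bool (deviation n c u = k) * f u"
  have "(\<Sum>u\<in>?near. f u) \<le> (\<Sum>u\<in>?near. \<Sum>c\<in>UNIV. \<Sum>k=1..m. ?b c k u)"
  proof (rule sum_mono)
    fix u assume "u \<in> ?near"
    then obtain c where c: "1 \<le> deviation n c u" "deviation n c u \<le> \<delta> * n" by blast
    let ?k = "deviation n c u"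
    have "f u = ?b c ?k u" by simp
    also have "\<dots> \<le> (\<Sum>k=1..m. ?b c k u)"
      using c km f0 by (intro member_le_sum[of ?k "{1..m}" "\<lambda>k. ?b c k u"]) auto
    also have "\<dots> \<le> (\<Sum>c\<in>UNIV. \<Sum>k=1..m. ?b c k u)"
      using f0 by (intro member_le_sum[of c UNIV "\<lambda>c. \<Sum>k=1..m. ?b c k u"]) (auto intro!: sum_nonneg)
    finally show "f u \<le> (\<Sum>c\<in>UNIV. \<Sum>k=1..m. ?b c k u)" .
  qed
  also have "\<dots> \<le> (\<Sum>u\<in>words n. \<Sum>c\<in>UNIV. \<Sum>k=1..m. ?b c k u)"
    using f0 by (intro sum_mono2 sum_nonneg) auto
  also have "\<dots> = (\<Sum>c\<in>UNIV. \<Sum>k=1..m. \<Sum>u\<in>words n. ?b c k u)"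
    by (subst sum.swap) (intro sum.cong refl sum.swap)
  also have "\<dots> \<le> (\<Sum>c\<in>(UNIV :: 'a set). \<Sum>k=1..m. q ^ n * (4 * (exp 1 * q * B * sqrt B) / sqrt n * (1 / 2) ^ k))"
  proof (intro sum_mono)
    fix c :: 'a and k assume "k \<in> {1..m}"
    then have k: "1 \<le> k" "real k \<le> \<delta> * n" using mk by auto
    let ?A = "{u \<in> words n. deviation n c u = k}"
    have "(\<Sum>u\<in>words n. ?b c k u) = (\<Sum>u\<in>?A. f u)"
      by (simp add: of_bool_def if_distrib[of "\<lambda>z. z * _"] sum.If_cases Int_def)
    also have "\<dots> \<le> (\<Sum>u\<in>?A. q ^ n * sqrt (B * k / n) ^ (d * k))"
      using f k by (intro sum_mono) auto
    also have "\<dots> = real (card ?A) * (q ^ n * sqrt (B * k / n) ^ (d * k))" by simp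
    also have "\<dots> \<le> real ((n choose k) * CARD('a) ^ k) * (q ^ n * sqrt (B * k / n) ^ (d * k))"
      using B by (intro mult_right_mono of_nat_mono card_deviation_le) (auto simp: q_def)
    also have "\<dots> = q ^ n * ((n choose k) * q ^ k * sqrt (B * k / n) ^ (d * k))"
      by (simp add: q_def)
    also have "\<dots> \<le> q ^ n * (4 * (exp 1 * q * B * sqrt B) / sqrt n * (1 / 2) ^ k)"
      using k \<delta> d B by (intro mult_left_mono near_term_le) (auto simp: q_def Suc_le_eq)
    finally show "(\<Sum>u\<in>words n. ?b c k u) \<le> q ^ n * (4 * (exp 1 * q * B * sqrt B) / sqrt n * (1 / 2) ^ k)" .
  qed
  also have "\<dots> = q ^ n * (q * (4 * (exp 1 * q * B * sqrt B) / sqrt n)) * (\<Sum>k=1..m. (1 / 2) ^ k)"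
    by (simp add: q_def sum_distrib_left sum_divide_distrib mult_ac)
  also have "\<dots> \<le> q ^ n * (q * (4 * (exp 1 * q * B * sqrt B) / sqrt n)) * 1"
    using B by (intro mult_left_mono sum_half_powers_le) (auto simp: q_def)
  finally show ?thesis by simp
qed

section \<open>Combining the three regimes\<close>

lemma poly_exp_tendsto_0:
  assumes "0 < c"
  shows "(\<lambda>n. (real n + 1) ^ a * (real d * real n + 1) ^ b * exp (- c * real n)) \<longlonglongrightarrow> 0"
proof -
  have lim: "(\<lambda>n. (real n + 1) powr real (a + b) * exp (- c * real n)) \<longlonglongrightarrow> 0"
    using assms by real_asymp
  have "(\<lambda>n. (real d + 1) ^ b * ((real n + 1) powr real (a + b) * exp (- c * real n))) \<longlonglongrightarrow> 0"
    using tendsto_mult_left[OF lim, of "(real d + 1) ^ b"] by simp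
  then show ?thesis
  proof (rule tendsto_sandwich[OF _ _ tendsto_const, rotated 2])
    show "\<forall>\<^sub>F n in sequentially. (real n + 1) ^ a * (real d * real n + 1) ^ b * exp (- c * real n) \<le>
       (real d + 1) ^ b * ((real n + 1) powr real (a + b) * exp (- c * real n))"
    proof (intro always_eventually allI)
      fix n
      have "(real d * real n + 1) ^ b \<le> ((real d + 1) * (real n + 1)) ^ b"
        by (intro power_mono) (auto simp: algebra_simps)
      then have "(real n + 1) ^ a * (real d * real n + 1) ^ b * exp (- c * real n) \<le>
         (real n + 1) ^ a * ((real d + 1) * (real n + 1)) ^ b * exp (- c * real n)"
        by (intro mult_right_mono mult_left_mono) auto
      also have "\<dots> = (real d + 1) ^ b * ((real n + 1) powr real (a + b) * exp (- c * real n))"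
      proof -
        have "(real n + 1) powr real (a + b) = (real n + 1) ^ (a + b)" by (rule powr_realpow) simp
        then show ?thesis by (simp only: power_add power_mult_distrib mult_ac)
      qed
      finally show "(real n + 1) ^ a * (real d * real n + 1) ^ b * exp (- c * real n) \<le>
         (real d + 1) ^ b * ((real n + 1) powr real (a + b) * exp (- c * real n))" .
    qed
  qed auto
qed

text \<open>Put x = Q s. If x is at least h^2, then h^4 is at most h x; otherwise x^(d/2) is at most
  x^(3/2), which gains sqrt x < h over x. The result is linear in s, so that it can be summed over
  all pairs.\<close>

lemma min_uncertainty_exp_le:
  fixes E s Q M h :: real
  assumes d: "3 \<le> d" and Q: "0 < Q" and s: "0 \<le> s" and M: "1 \<le> M" and h: "0 < h" "h \<le> 1"
    and E1: "E \<le> M * sqrt (Q * s) ^ d" and E2: "E \<le> h ^ 4"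
  shows "E / Q \<le> M * h * s"
proof -
  let ?x = "Q * s"
  have x: "0 \<le> ?x" using Q s by simp
  have "E \<le> M * h * ?x"
  proof (cases "h ^ 2 \<le> ?x")
    case True
    have "h ^ 4 = h * h * h ^ 2" by (simp add: eval_nat_numeral)
    also have "\<dots> \<le> 1 * h * ?x" using h True by (intro mult_mono) auto
    also have "\<dots> \<le> M * h * ?x" using M h x by (intro mult_right_mono) auto
    finally show ?thesis using E2 by simp
  next
    case False
    have sx: "sqrt ?x \<le> h" using False h by (intro real_le_lsqrt) auto
    have "sqrt ?x ^ d \<le> sqrt ?x ^ 3"
      using x by (intro power_decreasing[OF d _ order_trans[OF sx h(2)]]) simp
    also have "\<dots> = sqrt ?x * ?x" using x by (simp add: power3_eq_cube)
    also have "\<dots> \<le> h * ?x" using sx x by (rule mult_right_mono)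
    finally have "M * sqrt ?x ^ d \<le> M * (h * ?x)" using M by (intro mult_left_mono) auto
    then show ?thesis using E1 by (simp add: mult.assoc)
  qed
  then show ?thesis using Q by (simp add: field_simps)
qed

text \<open>Isolates what both models share. \<open>E\<close> stands for the norm of a correlation
  and \<open>s\<close> for the weight of a type class of pairs, so \<open>sum_s\<close> bounds the
  number of classes. Pairs with a word near some constant are handled by \<open>near_left\<close>
  and \<open>near_right\<close>; \<open>far\<close> and \<open>unc\<close> are combined for the
  remaining pairs.\<close>

theorem nonconst_sum_tendsto_0:
  fixes E s :: "nat \<Rightarrow> (nat \<Rightarrow> 'a::finite) \<Rightarrow> (nat \<Rightarrow> 'a) \<Rightarrow> real" and B \<eta> :: real
  defines "q \<equiv> real CARD('a)"
  assumes d: "3 \<le> d" and B: "0 < B" and \<eta>: "0 < \<eta>"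
    and E0: "\<And>n u v. 0 \<le> E n u v"
    and near_left: "\<And>n u c. u \<in> words n \<Longrightarrow> 1 \<le> deviation n c u \<Longrightarrow> deviation n c u \<le> \<eta> * n \<Longrightarrow>
       (\<Sum>v\<in>words n. E n u v) \<le> q ^ n * sqrt (B * deviation n c u / n) ^ (d * deviation n c u)"
    and near_right: "\<And>n v c. v \<in> words n \<Longrightarrow> 1 \<le> deviation n c v \<Longrightarrow> deviation n c v \<le> \<eta> * n \<Longrightarrow>
       (\<Sum>u\<in>words n. E n u v) \<le> q ^ n * sqrt (B * deviation n c v / n) ^ (d * deviation n c v)"
    and far: "\<And>\<delta>::real. 0 < \<delta> \<Longrightarrow> \<exists>c>0::real. \<forall>\<^sub>F n in sequentially. \<forall>u\<in>words n. \<forall>v\<in>words n.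
       (\<forall>a. \<delta> * real n < real (deviation n a u)) \<longrightarrow> (\<forall>a. \<delta> * real n < real (deviation n a v)) \<longrightarrow> E n u v \<le> exp (- c * real n)"
    and s0: "\<And>n u v. 0 \<le> s n u v"
    and unc: "\<And>n u v. u \<in> words n \<Longrightarrow> v \<in> words n \<Longrightarrow> E n u v \<le> (real d * real n + 1) ^ b * sqrt (q ^ n * s n u v) ^ d"
    and sum_s: "\<And>n. (\<Sum>u\<in>words n. \<Sum>v\<in>words n. s n u v) \<le> (real n + 1) ^ a"
  shows "(\<lambda>n. (\<Sum>u\<in>nonconst_words n. \<Sum>v\<in>nonconst_words n. E n u v) / q ^ n) \<longlonglongrightarrow> 0"
proof -
  define C where "C = exp 1 * q * B * sqrt B"
  have q: "1 \<le> q" by (simp add: q_def Suc_le_eq)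
  have C: "0 < C" using B q by (simp add: C_def)
  \<comment> \<open>Small enough for the near estimates, for B x to be at most 1, and for the ratio
    C sqrt x to be at most 1/4. The rate c depends on this choice, hence \<open>far\<close> is
    assumed for every \<delta>.\<close>
  define \<delta> where "\<delta> = min \<eta> (min (1 / B) (1 / (4 * C)\<^sup>2))"
  have \<delta>: "0 < \<delta>" "\<delta> \<le> \<eta>" "B * \<delta> \<le> 1" "C * sqrt \<delta> \<le> 1 / 4"
  proof -
    show "0 < \<delta>" "\<delta> \<le> \<eta>" using \<eta> B C by (auto simp: \<delta>_def)
    have "\<delta> \<le> 1 / B" by (simp add: \<delta>_def)
    then show "B * \<delta> \<le> 1" using B by (simp add: field_simps)
    have "sqrt \<delta> \<le> sqrt (1 / (4 * C)\<^sup>2)" by (simp only: real_sqrt_le_iff) (simp add: \<delta>_def)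
    also have "\<dots> = 1 / (4 * C)" using C by (simp only: real_sqrt_divide real_sqrt_one real_sqrt_abs)
    finally show "C * sqrt \<delta> \<le> 1 / 4" using C by (simp add: field_simps)
  qed
  from far[OF \<delta>(1)] obtain c where c: "0 < c"
    and ev: "\<forall>\<^sub>F n in sequentially. \<forall>u\<in>words n. \<forall>v\<in>words n. (\<forall>a. \<delta> * real n < real (deviation n a u)) \<longrightarrow>
        (\<forall>a. \<delta> * real n < real (deviation n a v)) \<longrightarrow> E n u v \<le> exp (- c * real n)" by blast
  define near where "near n = {u :: nat \<Rightarrow> 'a. u \<in> words n \<and> (\<exists>c. 1 \<le> deviation n c u \<and> deviation n c u \<le> \<delta> * n)}" for n
  define mid where "mid n = {u :: nat \<Rightarrow> 'a. u \<in> words n \<and> (\<forall>a. \<delta> * n < deviation n a u)}" for n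
  have fin: "finite (near n)" "finite (mid n)" "finite (nonconst_words n :: (nat \<Rightarrow> 'a) set)" for n
    unfolding near_def mid_def nonconst_words_def by (auto intro: finite_subset[OF _ finite_words])
  have cover: "nonconst_words n \<subseteq> near n \<union> mid n" for n
  proof
    fix u :: "nat \<Rightarrow> 'a" assume u: "u \<in> nonconst_words n"
    have "1 \<le> deviation n c u" for c
    proof -
      obtain l where "l < n" "u l \<noteq> c" using u by (auto simp: nonconst_words_def)
      then have "{l. l < n \<and> u l \<noteq> c} \<noteq> {}" by blast
      then show ?thesis by (simp add: Suc_le_eq card_gt_0_iff)
    qed
    then show "u \<in> near n \<union> mid n"
      using u unfolding near_def mid_def nonconst_words_def by (auto simp: not_le[symmetric])
  qed
  define U where "U n = 2 * (q * (4 * C / sqrt n)) +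
     (real n + 1) ^ a * (real d * real n + 1) ^ b * exp (- (c / 4) * real n)" for n
  have hi: "\<forall>\<^sub>F n in sequentially. (\<Sum>u\<in>nonconst_words n. \<Sum>v\<in>nonconst_words n. E n u v) / q ^ n \<le> U n"
    using ev
  proof eventually_elim
    case (elim n)
    let ?N = "nonconst_words n :: (nat \<Rightarrow> 'a) set" and ?W = "words n :: (nat \<Rightarrow> 'a) set"
    have near1: "(\<Sum>u\<in>near n. \<Sum>v\<in>?W. E n u v) \<le> q ^ n * (q * (4 * C / sqrt n))"
      unfolding near_def C_def q_def
    proof (rule sum_near_words_le[OF d B \<delta>(3) \<delta>(4)[unfolded C_def q_def]])
      fix u :: "nat \<Rightarrow> 'a" and c
      assume "u \<in> ?W" "1 \<le> deviation n c u" "deviation n c u \<le> \<delta> * n"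
      then show "(\<Sum>v\<in>?W. E n u v) \<le> real CARD('a) ^ n * sqrt (B * deviation n c u / n) ^ (d * deviation n c u)"
        using mult_right_mono[OF \<delta>(2), of n] by (intro near_left[unfolded q_def]) linarith+
    qed (simp add: E0 sum_nonneg)
    have near2: "(\<Sum>v\<in>near n. \<Sum>u\<in>?W. E n u v) \<le> q ^ n * (q * (4 * C / sqrt n))"
      unfolding near_def C_def q_def
    proof (rule sum_near_words_le[OF d B \<delta>(3) \<delta>(4)[unfolded C_def q_def]])
      fix v :: "nat \<Rightarrow> 'a" and c
      assume "v \<in> ?W" "1 \<le> deviation n c v" "deviation n c v \<le> \<delta> * n"
      then show "(\<Sum>u\<in>?W. E n u v) \<le> real CARD('a) ^ n * sqrt (B * deviation n c v / n) ^ (d * deviation n c v)"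
        using mult_right_mono[OF \<delta>(2), of n] by (intro near_right[unfolded q_def]) linarith+
    qed (simp add: E0 sum_nonneg)
    \<comment> \<open>The rate is divided by 4 so that \<open>?h ^ 4\<close> is the bound from
      \<open>far\<close>; one power of \<open>?h\<close> survives the trade with the uncertainty
      bound.\<close>
    let ?M = "(real d * real n + 1) ^ b" and ?h = "exp (- (c / 4) * real n)"
    have "(\<Sum>u\<in>mid n. \<Sum>v\<in>mid n. E n u v) \<le> (\<Sum>u\<in>mid n. \<Sum>v\<in>mid n. q ^ n * (?M * ?h * s n u v))"
    proof (intro sum_mono)
      fix u v assume uv: "u \<in> mid n" "v \<in> mid n"
      then have W: "u \<in> ?W" "v \<in> ?W" by (auto simp: mid_def)
      have "E n u v \<le> exp (- c * real n)" using elim uv by (auto simp: mid_def)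
      also have "exp (- c * real n) = ?h ^ 4" by (simp add: exp_of_nat_mult[symmetric])
      finally have "E n u v / q ^ n \<le> ?M * ?h * s n u v"
        using unc[OF W] q c by (intro min_uncertainty_exp_le[OF d _ s0]) (auto simp: add.commute)
      then show "E n u v \<le> q ^ n * (?M * ?h * s n u v)" using q by (simp add: field_simps)
    qed
    also have "\<dots> \<le> (\<Sum>u\<in>?W. \<Sum>v\<in>?W. q ^ n * (?M * ?h * s n u v))"
    proof (rule order_trans)
      show "(\<Sum>u\<in>mid n. \<Sum>v\<in>mid n. q ^ n * (?M * ?h * s n u v)) \<le> (\<Sum>u\<in>mid n. \<Sum>v\<in>?W. q ^ n * (?M * ?h * s n u v))"
        using q s0 by (intro sum_mono sum_mono2) (auto simp: mid_def)
      show "(\<Sum>u\<in>mid n. \<Sum>v\<in>?W. q ^ n * (?M * ?h * s n u v)) \<le> (\<Sum>u\<in>?W. \<Sum>v\<in>?W. q ^ n * (?M * ?h * s n u v))"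
        using q s0 by (intro sum_mono2) (auto simp: mid_def intro!: sum_nonneg)
    qed
    also have "\<dots> = q ^ n * (?M * ?h * (\<Sum>u\<in>?W. \<Sum>v\<in>?W. s n u v))"
      by (simp add: sum_distrib_left)
    also have "\<dots> \<le> q ^ n * (?M * ?h * (real n + 1) ^ a)"
      using q by (intro mult_left_mono sum_s) auto
    finally have mid: "(\<Sum>u\<in>mid n. \<Sum>v\<in>mid n. E n u v) \<le> q ^ n * (?M * ?h * (real n + 1) ^ a)" .
    have sub: "near n \<subseteq> ?W" "mid n \<subseteq> ?W" "?N \<subseteq> ?W" by (auto simp: near_def mid_def nonconst_words_def)
    have "(\<Sum>u\<in>?N. \<Sum>v\<in>?N. E n u v) = (\<Sum>(u, v)\<in>?N \<times> ?N. E n u v)"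
      by (rule sum.cartesian_product)
    also have "\<dots> \<le> (\<Sum>(u, v)\<in>(near n \<times> ?W \<union> ?W \<times> near n) \<union> mid n \<times> mid n. E n u v)"
      using cover[of n] sub fin E0 by (intro sum_mono2) auto
    also have "\<dots> \<le> (\<Sum>(u, v)\<in>near n \<times> ?W \<union> ?W \<times> near n. E n u v) + (\<Sum>(u, v)\<in>mid n \<times> mid n. E n u v)"
      using fin E0 by (subst sum_Un) (auto intro!: sum_nonneg)
    also have "(\<Sum>(u, v)\<in>near n \<times> ?W \<union> ?W \<times> near n. E n u v) \<le>
        (\<Sum>(u, v)\<in>near n \<times> ?W. E n u v) + (\<Sum>(u, v)\<in>?W \<times> near n. E n u v)"
      using fin E0 by (subst sum_Un) (auto intro!: sum_nonneg)
    also have "\<dots> = (\<Sum>u\<in>near n. \<Sum>v\<in>?W. E n u v) + (\<Sum>v\<in>near n. \<Sum>u\<in>?W. E n u v)"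
      by (simp add: sum.cartesian_product[symmetric]) (rule sum.swap)
    also have "(\<Sum>(u, v)\<in>mid n \<times> mid n. E n u v) = (\<Sum>u\<in>mid n. \<Sum>v\<in>mid n. E n u v)"
      by (rule sum.cartesian_product[symmetric])
    finally have "(\<Sum>u\<in>?N. \<Sum>v\<in>?N. E n u v) \<le> (\<Sum>u\<in>near n. \<Sum>v\<in>?W. E n u v) +
        (\<Sum>v\<in>near n. \<Sum>u\<in>?W. E n u v) + (\<Sum>u\<in>mid n. \<Sum>v\<in>mid n. E n u v)" by simp
    also have "\<dots> \<le> q ^ n * (q * (4 * C / sqrt n)) + q ^ n * (q * (4 * C / sqrt n)) + q ^ n * (?M * ?h * (real n + 1) ^ a)"
      by (intro add_mono near1 near2 mid)
    also have "\<dots> = q ^ n * U n" by (simp add: U_def algebra_simps)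
    finally have "(\<Sum>u\<in>?N. \<Sum>v\<in>?N. E n u v) \<le> q ^ n * U n" .
    then show ?case using q by (simp add: field_simps)
  qed
  have lim: "U \<longlonglongrightarrow> 0"
  proof -
    have "(\<lambda>n. 2 * (q * (4 * C / sqrt (real n)))) \<longlonglongrightarrow> 0" by real_asymp
    from tendsto_add[OF this poly_exp_tendsto_0[of "c / 4" a d b]] c show ?thesis
      unfolding U_def by simp
  qed
  have lo: "\<forall>\<^sub>F n in sequentially. 0 \<le> (\<Sum>u\<in>nonconst_words n. \<Sum>v\<in>nonconst_words n. E n u v) / q ^ n"
    using E0 q by (intro always_eventually allI divide_nonneg_nonneg sum_nonneg) auto
  show ?thesis by (rule tendsto_sandwich[OF lo hi tendsto_const lim])
qed

section \<open>The directed model\<close>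

lemma prod_remove2:
  assumes "finite X" "a \<in> X" "b \<in> X" "a \<noteq> b"
  shows "prod f X = f a * f b * prod f (X - {a, b})"
proof -
  have "prod f X = f a * prod f (X - {a})" by (rule prod.remove) (use assms in auto)
  also have "prod f (X - {a}) = f b * prod f (X - {a} - {b})" by (rule prod.remove) (use assms in auto)
  also have "X - {a} - {b} = X - {a, b}" by auto
  finally show ?thesis by (simp add: mult.assoc)
qed

text \<open>A swap whose block meets its targets saves a factor \<rho>, on average a factor 1 - c0
  per swap. The constant 64 suits \<open>r \<le> 4\<close>: the cost 2 (r Q)^2 / N of sampling
  without replacement, with N points, is then at most half of the gain c0 Q.\<close>

lemma norm_avg_swap_le:
  fixes H :: "('x \<Rightarrow> 'x) \<Rightarrow> complex" and t :: "nat \<Rightarrow> 'x \<Rightarrow> 'x" and \<gamma> \<rho> c0 :: real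
  assumes fin: "finite X" and N: "0 < card X"
    and t: "\<And>q. q < Q \<Longrightarrow> t q permutes X"
    and H: "\<And>q \<sigma>. q < Q \<Longrightarrow> \<sigma> permutes X \<Longrightarrow> H (\<sigma> \<circ> t q) = H \<sigma> * z q \<sigma>"
    and z: "\<And>q r \<sigma>. q < Q \<Longrightarrow> r < q \<Longrightarrow> \<sigma> permutes X \<Longrightarrow> z r (\<sigma> \<circ> t q) = z r \<sigma>"
    and nH: "\<And>\<sigma>. norm (H \<sigma>) = 1" and nz: "\<And>q \<sigma>. norm (z q \<sigma>) = 1"
    and good: "\<And>q \<sigma>. q < Q \<Longrightarrow> \<forall>b\<in>B q. \<sigma> b \<in> T b \<Longrightarrow> norm ((1 + z q \<sigma>) / 2) \<le> \<rho>"
    and B: "disjoint_family_on B {..<Q}" "\<And>q. q < Q \<Longrightarrow> B q \<subseteq> X" "\<And>q. q < Q \<Longrightarrow> card (B q) = r"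
    and T: "\<And>b. T b \<subseteq> X" "\<And>b. \<gamma> * card X \<le> card (T b)" and \<gamma>: "0 \<le> \<gamma>" "\<gamma> \<le> 1" and \<rho>: "0 \<le> \<rho>" "\<rho> \<le> 1"
    and c0: "c0 = (1 - \<rho>) * \<gamma> ^ r" and r: "r \<le> 4" and Q: "real Q \<le> c0 * card X / 64"
  shows "norm (avg (perms X) H) \<le> exp (- c0 * Q / 2)"
proof -
  let ?P = "perms X" and ?N = "card X"
  have c01: "0 \<le> c0" "c0 \<le> 1" unfolding c0 using \<gamma> \<rho> by (auto intro!: mult_le_one power_le_one)
  have "avg ?P H = avg ?P (\<lambda>\<sigma>. H \<sigma> * (\<Prod>q<Q. (1 + z q \<sigma>) / 2))"
    by (rule avg_perms_swap[where t = t]) (fact t H z)+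
  then have "norm (avg ?P H) = norm (avg ?P (\<lambda>\<sigma>. H \<sigma> * (\<Prod>q<Q. (1 + z q \<sigma>) / 2)))"
    by (rule arg_cong)
  also have "\<dots> \<le> avg ?P (\<lambda>\<sigma>. norm (H \<sigma> * (\<Prod>q<Q. (1 + z q \<sigma>) / 2)))"
    by (rule norm_avg_le)
  also have "\<dots> \<le> avg ?P (\<lambda>\<sigma>. \<Prod>q<Q. if \<forall>b\<in>B q. \<sigma> b \<in> T b then \<rho> else 1)"
  proof (rule avg_mono)
    fix \<sigma> assume "\<sigma> \<in> ?P"
    have "norm (H \<sigma> * (\<Prod>q<Q. (1 + z q \<sigma>) / 2)) = (\<Prod>q<Q. norm ((1 + z q \<sigma>) / 2))"
      by (simp only: norm_mult nH prod_norm mult_1)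
    also have "\<dots> \<le> (\<Prod>q<Q. if \<forall>b\<in>B q. \<sigma> b \<in> T b then \<rho> else 1)"
    proof (rule prod_mono)
      fix q assume "q \<in> {..<Q}"
      then have q: "q < Q" by simp
      have "norm (1 + z q \<sigma>) \<le> norm (1 :: complex) + norm (z q \<sigma>)" by (rule norm_triangle_ineq)
      then have "norm ((1 + z q \<sigma>) / 2) \<le> 1" by (simp add: nz norm_divide)
      with good[OF q, of \<sigma>] show "0 \<le> norm ((1 + z q \<sigma>) / 2) \<and>
          norm ((1 + z q \<sigma>) / 2) \<le> (if \<forall>b\<in>B q. \<sigma> b \<in> T b then \<rho> else 1)" by (simp split: if_split)
    qed
    finally show "norm (H \<sigma> * (\<Prod>q<Q. (1 + z q \<sigma>) / 2)) \<le> (\<Prod>q<Q. if \<forall>b\<in>B q. \<sigma> b \<in> T b then \<rho> else 1)" .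
  qed
  also have "\<dots> \<le> fact (?N - r * Q) / fact ?N * real ?N ^ (r * Q) * (1 - c0) ^ Q"
    unfolding c0 by (rule avg_perm_blocks_le[OF fin B T \<gamma>(1) \<rho>])
  also have "\<dots> \<le> exp (2 * real (r * Q) ^ 2 / ?N) * exp (- c0) ^ Q"
  proof (intro mult_mono power_mono)
    have "real (r * Q) \<le> 4 * real Q" using r by (simp add: mult_right_mono)
    also have "4 * real Q \<le> c0 * ?N / 16" using Q by simp
    also have "\<dots> \<le> ?N / 2" using c01 mult_right_mono[of c0 1 "real ?N"] by simp
    finally have "2 * (r * Q) \<le> ?N" by linarith
    then show "fact (?N - r * Q) / fact ?N * real ?N ^ (r * Q) \<le> exp (2 * real (r * Q) ^ 2 / ?N)"
      by (rule fact_ratio_exp_le[OF _ N])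
    show "1 - c0 \<le> exp (- c0)" using exp_ge_add_one_self[of "- c0"] by simp
  qed (use c01 in auto)
  also have "\<dots> = exp (2 * real (r * Q) ^ 2 / ?N - c0 * Q)"
    by (simp add: exp_of_nat_mult[symmetric] exp_add[symmetric] mult.commute)
  also have "\<dots> \<le> exp (- c0 * Q / 2)"
  proof -
    have "real (r * Q) ^ 2 \<le> (4 * real Q) ^ 2" using r by (intro power_mono) (auto simp: mult_right_mono)
    also have "\<dots> = 16 * (real Q * real Q)" by (simp add: power2_eq_square)
    also have "\<dots> \<le> 16 * (real Q * (c0 * ?N / 64))" by (intro mult_left_mono Q) auto
    finally have "2 * real (r * Q) ^ 2 / ?N \<le> c0 * Q / 2" using N by (simp add: field_simps)
    then show ?thesis by simp
  qed
  finally show ?thesis .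
qed

text \<open>Takes Q as large as allowed. Since c0 N / 64 is at least 2, rounding down loses at most
  half, so Q is at least c0 N / 128, and c0 Q / 2 produces the 256.\<close>

lemma exp_floor_le:
  fixes c0 N E :: real
  assumes c0: "0 < c0" and N: "128 / c0 \<le> N" and E: "\<And>Q::nat. real Q \<le> c0 * N / 64 \<Longrightarrow> E \<le> exp (- c0 * Q / 2)"
  shows "E \<le> exp (- (c0\<^sup>2 / 256) * N)"
proof -
  define Q where "Q = nat \<lfloor>c0 * N / 64\<rfloor>"
  have big: "128 \<le> c0 * N" using N c0 by (simp add: field_simps)
  have Q: "real Q \<le> c0 * N / 64" "c0 * N / 64 - 1 \<le> real Q"
    unfolding Q_def using big by linarith+
  then have "c0 * N / 128 \<le> real Q" using big by linarith
  then have "c0 * (c0 * N / 128) \<le> c0 * Q" using c0 by (intro mult_left_mono) auto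
  then have "- c0 * Q / 2 \<le> - (c0\<^sup>2 / 256) * N" by (simp add: power2_eq_square algebra_simps)
  then show ?thesis using E[OF Q(1)] by (meson exp_le_cancel_iff order_trans)
qed

text \<open>Pigeonhole, twice: a letter e popular among all places, and a letter e' popular among
  the more than \<delta> n places where \<open>f (w l)\<close> differs from \<open>f e\<close>. The
  map f is the identity for a single word and a projection for a word of pairs.\<close>

lemma popular_values:
  fixes w :: "nat \<Rightarrow> 'c::finite" and \<delta> :: real
  assumes \<delta>: "0 < \<delta>" "\<delta> \<le> 1" and n: "0 < n" and dev: "\<And>a. \<delta> * n < deviation n a (\<lambda>l. f (w l))"
  obtains e e' where "f e \<noteq> f e'" "\<delta> / CARD('c) * n \<le> card {l. l < n \<and> w l = e}"
    "\<delta> / CARD('c) * n \<le> card {l. l < n \<and> w l = e'}"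
proof -
  have pigeon: "\<exists>e\<in>w ` A. \<delta> / CARD('c) * n \<le> card {l. l < n \<and> w l = e}"
    if A: "A \<subseteq> {..<n}" "\<delta> * n \<le> card A" for A
  proof (rule ccontr)
    assume "\<not> ?thesis"
    then have less: "card {l. l < n \<and> w l = e} < \<delta> / CARD('c) * n" if "e \<in> w ` A" for e
      using that by (auto simp: not_le)
    have fA: "finite A" using A finite_subset by blast
    have "0 < real (card A)" using A(2) \<delta> n by (smt (verit) mult_pos_pos of_nat_0_less_iff)
    then have ne: "A \<noteq> {}" by auto
    have "real (card A) = (\<Sum>e\<in>w ` A. real (card {l\<in>A. w l = e}))"
      using sum.group[OF fA finite_imageI[OF fA], of w w "\<lambda>_. 1::real"] by simp
    also have "\<dots> < (\<Sum>e\<in>w ` A. \<delta> / CARD('c) * n)"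
    proof (rule sum_strict_mono)
      fix e assume "e \<in> w ` A"
      have "card {l\<in>A. w l = e} \<le> card {l. l < n \<and> w l = e}" using A by (intro card_mono) auto
      then show "real (card {l\<in>A. w l = e}) < \<delta> / CARD('c) * n" using less[OF \<open>e \<in> w ` A\<close>] by linarith
    qed (use ne fA in auto)
    also have "\<dots> = real (card (w ` A)) * (\<delta> / CARD('c) * n)" by simp
    also have "\<dots> \<le> real CARD('c) * (\<delta> / CARD('c) * n)"
      using \<delta> by (intro mult_right_mono of_nat_mono card_mono) auto
    finally show False using A(2) by simp
  qed
  have "\<delta> * n \<le> card {..<n}" using \<delta> by (simp add: mult_left_le_one_le)
  from pigeon[OF order_refl this] obtain e where e: "\<delta> / CARD('c) * n \<le> card {l. l < n \<and> w l = e}" by blast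
  have "\<delta> * n \<le> card {l. l < n \<and> f (w l) \<noteq> f e}" using dev[of "f e"] by simp
  from pigeon[OF _ this] obtain e' where "e' \<in> w ` {l. l < n \<and> f (w l) \<noteq> f e}"
     "\<delta> / CARD('c) * n \<le> card {l. l < n \<and> w l = e'}" by auto
  then show ?thesis using e by (intro that[of e e']) auto
qed

lemma obtain_injection:
  assumes "Q \<le> card A"
  obtains a :: "nat \<Rightarrow> 'x" where "inj_on a {..<Q}" "a ` {..<Q} \<subseteq> A"
proof -
  obtain A' where A': "A' \<subseteq> A" "card A' = Q" "finite A'"
    using obtain_subset_with_card_n[OF assms] by blast
  then obtain a where "bij_betw a {0..<Q} A'" using ex_bij_betw_nat_finite[of A'] by auto
  then show ?thesis using A' by (intro that[of a]) (auto simp: bij_betw_def atLeast0LessThan)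
qed

lemma card_points_fst: "card {x \<in> points n d. R (fst x)} = card {l. l < n \<and> R l} * d"
proof -
  have "{x \<in> points n d. R (fst x)} = {l. l < n \<and> R l} \<times> {..<d}" by (auto simp: points_eq)
  then show ?thesis by (simp add: card_cartesian_product)
qed

lemma card_points: "card (points n d) = n * d"
  by (simp add: points_eq card_cartesian_product)

section \<open>Estimates for uniform permutations\<close>

context additive_character
begin

text \<open>The squared norm of \<open>1 + \<omega> x\<close> is
  \<open>2 + 2 * Re (\<omega> x)\<close>, and 1 is the only point of the unit circle with real part
  1. Finiteness of the field makes the bound uniform.\<close>

lemma ex_half_angle_bound: "\<exists>\<rho>. 0 \<le> \<rho> \<and> \<rho> < 1 \<and> (\<forall>x. x \<noteq> 0 \<longrightarrow> norm ((1 + \<omega> x) / 2) \<le> \<rho>)"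
proof -
  have lt: "norm ((1 + \<omega> x) / 2) < 1" if "x \<noteq> 0" for x
  proof -
    have n1: "(Re (\<omega> x))\<^sup>2 + (Im (\<omega> x))\<^sup>2 = 1"
      using norm_chi[of x] by (metis cmod_power2 power_one)
    have "Re (\<omega> x) \<noteq> 1"
    proof
      assume "Re (\<omega> x) = 1"
      with n1 have "\<omega> x = 1" by (simp add: complex_eq_iff)
      with chi_eq_1 that show False by blast
    qed
    moreover have "Re (\<omega> x) \<le> 1" using complex_Re_le_cmod[of "\<omega> x"] by (simp add: norm_chi)
    ultimately have "Re (\<omega> x) < 1" by simp
    moreover have "(norm (1 + \<omega> x))\<^sup>2 = 2 + 2 * Re (\<omega> x)"
      using n1 by (simp add: cmod_power2 power2_sum)
    ultimately have "(norm (1 + \<omega> x))\<^sup>2 < 2\<^sup>2" by simp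
    then have "norm (1 + \<omega> x) < 2" by (rule power_less_imp_less_base) simp
    then show ?thesis by (simp add: norm_divide)
  qed
  let ?A = "(\<lambda>x. norm ((1 + \<omega> x) / 2)) ` (UNIV - {0})"
  have "(1 :: 'a) \<in> UNIV - {0}" by simp
  then have A: "finite ?A" "?A \<noteq> {}" by (simp, blast)
  have "Max ?A \<in> ?A" using A by (rule Max_in)
  then obtain x where x: "x \<noteq> 0" "Max ?A = norm ((1 + \<omega> x) / 2)" by blast
  then have "0 \<le> Max ?A" "Max ?A < 1" using lt[OF x(1)] by (simp_all only: norm_ge_zero)
  moreover have "norm ((1 + \<omega> x) / 2) \<le> Max ?A" if "x \<noteq> 0" for x
    using A that by (intro Max_ge) auto
  ultimately show ?thesis by blast
qed

lemma orth_chi: "(\<Sum>a\<in>UNIV. \<omega> (a * b) * cnj (\<omega> (a * b'))) = (if b = b' then of_nat CARD('a) else 0)"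
proof -
  have "(\<Sum>a\<in>UNIV. \<omega> (a * b) * cnj (\<omega> (a * b'))) = (\<Sum>a\<in>UNIV. \<omega> ((b - b') * a))"
    by (simp add: chi_diff[symmetric] algebra_simps)
  then show ?thesis by (simp add: sum_chi)
qed

lemma directed_corr_uncertainty:
  "norm (corr (perms (points n d)) n d u v) \<le>
     sqrt (real CARD('a) ^ n * (type_weight {..<n} u * type_weight {..<n} v)) ^ d"
proof -
  let ?X = "points n d" and ?q = "real CARD('a)"
  have "norm (corr (perms ?X) n d u v) \<le>
      sqrt (?q ^ card ?X * type_weight ?X (\<lambda>x. u (fst x)) * type_weight ?X (\<lambda>x. v (fst x)))"
    unfolding corr_def phase_def using uncertainty[OF finite_points[of n d] orth_chi, of "\<lambda>x. u (fst x)" "\<lambda>x. v (fst x)"] .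
  also have "\<dots> \<le> sqrt (?q ^ (n * d) * type_weight {..<n} u ^ d * type_weight {..<n} v ^ d)"
    unfolding card_points unfolding points_eq
    by (intro real_sqrt_le_mono mult_mono mult_left_mono type_weight_blowup)
      (auto intro!: mult_nonneg_nonneg zero_le_power less_imp_le[OF type_weight_pos])
  also have "\<dots> = sqrt (?q ^ n * (type_weight {..<n} u * type_weight {..<n} v)) ^ d"
    by (simp only: power_mult power_mult_distrib real_sqrt_power[symmetric] mult.assoc)
  finally show ?thesis .
qed

text \<open>After the shift by c only the points of the support remain in the product, d for each
  deviating vertex, and all fibers are random. The bound n / d on the deviation makes these points
  at most as many as the fibers.\<close>

lemma directed_corr_near:
  assumes u: "1 \<le> deviation n c u" "deviation n c u \<le> (1 / d) * n" and d: "2 \<le> d"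
  shows "(\<Sum>v\<in>words n. norm (corr (perms (points n d)) n d u v)) \<le>
    real CARD('a) ^ n * sqrt (4 * exp 1 * d * deviation n c u / n) ^ (d * deviation n c u)"
proof -
  let ?X = "points n d" and ?k = "deviation n c u"
  define S where "S = {x \<in> ?X. u (fst x) - c \<noteq> 0}"
  have cS: "card S = ?k * d" unfolding S_def using card_points_fst[of n d "\<lambda>l. u l - c \<noteq> 0"] by simp
  have X: "?X = {..<n} \<times> {..<d}" by (rule points_eq)
  have SX: "{x \<in> S. x \<in> {..<n} \<times> {..<d}} = S" by (auto simp: S_def X)
  have "norm (corr (perms ?X) n d u v) = norm (avg (perms ({..<n} \<times> {..<d})) (\<lambda>\<pi>. \<Prod>x\<in>S. \<omega> ((u (fst x) - c) * v (fst (\<pi> x)))))" for v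
  proof -
    have "norm (corr (perms ?X) n d u v) = norm (corr (perms ?X) n d (\<lambda>l. u l - c) v)"
      by (rule norm_corr_shift[symmetric]) simp
    also have "corr (perms ?X) n d (\<lambda>l. u l - c) v = avg (perms ?X) (\<lambda>\<pi>. \<Prod>x\<in>S. \<omega> ((u (fst x) - c) * v (fst (\<pi> x))))"
      unfolding corr_def phase_def
      by (intro avg_cong prod.mono_neutral_right) (auto simp: S_def finite_points chi_0)
    finally show ?thesis by (simp only: X)
  qed
  then have "(\<Sum>v\<in>words n. norm (corr (perms ?X) n d u v)) =
     (\<Sum>v\<in>words n. norm (avg (perms ({..<n} \<times> {..<d})) (\<lambda>\<pi>. \<Prod>x\<in>S. \<omega> ((u (fst x) - c) * v (fst (\<pi> x))))))"
    by simp
  also have "\<dots> \<le> real CARD('a) ^ card {..<n} * sqrt ((4 * exp 1 * card {x \<in> S. x \<in> {..<n} \<times> {..<d}} / card {..<n}) ^ card {x \<in> S. x \<in> {..<n} \<times> {..<d}})"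
  proof (rule sum_words_near_constant[where g = "\<lambda>x. x"])
    have "real (?k * d) \<le> n" using u(2) d by (simp add: field_simps)
    then have "?k * d \<le> n" by (simp only: of_nat_le_iff)
    then show "card {x \<in> S. x \<in> {..<n} \<times> {..<d}} \<le> card {..<n}" unfolding SX cS by simp
  qed (use d in \<open>auto simp: S_def X\<close>)
  also have "\<dots> = real CARD('a) ^ n * sqrt (4 * exp 1 * d * ?k / n) ^ (d * ?k)"
    unfolding SX cS by (simp add: real_sqrt_power mult_ac)
  finally show ?thesis .
qed

text \<open>Exchanging the images of two points with letters c and c' of u multiplies the phase by
  \<open>\<omega>\<close> of (c - c') times a difference of letters of v. This is nontrivial as soon
  as the images carry two popular letters e and e' of v, an event whose probability is bounded
  below.\<close>

lemma directed_corr_far: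
  fixes \<delta> :: real
  assumes \<delta>: "0 < \<delta>" and d: "1 \<le> d"
  shows "\<exists>c>0::real. \<forall>\<^sub>F n in sequentially. \<forall>u\<in>words n. \<forall>v\<in>words n.
    (\<forall>a. \<delta> * real n < real (deviation n a u)) \<longrightarrow> (\<forall>a. \<delta> * real n < real (deviation n a v)) \<longrightarrow>
    norm (corr (perms (points n d)) n d u v) \<le> exp (- c * real n)"
proof -
  obtain \<rho> where \<rho>: "0 \<le> \<rho>" "\<rho> < 1" and half: "\<And>x. x \<noteq> 0 \<Longrightarrow> norm ((1 + \<omega> x) / 2) \<le> \<rho>"
    using ex_half_angle_bound by blast
  define \<delta>' where "\<delta>' = min \<delta> 1"
  define \<gamma> where "\<gamma> = \<delta>' / CARD('a)"
  define c0 where "c0 = (1 - \<rho>) * \<gamma> ^ 2"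
  have \<delta>': "0 < \<delta>'" "\<delta>' \<le> 1" "\<delta>' \<le> \<delta>" using \<delta> by (auto simp: \<delta>'_def)
  have \<gamma>: "0 < \<gamma>" "\<gamma> \<le> 1" using \<delta>' by (auto simp: \<gamma>_def divide_le_eq_1 Suc_le_eq intro: order_trans[of _ 1])
  have c0: "0 < c0" using \<gamma> \<rho> by (simp add: c0_def)
  have c0\<gamma>: "c0 \<le> \<gamma>"
  proof -
    have "c0 \<le> 1 * \<gamma> ^ 2" unfolding c0_def using \<rho> by (intro mult_right_mono) auto
    also have "\<dots> \<le> \<gamma>" using \<gamma> by (simp add: power2_eq_square mult_left_le_one_le)
    finally show ?thesis .
  qed
  have main: "norm (corr (perms (points n d)) n d u v) \<le> exp (- c0 * Q / 2)"
    if n: "0 < n" and u: "\<And>a. \<delta> * real n < real (deviation n a u)" and v: "\<And>a. \<delta> * real n < real (deviation n a v)"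
      and Q: "real Q \<le> c0 * real (n * d) / 64" for n u v and Q :: nat
  proof -
    let ?X = "points n d"
    have fX: "finite ?X" by (rule finite_points)
    have \<delta>n: "\<delta>' * n \<le> \<delta> * n" using \<delta>' by (simp add: mult_right_mono)
    have dev_u: "\<delta>' * n < deviation n a u" for a using u[of a] \<delta>n by linarith
    have dev_v: "\<delta>' * n < deviation n a v" for a using v[of a] \<delta>n by linarith
    obtain c c' where c: "c \<noteq> c'" "\<gamma> * n \<le> card {l. l < n \<and> u l = c}" "\<gamma> * n \<le> card {l. l < n \<and> u l = c'}"
      unfolding \<gamma>_def by (rule popular_values[where f = "\<lambda>x. x" and w = u, OF \<delta>'(1,2) n dev_u])
    obtain e e' where e: "e \<noteq> e'" "\<gamma> * n \<le> card {l. l < n \<and> v l = e}" "\<gamma> * n \<le> card {l. l < n \<and> v l = e'}"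
      unfolding \<gamma>_def by (rule popular_values[where f = "\<lambda>x. x" and w = v, OF \<delta>'(1,2) n dev_v])
    have big: "\<gamma> * card ?X \<le> card {x \<in> ?X. w (fst x) = b}" if "\<gamma> * n \<le> card {l. l < n \<and> w l = b}" for w :: "nat \<Rightarrow> 'a" and b
      using mult_right_mono[OF that, of d] card_points_fst[of n d "\<lambda>l. w l = b"] by (simp add: card_points mult.assoc)
    have QX: "real Q \<le> \<gamma> * card ?X"
    proof -
      have "real Q \<le> c0 * real (n * d)" using Q c0 by (simp add: field_simps)
      also have "\<dots> \<le> \<gamma> * card ?X" unfolding card_points by (intro mult_right_mono c0\<gamma>) simp
      finally show ?thesis .
    qed
    have "Q \<le> card {x \<in> ?X. u (fst x) = c}" using QX big[OF c(2)] by linarith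
    then obtain a where a: "inj_on a {..<Q}" "a ` {..<Q} \<subseteq> {x \<in> ?X. u (fst x) = c}" by (rule obtain_injection)
    have "Q \<le> card {x \<in> ?X. u (fst x) = c'}" using QX big[OF c(3)] by linarith
    then obtain a' where a': "inj_on a' {..<Q}" "a' ` {..<Q} \<subseteq> {x \<in> ?X. u (fst x) = c'}" by (rule obtain_injection)
    have aX: "a q \<in> ?X" "u (fst (a q)) = c" "a' q \<in> ?X" "u (fst (a' q)) = c'" if "q < Q" for q
      using a a' that by auto
    have aa': "a q \<noteq> a' r" if "q < Q" "r < Q" for q r using aX(2)[OF that(1)] aX(4)[OF that(2)] c(1) by metis
    have neq: "a q \<noteq> a r" "a' q \<noteq> a' r" if "q < Q" "r < Q" "q \<noteq> r" for q r
      using a(1) a'(1) that by (auto simp: inj_on_def)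
    define z where "z q \<sigma> = \<omega> ((c - c') * (v (fst (\<sigma> (a' q))) - v (fst (\<sigma> (a q)))))" for q :: nat and \<sigma> :: "nat \<times> nat \<Rightarrow> nat \<times> nat"
    show ?thesis
      unfolding corr_def
    \<comment> \<open>The block of a swap consists of its two points; the targets ask for the letter
      e of v at points with letter c, and for e' at the others.\<close>
    proof (rule norm_avg_swap_le[where X = ?X and t = "\<lambda>q. Transposition.transpose (a q) (a' q)" and z = z and r = 2 and \<gamma> = \<gamma> and \<rho> = \<rho>
          and B = "\<lambda>q. {a q, a' q}" and T = "\<lambda>b. {x \<in> ?X. v (fst x) = (if u (fst b) = c then e else e')}"])
      show "Transposition.transpose (a q) (a' q) permutes ?X" if "q < Q" for q
        using aX[OF that] by (intro permutes_swap_id)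
      show "phase n d u v (\<sigma> \<circ> Transposition.transpose (a q) (a' q)) = phase n d u v \<sigma> * z q \<sigma>" if q: "q < Q" for q \<sigma>
      proof -
        let ?R = "\<Prod>x\<in>?X - {a q, a' q}. \<omega> (u (fst x) * v (fst (\<sigma> x)))"
        have "phase n d u v (\<sigma> \<circ> Transposition.transpose (a q) (a' q)) = \<omega> (c * v (fst (\<sigma> (a' q)))) * \<omega> (c' * v (fst (\<sigma> (a q)))) *
            (\<Prod>x\<in>?X - {a q, a' q}. \<omega> (u (fst x) * v (fst ((\<sigma> \<circ> Transposition.transpose (a q) (a' q)) x))))"
          unfolding phase_def using aX[OF q] aa'[OF q q] by (subst prod_remove2[OF fX, of "a q" "a' q"]) auto
        also have "(\<Prod>x\<in>?X - {a q, a' q}. \<omega> (u (fst x) * v (fst ((\<sigma> \<circ> Transposition.transpose (a q) (a' q)) x)))) = ?R"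
          by (intro prod.cong) (auto simp: transpose_def)
        also have "\<omega> (c * v (fst (\<sigma> (a' q)))) * \<omega> (c' * v (fst (\<sigma> (a q)))) =
            \<omega> (c * v (fst (\<sigma> (a q)))) * \<omega> (c' * v (fst (\<sigma> (a' q)))) * z q \<sigma>"
          unfolding z_def chi_add[symmetric] by (simp add: algebra_simps)
        also have "\<dots> * ?R = phase n d u v \<sigma> * z q \<sigma>"
          unfolding phase_def using aX[OF q] aa'[OF q q] by (subst prod_remove2[OF fX, of "a q" "a' q"]) auto
        finally show ?thesis .
      qed
      show "z r (\<sigma> \<circ> Transposition.transpose (a q) (a' q)) = z r \<sigma>" if "q < Q" "r < q" for q r \<sigma>
      proof -
        have "r < Q" using that by simp
        then have "Transposition.transpose (a q) (a' q) (a r) = a r" "Transposition.transpose (a q) (a' q) (a' r) = a' r"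
          using that aa'[of r q] aa'[of q r] neq[of r q] by (auto simp: transpose_def)
        then show ?thesis by (simp add: z_def)
      qed
      show "norm ((1 + z q \<sigma>) / 2) \<le> \<rho>" if "q < Q"
        "\<forall>b\<in>{a q, a' q}. \<sigma> b \<in> {x \<in> ?X. v (fst x) = (if u (fst b) = c then e else e')}" for q \<sigma>
        unfolding z_def using that aX[OF that(1)] c(1) e(1) by (intro half) auto
      show "disjoint_family_on (\<lambda>q. {a q, a' q}) {..<Q}"
        unfolding disjoint_family_on_def using aa' neq by auto
      show "card {a q, a' q} = 2" if "q < Q" for q using aa'[OF that that] by simp
      show "\<gamma> * card ?X \<le> card {x \<in> ?X. v (fst x) = (if u (fst b) = c then e else e')}" for b
        using big[OF e(2)] big[OF e(3)] by simp
      show "0 < card ?X" using n d by (simp add: card_points)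
      show "real Q \<le> c0 * card ?X / 64" using Q by (simp add: card_points)
    qed (use \<gamma> \<rho> aX fX in \<open>auto simp: c0_def z_def norm_chi norm_phase\<close>)
  qed
  have "\<forall>\<^sub>F n in sequentially. 128 / c0 \<le> real n \<and> 0 < n"
    by (intro eventually_conj eventually_gt_at_top filterlim_real_sequentially[unfolded filterlim_at_top, rule_format])
  then have ev: "\<forall>\<^sub>F n in sequentially. \<forall>u\<in>words n. \<forall>v\<in>words n.
    (\<forall>a. \<delta> * real n < real (deviation n a u)) \<longrightarrow> (\<forall>a. \<delta> * real n < real (deviation n a v)) \<longrightarrow>
    norm (corr (perms (points n d)) n d u v) \<le> exp (- (c0\<^sup>2 / 256) * real n)"
  proof (eventually_elim, intro ballI impI)
    fix n and u v :: "nat \<Rightarrow> 'a"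
    assume n: "128 / c0 \<le> real n \<and> 0 < n" and uv: "\<forall>a. \<delta> * real n < real (deviation n a u)" "\<forall>a. \<delta> * real n < real (deviation n a v)"
    have nd: "real n \<le> real (n * d)" using d by (simp add: mult_le_cancel_left1)
    have N: "128 / c0 \<le> real (n * d)" using n nd by linarith
    have "norm (corr (perms (points n d)) n d u v) \<le> exp (- (c0\<^sup>2 / 256) * real (n * d))"
      by (rule exp_floor_le[OF c0 N]) (use n uv main in blast)
    also have "\<dots> \<le> exp (- (c0\<^sup>2 / 256) * real n)"
      using nd by (simp add: mult_left_mono)
    finally show "norm (corr (perms (points n d)) n d u v) \<le> exp (- (c0\<^sup>2 / 256) * real n)" .
  qed
  show ?thesis by (rule exI[of _ "c0\<^sup>2 / 256"]) (use ev c0 in simp)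
qed

lemma sum_type_weight_pairs:
  "(\<Sum>u\<in>words n. \<Sum>v\<in>words n. type_weight {..<n} (u :: nat \<Rightarrow> 'a) * type_weight {..<n} (v :: nat \<Rightarrow> 'a)) \<le>
    (real n + 1) ^ (2 * CARD('a))"
proof -
  have "(\<Sum>u\<in>words n. type_weight {..<n} (u :: nat \<Rightarrow> 'a)) \<le> (real n + 1) ^ CARD('a)"
    using sum_type_weight_le[of "{..<n}", where 'c = 'a] by simp
  then have "(\<Sum>u\<in>words n. type_weight {..<n} (u :: nat \<Rightarrow> 'a)) * (\<Sum>u\<in>words n. type_weight {..<n} (u :: nat \<Rightarrow> 'a))
      \<le> (real n + 1) ^ CARD('a) * (real n + 1) ^ CARD('a)"
    by (intro mult_mono) (simp_all add: sum_nonneg less_imp_le[OF type_weight_pos])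
  then show ?thesis by (simp add: sum_product power_add[symmetric] mult_2)
qed

theorem directed_corr_sum_tendsto_0:
  assumes d: "3 \<le> d"
  shows "(\<lambda>n. (\<Sum>u\<in>nonconst_words n. \<Sum>v\<in>nonconst_words n. norm (corr (perms (points n d)) n d u v)) /
    real CARD('a) ^ n) \<longlonglongrightarrow> 0"
proof (rule nonconst_sum_tendsto_0[OF d, where B = "4 * exp 1 * d" and \<eta> = "1 / d" and b = 0 and a = "2 * CARD('a)"
    and s = "\<lambda>n u v. type_weight {..<n} u * type_weight {..<n} v"])
  have comm: "corr (perms (points n d)) n d u v = corr (perms (points n d)) n d v u" for n u v
    by (rule corr_commute) (auto intro: permutes_inv)
  fix n :: nat and c :: 'a
  show left: "(\<Sum>v\<in>words n. norm (corr (perms (points n d)) n d u v)) \<le>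
     real CARD('a) ^ n * sqrt (4 * exp 1 * d * deviation n c u / n) ^ (d * deviation n c u)"
    if "1 \<le> deviation n c u" "deviation n c u \<le> (1 / d) * n" for u
    using directed_corr_near[OF that] d by simp
  show "(\<Sum>u\<in>words n. norm (corr (perms (points n d)) n d u v)) \<le>
     real CARD('a) ^ n * sqrt (4 * exp 1 * d * deviation n c v / n) ^ (d * deviation n c v)"
    if "1 \<le> deviation n c v" "deviation n c v \<le> (1 / d) * n" for v
    using left[OF that] by (simp only: comm[of n v])
next
  fix n and u v :: "nat \<Rightarrow> 'a"
  show "norm (corr (perms (points n d)) n d u v) \<le>
    (real d * real n + 1) ^ 0 * sqrt (real CARD('a) ^ n * (type_weight {..<n} u * type_weight {..<n} v)) ^ d"
    using directed_corr_uncertainty by simp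
  show "(\<Sum>u\<in>words n. \<Sum>v\<in>words n. type_weight {..<n} (u :: nat \<Rightarrow> 'a) * type_weight {..<n} (v :: nat \<Rightarrow> 'a)) \<le>
    (real n + 1) ^ (2 * CARD('a))" by (rule sum_type_weight_pairs)
  show "0 \<le> type_weight {..<n} u * type_weight {..<n} v" by (simp add: less_imp_le[OF type_weight_pos])
next
  fix \<delta> :: real assume "0 < \<delta>"
  then show "\<exists>c>0::real. \<forall>\<^sub>F n in sequentially. \<forall>u\<in>words n. \<forall>v\<in>words n.
    (\<forall>a. \<delta> * real n < real (deviation n a u)) \<longrightarrow> (\<forall>a. \<delta> * real n < real (deviation n a v)) \<longrightarrow>
    norm (corr (perms (points n d)) n d u v) \<le> exp (- c * real n)"
    by (rule directed_corr_far) (use d in simp)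
qed (use d in simp_all)

end

section \<open>Random matchings\<close>

text \<open>Perfect pairings as fixed-point-free involutions, so that \<open>phase\<close> and
  \<open>directed_adj\<close> apply to them unchanged.\<close>

definition matchings :: "'x set \<Rightarrow> ('x \<Rightarrow> 'x) set" where
  "matchings X = {P. P permutes X \<and> (\<forall>x\<in>X. P x \<noteq> x) \<and> (\<forall>x. P (P x) = x)}"

lemma matchingsD:
  assumes "P \<in> matchings X"
  shows "P permutes X" "x \<in> X \<Longrightarrow> P x \<noteq> x" "P (P x) = x" "P x \<in> X \<longleftrightarrow> x \<in> X" "P x = P y \<longleftrightarrow> x = y"
proof -
  show P: "P permutes X" "x \<in> X \<Longrightarrow> P x \<noteq> x" "P (P x) = x"
    using assms by (auto simp: matchings_def)
  show "P x \<in> X \<longleftrightarrow> x \<in> X" by (rule permutes_in_image[OF P(1)])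
  show "P x = P y \<longleftrightarrow> x = y" using permutes_inj[OF P(1)] by (auto simp: inj_def)
qed

lemma finite_matchings: "finite X \<Longrightarrow> finite (matchings X)"
  by (rule finite_subset[OF _ finite_permutations[of X]]) (auto simp: matchings_def)

lemma conj_matchings:
  assumes "\<sigma> permutes X" "P \<in> matchings X"
  shows "\<sigma> \<circ> P \<circ> iperm \<sigma> \<in> matchings X"
  unfolding matchings_def
proof (intro CollectI conjI ballI allI)
  let ?i = "iperm \<sigma>"
  note P = matchingsD[OF assms(2)] and s = permutes_inverses[OF assms(1)]
  show "\<sigma> \<circ> P \<circ> ?i permutes X"
    by (intro permutes_compose permutes_inv assms P(1))
  fix x
  show "(\<sigma> \<circ> P \<circ> ?i) ((\<sigma> \<circ> P \<circ> ?i) x) = x" by (simp add: P s)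
  show "(\<sigma> \<circ> P \<circ> ?i) x \<noteq> x" if "x \<in> X"
  proof
    assume "(\<sigma> \<circ> P \<circ> ?i) x = x"
    then have "P (?i x) = ?i x" by (metis comp_apply s(2))
    moreover have "?i x \<in> X" using that permutes_in_image[OF permutes_inv[OF assms(1)]] by simp
    ultimately show False using P(2) by blast
  qed
qed

text \<open>Conjugation by \<sigma> permutes the matchings. With \<open>Y = X\<close> all points are
  relabelled; a smaller Y can keep the support of u in place.\<close>

lemma avg_matchings_conj:
  assumes X: "finite X" and Y: "Y \<subseteq> X"
  shows "avg (matchings X) f =
    avg (matchings X) (\<lambda>P. avg (perms Y) (\<lambda>\<sigma>. f (\<sigma> \<circ> P \<circ> iperm \<sigma>)))"
proof (rule avg_invariant)
  show "finite (perms Y)" using X Y finite_subset by (intro finite_perms) blast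
  fix \<sigma> assume "\<sigma> \<in> (perms Y)"
  then have s: "\<sigma> permutes X" using Y permutes_subset by blast
  let ?i = "iperm \<sigma>"
  have i: "iperm ?i = \<sigma>" by (rule permutes_inv_inv[OF s])
  have "bij_betw (\<lambda>P. \<sigma> \<circ> P \<circ> ?i) (matchings X) (matchings X)"
  proof (rule bij_betwI[where g = "\<lambda>P. ?i \<circ> P \<circ> \<sigma>"])
    show "(\<lambda>P. \<sigma> \<circ> P \<circ> ?i) \<in> matchings X \<rightarrow> matchings X" using conj_matchings[OF s] by blast
    show "(\<lambda>P. ?i \<circ> P \<circ> \<sigma>) \<in> matchings X \<rightarrow> matchings X"
      using conj_matchings[OF permutes_inv[OF s]] unfolding i by blast
  qed (auto simp: fun_eq_iff permutes_inverses[OF s])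
  then show "avg (matchings X) (\<lambda>P. f (\<sigma> \<circ> P \<circ> ?i)) = avg (matchings X) f" by (rule avg_reindex)
qed (rule perms_nonempty)

text \<open>An injective numbering selects the smaller endpoint of each pair. The matching thus
  becomes a bijection between two halves, to which permutation estimates apply.\<close>

lemma half_of_matching:
  assumes X: "finite X" and P: "P \<in> matchings X"
  obtains H where "H \<subseteq> X" "H \<inter> P ` H = {}" "X = H \<union> P ` H" "card X = 2 * card H"
proof -
  obtain f :: "'a \<Rightarrow> nat" where f: "inj_on f X" using finite_imp_inj_to_nat_seg[OF X] by blast
  define H where "H = {x \<in> X. f x < f (P x)}"
  note D = matchingsD[OF P]
  have ne: "f (P x) \<noteq> f x" if "x \<in> X" for x
    using f that D(2)[OF that] D(4)[of x] by (auto simp: inj_on_def)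
  have sub: "H \<subseteq> X" by (auto simp: H_def)
  have disj: "H \<inter> P ` H = {}" by (auto simp: H_def D)
  have un: "X = H \<union> P ` H"
  proof (intro equalityI subsetI)
    fix x assume x: "x \<in> X"
    show "x \<in> H \<union> P ` H"
    proof (cases "f x < f (P x)")
      case False
      then have "P x \<in> H" using x ne[OF x] D by (simp add: H_def)
      then have "P (P x) \<in> P ` H" by blast
      then show ?thesis by (simp add: D)
    qed (use x in \<open>simp add: H_def\<close>)
  qed (use sub in \<open>auto simp: D\<close>)
  have fH: "finite H" using X by (simp add: H_def)
  have "card (P ` H) = card H" by (rule card_image) (simp add: inj_on_def D)
  then have "card (H \<union> P ` H) = 2 * card H" using card_Un_disjoint[OF fH _ disj] fH by simp
  with un have "card X = 2 * card H" by (simp only:)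
  with sub disj un show ?thesis by (rule that)
qed

lemma prod_matching:
  assumes X: "finite X" and P: "P \<in> matchings X" and H: "H \<inter> P ` H = {}" "X = H \<union> P ` H"
  shows "(\<Prod>x\<in>X. f x) = (\<Prod>y\<in>H. f y * f (P y))"
proof -
  have fin: "finite H" "finite (P ` H)" using X H(2) by auto
  have "(\<Prod>x\<in>X. f x) = (\<Prod>x\<in>H. f x) * (\<Prod>x\<in>P ` H. f x)"
    unfolding H(2) by (rule prod.union_disjoint[OF fin H(1)])
  also have "(\<Prod>x\<in>P ` H. f x) = (\<Prod>y\<in>H. f (P y))"
    by (rule prod.reindex_cong[OF _ refl refl]) (simp add: inj_on_def matchingsD(5)[OF P])
  finally show ?thesis by (simp add: prod.distrib)
qed

text \<open>A word on X amounts to two independent words on H, read at y and at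
  \<open>P y\<close>.\<close>

lemma sum_words_matching:
  assumes X: "finite X" and P: "P \<in> matchings X" and H: "H \<inter> P ` H = {}" "X = H \<union> P ` H"
  shows "(\<Sum>\<gamma>\<in>X \<rightarrow>\<^sub>E T. F (restrict \<gamma> H) (restrict (\<gamma> \<circ> P) H)) =
    (\<Sum>\<alpha>\<in>H \<rightarrow>\<^sub>E T. \<Sum>\<beta>\<in>H \<rightarrow>\<^sub>E T. F \<alpha> \<beta>)"
  unfolding sum.cartesian_product
proof (rule sum.reindex_bij_witness[where i = "\<lambda>z x. if x \<in> H then fst z x else if x \<in> X then snd z (P x) else undefined"
      and j = "\<lambda>\<gamma>. (restrict \<gamma> H, restrict (\<gamma> \<circ> P) H)"])
  note D = matchingsD[OF P]
  have HP: "P x \<in> H \<longleftrightarrow> x \<in> X \<and> x \<notin> H" for x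
  proof
    assume "P x \<in> H"
    then have "P (P x) \<in> P ` H" by blast
    then show "x \<in> X \<and> x \<notin> H" using H by (auto simp: D)
  next
    assume "x \<in> X \<and> x \<notin> H"
    then obtain y where "y \<in> H" "x = P y" using H(2) by auto
    then show "P x \<in> H" by (simp add: D)
  qed
  have HX: "x \<in> X" if "x \<in> H" for x using that H(2) by blast
  {
    fix \<gamma> assume g: "\<gamma> \<in> X \<rightarrow>\<^sub>E T"
    show "(\<lambda>x. if x \<in> H then fst (restrict \<gamma> H, restrict (\<gamma> \<circ> P) H) x
        else if x \<in> X then snd (restrict \<gamma> H, restrict (\<gamma> \<circ> P) H) (P x) else undefined) = \<gamma>"
      using PiE_arb[OF g] by (auto simp: fun_eq_iff HP D)
    show "(restrict \<gamma> H, restrict (\<gamma> \<circ> P) H) \<in> (H \<rightarrow>\<^sub>E T) \<times> (H \<rightarrow>\<^sub>E T)"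
      using g HX by (auto simp: D intro!: PiE_mem[OF g])
  next
    fix z assume "z \<in> (H \<rightarrow>\<^sub>E T) \<times> (H \<rightarrow>\<^sub>E T)"
    then have z: "fst z \<in> H \<rightarrow>\<^sub>E T" "snd z \<in> H \<rightarrow>\<^sub>E T" by auto
    let ?y = "\<lambda>x. if x \<in> H then fst z x else if x \<in> X then snd z (P x) else undefined"
    have "restrict ?y H = fst z" using PiE_arb[OF z(1)] by (auto simp: fun_eq_iff)
    moreover have "restrict (?y \<circ> P) H = snd z" using PiE_arb[OF z(2)] HX by (auto simp: fun_eq_iff HP D)
    ultimately show "(restrict ?y H, restrict (?y \<circ> P) H) = z" by (simp add: prod_eq_iff)
    show "?y \<in> X \<rightarrow>\<^sub>E T"
    proof (rule PiE_I)
      fix x assume "x \<in> X"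
      then show "?y x \<in> T" using PiE_mem[OF z(1), of x] PiE_mem[OF z(2), of "P x"] by (auto simp: HP)
    qed (use HX in auto)
  }
qed auto

lemma type_weight_indicator_le:
  assumes X: "finite X" and S: "S \<subseteq> X" "S \<noteq> {}"
  shows "type_weight X (\<lambda>x. x \<in> S) \<le> (card S / card X) ^ card S"
proof -
  let ?s = "card S" and ?N = "card X"
  have fS: "finite S" using X S finite_subset by blast
  have sN: "?s \<le> ?N" using card_mono[OF X S(1)] .
  have s: "0 < ?s" using fS S by (simp add: card_gt_0_iff)
  have N: "0 < ?N" using s sN by linarith
  have "{x \<in> X. (x \<in> S) = True} = S" "{x \<in> X. (x \<in> S) = False} = X - S" using S by auto
  then have "type_weight X (\<lambda>x. x \<in> S) = fact ?s * fact (?N - ?s) / fact ?N"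
    unfolding type_weight_def UNIV_bool using S fS by (simp add: card_Diff_subset mult.commute)
  also have "\<dots> = 1 / (?N choose ?s)" using sN by (simp add: binomial_fact)
  also have "\<dots> \<le> 1 / (real ?N / ?s) ^ ?s"
    using binomial_ge_n_over_k_pow_k[OF sN, where 'a = real] s N zero_less_binomial[OF sN]
    by (intro divide_left_mono mult_pos_pos) auto
  also have "\<dots> = (real ?s / ?N) ^ ?s" by (simp add: power_divide)
  finally show ?thesis .
qed

text \<open>Relabelling makes S a random set of fixed size, which is compared with independent
  points of density \<open>\<xi>\<close>: the type weight is at most \<open>\<xi> ^ card S\<close>,
  which cancels the normalization of F, and the sum over all words factors over the pairs. This
  exponential moment is meant for points of a support that are matched to one another.\<close>

lemma avg_internal_pairs_le:
  fixes y :: real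
  assumes X: "finite X" and S: "S \<subseteq> X" "S \<noteq> {}" and y: "0 \<le> y" "y\<^sup>2 * card S \<le> 2 * card X"
  shows "avg (matchings X) (\<lambda>P. y ^ card {x \<in> S. P x \<in> S}) \<le> exp (2 * card S)"
proof -
  let ?s = "card S" and ?N = "card X" and ?P = "perms X"
  define \<xi> where "\<xi> = real ?s / ?N"
  have fS: "finite S" using X S finite_subset by blast
  have s: "0 < ?s" using fS S by (simp add: card_gt_0_iff)
  have N: "0 < ?N" using s card_mono[OF X S(1)] by linarith
  have \<xi>: "0 < \<xi>" using s N by (simp add: \<xi>_def)
  have "avg ?P (\<lambda>\<sigma>. y ^ card {x \<in> S. (\<sigma> \<circ> P \<circ> iperm \<sigma>) x \<in> S}) \<le> exp (2 * ?s)" if P: "P \<in> matchings X" for P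
  proof -
    obtain H where H: "H \<subseteq> X" "H \<inter> P ` H = {}" "X = H \<union> P ` H" "?N = 2 * card H"
      by (rule half_of_matching[OF X P])
    note D = matchingsD[OF P]
    have fH: "finite H" using X H(1) finite_subset by blast
    \<comment> \<open>A pair with both ends in S is counted at each end, hence
      \<open>y\<^sup>2\<close>.\<close>
    define \<phi> :: "bool \<Rightarrow> bool \<Rightarrow> real" where
      "\<phi> a b = (if a then \<xi> else 1) * (if b then \<xi> else 1) * (if a \<and> b then y\<^sup>2 else 1)" for a b
    have \<phi>0: "0 \<le> \<phi> a b" for a b using \<xi> by (simp add: \<phi>_def)
    define F where "F \<gamma> = (\<Prod>h\<in>H. \<phi> (\<gamma> h) (\<gamma> (P h))) / \<xi> ^ ?s" for \<gamma>
    have F0: "0 \<le> F \<gamma>" for \<gamma> using \<phi>0 \<xi> by (simp add: F_def prod_nonneg)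
    have "avg ?P (\<lambda>\<sigma>. y ^ card {x \<in> S. (\<sigma> \<circ> P \<circ> iperm \<sigma>) x \<in> S}) =
        avg ?P (\<lambda>\<sigma>. F (restrict ((\<lambda>x. x \<in> S) \<circ> \<sigma>) X))"
    proof (rule avg_cong)
      fix \<sigma> assume "\<sigma> \<in> ?P"
      then have s: "\<sigma> permutes X" by simp
      let ?b = "\<lambda>x. \<sigma> x \<in> S"
      have "bij_betw \<sigma> {x \<in> X. ?b x \<and> ?b (P x)} {x \<in> S. (\<sigma> \<circ> P \<circ> iperm \<sigma>) x \<in> S}"
        by (rule bij_betwI[where g = "iperm \<sigma>"])
          (use S permutes_in_image[OF permutes_inv[OF s]] in \<open>auto simp: permutes_inverses[OF s]\<close>)
      then have t: "card {x \<in> S. (\<sigma> \<circ> P \<circ> iperm \<sigma>) x \<in> S} = card {x \<in> X. ?b x \<and> ?b (P x)}"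
        by (simp add: bij_betw_same_card)
      have "bij_betw \<sigma> {x \<in> X. ?b x} S"
        by (rule bij_betwI[where g = "iperm \<sigma>"])
          (use S permutes_in_image[OF permutes_inv[OF s]] in \<open>auto simp: permutes_inverses[OF s]\<close>)
      then have c: "card {x \<in> X. ?b x} = ?s" by (rule bij_betw_same_card)
      have "\<xi> ^ ?s * y ^ card {x \<in> X. ?b x \<and> ?b (P x)} =
          (\<Prod>x\<in>X. (if ?b x then \<xi> else 1) * (if ?b x \<and> ?b (P x) then y else 1))"
        using X by (simp add: prod.distrib prod.If_cases c Int_def conj_commute)
      also have "\<dots> = (\<Prod>h\<in>H. \<phi> (?b h) (?b (P h)))"
        unfolding prod_matching[OF X P H(2,3)]
        by (intro prod.cong) (auto simp: \<phi>_def D power2_eq_square)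
      also have "\<dots> = (\<Prod>h\<in>H. \<phi> (restrict ((\<lambda>x. x \<in> S) \<circ> \<sigma>) X h) (restrict ((\<lambda>x. x \<in> S) \<circ> \<sigma>) X (P h)))"
        using H(1) by (intro prod.cong) (auto simp: D subset_iff)
      finally show "y ^ card {x \<in> S. (\<sigma> \<circ> P \<circ> iperm \<sigma>) x \<in> S} = F (restrict ((\<lambda>x. x \<in> S) \<circ> \<sigma>) X)"
        unfolding F_def t using \<xi> by (simp add: field_simps)
    qed
    also have "\<dots> \<le> type_weight X (\<lambda>x. x \<in> S) * (\<Sum>\<gamma>\<in>X \<rightarrow>\<^sub>E UNIV. F \<gamma>)"
      by (rule avg_word_le[OF X F0])
    also have "(\<Sum>\<gamma>\<in>X \<rightarrow>\<^sub>E UNIV. F \<gamma>) = (1 + 2 * \<xi> + y\<^sup>2 * \<xi>\<^sup>2) ^ card H / \<xi> ^ ?s"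
    proof -
      have "(\<Sum>\<gamma>\<in>X \<rightarrow>\<^sub>E UNIV. F \<gamma>) = (\<Sum>\<gamma>\<in>X \<rightarrow>\<^sub>E UNIV. (\<Prod>h\<in>H. \<phi> (restrict \<gamma> H h) (restrict (\<gamma> \<circ> P) H h))) / \<xi> ^ ?s"
        by (simp add: F_def sum_divide_distrib)
      also have "(\<Sum>\<gamma>\<in>X \<rightarrow>\<^sub>E UNIV. (\<Prod>h\<in>H. \<phi> (restrict \<gamma> H h) (restrict (\<gamma> \<circ> P) H h))) =
          (\<Sum>\<alpha>\<in>H \<rightarrow>\<^sub>E UNIV. \<Sum>\<beta>\<in>H \<rightarrow>\<^sub>E UNIV. \<Prod>h\<in>H. \<phi> (\<alpha> h) (\<beta> h))"
        by (rule sum_words_matching[OF X P H(2,3), where F = "\<lambda>\<alpha> \<beta>. \<Prod>h\<in>H. \<phi> (\<alpha> h) (\<beta> h)"])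
      also have "\<dots> = (\<Sum>\<alpha>\<in>H \<rightarrow>\<^sub>E UNIV. \<Prod>h\<in>H. \<Sum>b\<in>UNIV. \<phi> (\<alpha> h) b)"
        using fH by (intro sum.cong refl prod_sum_PiE[symmetric]) auto
      also have "\<dots> = (\<Prod>h\<in>H. \<Sum>a\<in>UNIV. \<Sum>b\<in>UNIV. \<phi> a b)"
        using fH by (intro prod_sum_PiE[symmetric]) auto
      also have "\<dots> = (1 + 2 * \<xi> + y\<^sup>2 * \<xi>\<^sup>2) ^ card H"
        by (simp add: UNIV_bool \<phi>_def power2_eq_square algebra_simps)
      finally show ?thesis .
    qed
    also have "type_weight X (\<lambda>x. x \<in> S) * ((1 + 2 * \<xi> + y\<^sup>2 * \<xi>\<^sup>2) ^ card H / \<xi> ^ ?s) \<le>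
        \<xi> ^ ?s * ((1 + 2 * \<xi> + y\<^sup>2 * \<xi>\<^sup>2) ^ card H / \<xi> ^ ?s)"
      using type_weight_indicator_le[OF X S] \<xi> unfolding \<xi>_def[symmetric] by (intro mult_right_mono) auto
    also have "\<dots> = (1 + (2 * \<xi> + y\<^sup>2 * \<xi>\<^sup>2)) ^ card H" using \<xi> by (simp add: add.assoc)
    also have "\<dots> \<le> exp (2 * \<xi> + y\<^sup>2 * \<xi>\<^sup>2) ^ card H"
      using \<xi> by (intro power_mono exp_ge_add_one_self) auto
    also have "\<dots> = exp (card H * (2 * \<xi> + y\<^sup>2 * \<xi>\<^sup>2))" by (rule exp_of_nat_mult[symmetric])
    also have "\<dots> \<le> exp (2 * ?s)"
    proof -
      have h: "real (card H) = ?N / 2" using H(4) by simp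
      have "card H * (2 * \<xi> + y\<^sup>2 * \<xi>\<^sup>2) = ?s + (y\<^sup>2 * ?s) / (2 * ?N) * ?s"
        unfolding h \<xi>_def using N by (simp add: field_simps power2_eq_square)
      also have "\<dots> \<le> real ?s + 1 * real ?s"
        using y(2) N by (intro add_left_mono mult_right_mono) (auto simp: field_simps)
      finally show ?thesis by simp
    qed
    finally show ?thesis .
  qed
  then have le: "avg (matchings X) (\<lambda>P. avg ?P (\<lambda>\<sigma>. y ^ card {x \<in> S. (\<sigma> \<circ> P \<circ> iperm \<sigma>) x \<in> S})) \<le>
      avg (matchings X) (\<lambda>_. exp (2 * ?s))" by (intro avg_mono) auto
  \<comment> \<open>Without matchings the average is 0, by division by zero.\<close>
  have "avg (matchings X) (\<lambda>_. exp (2 * real ?s)) \<le> exp (2 * ?s)"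
    by (cases "matchings X = {}") (simp_all add: avg_const finite_matchings[OF X], simp add: avg_def)
  with le show ?thesis
    using avg_matchings_conj[OF X order_refl, of "\<lambda>P. y ^ card {x \<in> S. P x \<in> S}"] by simp
qed

section \<open>The undirected model\<close>

lemma inv_matching: "P \<in> matchings X \<Longrightarrow> iperm P = P"
  by (rule inv_equality) (simp_all add: matchingsD)

lemma sqrt_square_mult_power: "sqrt (((real h + 1) ^ m)\<^sup>2 * x ^ d) = (real h + 1) ^ m * sqrt x ^ d"
  by (simp only: real_sqrt_mult real_sqrt_abs real_sqrt_power[of x]) simp

context additive_character
begin

text \<open>The contribution of one edge whose endpoints carry the letters r and t of the joint word
  of u and v: both orientations occur in u^T A v. The exponent is a nondegenerate symmetric form,
  whence \<open>orth_pairing\<close>.\<close>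

definition pairing :: "'a \<times> 'a \<Rightarrow> 'a \<times> 'a \<Rightarrow> complex" where
  "pairing r t = \<omega> (fst r * snd t + fst t * snd r)"

lemma norm_pairing: "norm (pairing r t) = 1"
  by (simp add: pairing_def norm_chi)

lemma orth_pairing: "(\<Sum>a\<in>UNIV. pairing a b * cnj (pairing a b')) = (if b = b' then of_nat CARD('a \<times> 'a) else 0)"
proof -
  have "(\<Sum>a\<in>UNIV. pairing a b * cnj (pairing a b')) =
      (\<Sum>a\<in>UNIV. \<omega> ((snd b - snd b') * fst a) * \<omega> ((fst b - fst b') * snd a))"
    by (simp add: pairing_def chi_diff[symmetric] chi_add[symmetric] algebra_simps)
  also have "\<dots> = (\<Sum>x\<in>UNIV. \<omega> ((snd b - snd b') * x)) * (\<Sum>y\<in>UNIV. \<omega> ((fst b - fst b') * y))"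
    by (simp only: UNIV_Times_UNIV[symmetric] sum_product sum.cartesian_product split_def)
  also have "\<dots> = (if b = b' then of_nat CARD('a \<times> 'a) else 0)"
    by (simp add: sum_chi prod_eq_iff card_cartesian_product flip: UNIV_Times_UNIV)
  finally show ?thesis .
qed

lemma phase_conj:
  assumes s: "\<sigma> permutes points n d"
  shows "phase n d u v (\<sigma> \<circ> P \<circ> iperm \<sigma>) = (\<Prod>y\<in>points n d. \<omega> (u (fst (\<sigma> y)) * v (fst (\<sigma> (P y)))))"
proof -
  have "phase n d u v (\<sigma> \<circ> P \<circ> iperm \<sigma>) =
      (\<Prod>y\<in>points n d. \<omega> (u (fst (\<sigma> y)) * v (fst ((\<sigma> \<circ> P \<circ> iperm \<sigma>) (\<sigma> y)))))"
    unfolding phase_def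
    by (rule prod_perm_reindex[OF s, symmetric, where f = "\<lambda>x. \<omega> (u (fst x) * v (fst ((\<sigma> \<circ> P \<circ> iperm \<sigma>) x)))"])
  then show ?thesis by (simp add: permutes_inverses[OF s])
qed

lemma phase_conj_half:
  assumes s: "\<sigma> permutes points n d" and P: "P \<in> matchings (points n d)"
    and H: "H \<inter> P ` H = {}" "points n d = H \<union> P ` H"
  shows "phase n d u v (\<sigma> \<circ> P \<circ> iperm \<sigma>) =
    (\<Prod>y\<in>H. pairing (u (fst (\<sigma> y)), v (fst (\<sigma> y))) (u (fst (\<sigma> (P y))), v (fst (\<sigma> (P y)))))"
  unfolding phase_conj[OF s] prod_matching[OF finite_points P H]
  by (intro prod.cong refl) (simp add: pairing_def chi_add matchingsD(3)[OF P])

text \<open>Random relabelling preserves the uniform law on matchings, so each fixed matching can be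
  treated under random relabelling. If there is no matching, \<open>corr\<close> is 0.\<close>

lemma matching_corr_le:
  assumes "\<And>P. P \<in> matchings (points n d) \<Longrightarrow>
     norm (avg (perms (points n d)) (\<lambda>\<sigma>. phase n d u v (\<sigma> \<circ> P \<circ> iperm \<sigma>))) \<le> c"
    and "0 \<le> c"
  shows "norm (corr (matchings (points n d)) n d u v) \<le> c"
proof (cases "matchings (points n d) = {}")
  case True
  then show ?thesis using assms(2) by (simp add: corr_def avg_def)
next
  case False
  have "corr (matchings (points n d)) n d u v = avg (matchings (points n d))
     (\<lambda>P. avg (perms (points n d)) (\<lambda>\<sigma>. phase n d u v (\<sigma> \<circ> P \<circ> iperm \<sigma>)))"
    unfolding corr_def by (rule avg_matchings_conj) (simp_all add: finite_points)
  then have "norm (corr (matchings (points n d)) n d u v) \<le> avg (matchings (points n d))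
     (\<lambda>P. norm (avg (perms (points n d)) (\<lambda>\<sigma>. phase n d u v (\<sigma> \<circ> P \<circ> iperm \<sigma>))))"
    by (simp only: norm_avg_le)
  also have "\<dots> \<le> c"
    using False assms(1) by (intro avg_le_const) (auto simp: finite_matchings finite_points)
  finally show ?thesis .
qed

text \<open>For a matching with halves H and P(H), a further random re-pairing of the halves changes
  nothing, and \<open>uncertainty\<close> for the form \<open>pairing\<close> applies to the two
  half-words. Their weights depend on \<sigma>; on average their product is at most the weight of
  the joint word on the points times the square of a polynomial bound for the number of types on
  H.\<close>

lemma undirected_corr_uncertainty:
  "norm (corr (matchings (points n d)) n d u v) \<le>
     (real d * real n + 1) ^ (CARD('a) ^ 2) * sqrt (real CARD('a) ^ n * type_weight {..<n} (\<lambda>l. (u l, v l))) ^ d"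
proof (rule matching_corr_le)
  let ?X = "points n d" and ?q = "real CARD('a)" and ?P = "perms (points n d)"
  define w where "w x = (u (fst x), v (fst x))" for x :: "nat \<times> nat"
  fix P assume P: "P \<in> matchings ?X"
  note D = matchingsD[OF P]
  obtain H where H: "H \<subseteq> ?X" "H \<inter> P ` H = {}" "?X = H \<union> P ` H" "card ?X = 2 * card H"
    by (rule half_of_matching[OF finite_points P])
  have fH: "finite H" using H(1) finite_points finite_subset by blast
  define Z where "Z \<sigma> = (\<Prod>y\<in>H. pairing (w (\<sigma> y)) (w (\<sigma> (P y))))" for \<sigma> :: "nat \<times> nat \<Rightarrow> nat \<times> nat"
  define F :: "(nat \<times> nat \<Rightarrow> 'a \<times> 'a) \<Rightarrow> real"
    where "F \<gamma> = type_weight H (restrict \<gamma> H) * type_weight H (restrict (\<gamma> \<circ> P) H)" for \<gamma>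
  have F0: "0 \<le> F \<gamma>" for \<gamma> by (simp add: F_def type_weight_nonneg)
  let ?R = "perms H"
  have "avg ?P (\<lambda>\<sigma>. phase n d u v (\<sigma> \<circ> P \<circ> iperm \<sigma>)) = avg ?P Z"
    unfolding Z_def w_def by (intro avg_cong phase_conj_half[OF _ P H(2,3)]) simp
  also have "\<dots> = avg ?P (\<lambda>\<sigma>. avg ?R (\<lambda>\<rho>. \<Prod>y\<in>H. pairing (w (\<sigma> y)) (w (\<sigma> (P (\<rho> y))))))"
  proof (rule avg_invariant)
    fix \<rho> assume "\<rho> \<in> ?R"
    then have r: "\<rho> permutes H" by simp
    \<comment> \<open>The permutation \<rho> of H, carried over to P(H) by P and fixing H, so that y
      meets the label at \<open>P (\<rho> y)\<close>.\<close>
    let ?\<tau> = "\<lambda>x. if x \<in> P ` H then P (\<rho> (P x)) else x"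
    have "bij_betw (\<lambda>x. P (\<rho> (P x))) (P ` H) (P ` H)"
      by (rule bij_betwI[where g = "\<lambda>x. P (iperm \<rho> (P x))"])
        (auto simp: D permutes_inverses[OF r] permutes_in_image[OF r] permutes_in_image[OF permutes_inv[OF r]])
    then have "bij_betw ?\<tau> (P ` H) (P ` H)" by (simp cong: bij_betw_cong)
    then have "?\<tau> permutes P ` H" by (rule bij_imp_permutes) simp
    then have \<tau>: "?\<tau> permutes ?X" by (rule permutes_subset) (use H(3) in blast)
    have "avg ?P Z = avg ?P (\<lambda>\<sigma>. Z (\<sigma> \<circ> ?\<tau>))" by (rule perms_comp_right[OF \<tau>, symmetric])
    also have "\<dots> = avg ?P (\<lambda>\<sigma>. \<Prod>y\<in>H. pairing (w (\<sigma> y)) (w (\<sigma> (P (\<rho> y)))))"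
    proof (intro avg_cong)
      fix \<sigma>
      show "Z (\<sigma> \<circ> ?\<tau>) = (\<Prod>y\<in>H. pairing (w (\<sigma> y)) (w (\<sigma> (P (\<rho> y)))))"
        unfolding Z_def
      proof (intro prod.cong refl)
        fix y assume y: "y \<in> H"
        then have "?\<tau> y = y" "?\<tau> (P y) = P (\<rho> y)" using H(2) by (auto simp: D)
        then show "pairing (w ((\<sigma> \<circ> ?\<tau>) y)) (w ((\<sigma> \<circ> ?\<tau>) (P y))) = pairing (w (\<sigma> y)) (w (\<sigma> (P (\<rho> y))))"
          by (simp only: comp_apply)
      qed
    qed
    finally show "avg ?P (\<lambda>\<sigma>. \<Prod>y\<in>H. pairing (w (\<sigma> y)) (w (\<sigma> (P (\<rho> y))))) = avg ?P Z" by (rule sym)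
  qed (simp_all add: fH)
  finally have "norm (avg ?P (\<lambda>\<sigma>. phase n d u v (\<sigma> \<circ> P \<circ> iperm \<sigma>))) \<le>
      avg ?P (\<lambda>\<sigma>. norm (avg ?R (\<lambda>\<rho>. \<Prod>y\<in>H. pairing (w (\<sigma> y)) (w (\<sigma> (P (\<rho> y)))))))"
    by (simp only: norm_avg_le)
  also have "\<dots> \<le> avg ?P (\<lambda>\<sigma>. sqrt (real CARD('a \<times> 'a) ^ card H * F (restrict (w \<circ> \<sigma>) ?X)))"
  proof (rule avg_mono)
    fix \<sigma> assume "\<sigma> \<in> ?P"
    have "norm (avg ?R (\<lambda>\<rho>. \<Prod>y\<in>H. pairing (w (\<sigma> y)) (w (\<sigma> (P (\<rho> y)))))) \<le>
       sqrt (real CARD('a \<times> 'a) ^ card H * type_weight H (\<lambda>y. w (\<sigma> y)) * type_weight H (\<lambda>y. w (\<sigma> (P y))))"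
      by (rule uncertainty[OF fH orth_pairing])
    also have "type_weight H (\<lambda>y. w (\<sigma> y)) = type_weight H (restrict (restrict (w \<circ> \<sigma>) ?X) H)"
      by (rule type_weight_cong) (use H(1) in auto)
    also have "type_weight H (\<lambda>y. w (\<sigma> (P y))) = type_weight H (restrict (restrict (w \<circ> \<sigma>) ?X \<circ> P) H)"
      by (rule type_weight_cong) (use H(1) in \<open>auto simp: D subset_iff\<close>)
    finally show "norm (avg ?R (\<lambda>\<rho>. \<Prod>y\<in>H. pairing (w (\<sigma> y)) (w (\<sigma> (P (\<rho> y)))))) \<le>
       sqrt (real CARD('a \<times> 'a) ^ card H * F (restrict (w \<circ> \<sigma>) ?X))"
      by (simp only: F_def mult.assoc)
  qed
  \<comment> \<open>Jensen's inequality leaves only the mean of the product of the two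
    weights.\<close>
  also have "\<dots> \<le> sqrt (avg ?P (\<lambda>\<sigma>. real CARD('a \<times> 'a) ^ card H * F (restrict (w \<circ> \<sigma>) ?X)))"
    using F0 by (intro avg_sqrt_le) (auto simp: finite_points)
  also have "\<dots> \<le> sqrt (real CARD('a \<times> 'a) ^ card H * (type_weight {..<n} (\<lambda>l. (u l, v l)) ^ d * ((real (card H) + 1) ^ CARD('a \<times> 'a))\<^sup>2))"
    unfolding avg_mult_left
  proof (intro real_sqrt_le_mono mult_left_mono)
    have "avg ?P (\<lambda>\<sigma>. F (restrict (w \<circ> \<sigma>) ?X)) \<le> type_weight ?X w * (\<Sum>\<gamma>\<in>?X \<rightarrow>\<^sub>E UNIV. F \<gamma>)"
      by (rule avg_word_le[OF finite_points F0])
    also have "(\<Sum>\<gamma>\<in>?X \<rightarrow>\<^sub>E UNIV. F \<gamma>) =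
        (\<Sum>\<alpha>\<in>H \<rightarrow>\<^sub>E (UNIV :: ('a \<times> 'a) set). \<Sum>\<beta>\<in>H \<rightarrow>\<^sub>E (UNIV :: ('a \<times> 'a) set). type_weight H \<alpha> * type_weight H \<beta>)"
      unfolding F_def by (rule sum_words_matching[OF finite_points P H(2,3)])
    also have "\<dots> = (\<Sum>\<alpha>\<in>H \<rightarrow>\<^sub>E (UNIV :: ('a \<times> 'a) set). type_weight H \<alpha>)\<^sup>2"
      by (simp add: power2_eq_square sum_product)
    also have "type_weight ?X w * \<dots> \<le> type_weight {..<n} (\<lambda>l. (u l, v l)) ^ d * ((real (card H) + 1) ^ CARD('a \<times> 'a))\<^sup>2"
    proof (intro mult_mono power_mono sum_type_weight_le fH)
      show "type_weight ?X w \<le> type_weight {..<n} (\<lambda>l. (u l, v l)) ^ d"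
        unfolding w_def points_eq by (rule type_weight_blowup[of "{..<n}" d "\<lambda>l. (u l, v l)"]) simp
    qed (simp_all add: sum_nonneg)
    finally show "avg ?P (\<lambda>\<sigma>. F (restrict (w \<circ> \<sigma>) ?X)) \<le>
      type_weight {..<n} (\<lambda>l. (u l, v l)) ^ d * ((real (card H) + 1) ^ CARD('a \<times> 'a))\<^sup>2" .
  qed simp
  also have "\<dots> = (real (card H) + 1) ^ (CARD('a) ^ 2) * sqrt (?q ^ n * type_weight {..<n} (\<lambda>l. (u l, v l))) ^ d"
  proof -
    have c: "CARD('a \<times> 'a) = CARD('a) ^ 2" by (simp add: power2_eq_square)
    have "n * d = 2 * card H" using H(4) by (simp add: card_points)
    then have "(?q ^ 2) ^ card H = (?q ^ n) ^ d" by (simp only: power_mult[symmetric])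
    then have "real CARD('a \<times> 'a) ^ card H * (type_weight {..<n} (\<lambda>l. (u l, v l)) ^ d * ((real (card H) + 1) ^ CARD('a \<times> 'a))\<^sup>2) =
       ((real (card H) + 1) ^ (CARD('a) ^ 2))\<^sup>2 * (?q ^ n * type_weight {..<n} (\<lambda>l. (u l, v l))) ^ d"
      unfolding c of_nat_power by (simp only: power_mult_distrib mult_ac)
    then show ?thesis by (simp only: sqrt_square_mult_power)
  qed
  also have "\<dots> \<le> (real d * real n + 1) ^ (CARD('a) ^ 2) * sqrt (?q ^ n * type_weight {..<n} (\<lambda>l. (u l, v l))) ^ d"
  proof (intro mult_right_mono power_mono)
    have "card H \<le> n * d" using H(4) by (simp add: card_points)
    then show "real (card H) + 1 \<le> real d * real n + 1" by (simp add: mult.commute flip: of_nat_mult)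
  qed simp_all
  finally show "norm (avg ?P (\<lambda>\<sigma>. phase n d u v (\<sigma> \<circ> P \<circ> iperm \<sigma>))) \<le>
    (real d * real n + 1) ^ (CARD('a) ^ 2) * sqrt (?q ^ n * type_weight {..<n} (\<lambda>l. (u l, v l))) ^ d" .
qed simp_all

text \<open>Relabelling only the points outside the support S of u - c keeps S in place and
  randomizes the partners lying outside S, j in number. If t points of S are matched inside S, the
  collision bound is only z^(j/2); the excess z^(-t/2) over the desired power of z is controlled on
  average by \<open>avg_internal_pairs_le\<close>.\<close>

lemma undirected_corr_near:
  assumes u: "1 \<le> deviation n c u" "deviation n c u \<le> (1 / (2 * d)) * n" and d: "2 \<le> d"
  shows "(\<Sum>v\<in>words n. norm (corr (matchings (points n d)) n d u v)) \<le>
    real CARD('a) ^ n * sqrt (8 * exp 5 * d * deviation n c u / n) ^ (d * deviation n c u)"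
proof -
  let ?X = "points n d" and ?k = "deviation n c u" and ?M = "matchings (points n d)"
  define K where "K = {l. l < n \<and> u l - c \<noteq> 0}"
  define L where "L = {..<n} - K"
  define S where "S = {x \<in> ?X. u (fst x) - c \<noteq> 0}"
  define Y where "Y = L \<times> {..<d}"
  define j where "j P = card {x \<in> S. P x \<in> Y}" for P
  have cS: "card S = ?k * d" unfolding S_def using card_points_fst[of n d "\<lambda>l. u l - c \<noteq> 0"] by simp
  have fS: "finite S" by (simp add: S_def finite_points)
  have fY: "finite Y" by (simp add: Y_def L_def)
  have XS: "?X = S \<union> Y" "S \<inter> Y = {}" by (auto simp: S_def Y_def L_def K_def points_eq)
  have "card L = n - card K" unfolding L_def by (subst card_Diff_subset) (auto simp: K_def)
  then have cL: "card L = n - ?k" by (simp add: K_def)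
  have kd: "2 * (?k * d) \<le> n"
  proof -
    have "2 * (real ?k * real d) \<le> n" using u(2) d by (simp add: field_simps)
    then have "real (2 * (?k * d)) \<le> real n" by simp
    then show ?thesis by (simp only: of_nat_le_iff)
  qed
  have k2: "2 * ?k \<le> n"
  proof -
    have "?k * 1 \<le> ?k * d" using d by (intro mult_left_mono) auto
    then show ?thesis using kd by linarith
  qed
  have n: "0 < n" using u(1) k2 by linarith
  have cL2: "real n / 2 \<le> real (card L)" "?k * d \<le> card L" unfolding cL using k2 kd by linarith+
  \<comment> \<open>Bounds 4 e j / card L for every matching, since j is at most
    \<open>card S\<close> and L contains at least n / 2 vertices.\<close>
  define z where "z = 8 * exp 1 * real (?k * d) / n"
  have z: "0 < z" using u(1) d n by (simp add: z_def)
  have near: "(\<Sum>v\<in>words n. norm (avg (perms Y) (\<lambda>\<pi>. phase n d (\<lambda>l. u l - c) v (\<pi> \<circ> P \<circ> iperm \<pi>)))) \<le>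
     real CARD('a) ^ n * (sqrt z ^ (?k * d) * (1 / sqrt z) ^ card {x \<in> S. P x \<in> S})" if P: "P \<in> ?M" for P
  proof -
    note D = matchingsD[OF P]
    have jS: "?k * d = j P + card {x \<in> S. P x \<in> S}"
    proof -
      have "P x \<in> S \<or> P x \<in> Y" if "x \<in> S" for x
        using that XS(1) D(4)[of x] by blast
      then have un: "{x \<in> S. P x \<in> Y} \<union> {x \<in> S. P x \<in> S} = S" by blast
      have "{x \<in> S. P x \<in> Y} \<inter> {x \<in> S. P x \<in> S} = {}" using XS(2) by blast
      then have "card ({x \<in> S. P x \<in> Y} \<union> {x \<in> S. P x \<in> S}) = j P + card {x \<in> S. P x \<in> S}"
        unfolding j_def using fS by (intro card_Un_disjoint) simp_all
      then have "card S = j P + card {x \<in> S. P x \<in> S}" unfolding un .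
      then show ?thesis using cS by simp
    qed
    then have jk: "j P \<le> ?k * d" by linarith
    \<comment> \<open>Points of Y stay in Y, where u equals c, and drop out of the product; points
      of S are fixed by \<pi>, which acts on their partners only.\<close>
    have eq: "phase n d (\<lambda>l. u l - c) v (\<pi> \<circ> P \<circ> iperm \<pi>) = (\<Prod>x\<in>S. \<omega> ((u (fst x) - c) * v (fst (\<pi> (P x)))))"
      if "\<pi> permutes Y" for \<pi> v
    proof -
      have pX: "\<pi> permutes ?X" using that XS(1) by (auto intro: permutes_subset)
      have fix_S: "\<pi> x = x" if "x \<in> S" for x
        using that XS(2) by (intro permutes_not_in[OF \<open>\<pi> permutes Y\<close>]) blast
      have zero: "u (fst (\<pi> x)) - c = 0" if "x \<in> ?X - S" for x
      proof -
        have "\<pi> x \<in> Y" using that XS(1) permutes_in_image[OF \<open>\<pi> permutes Y\<close>] by blast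
        then show ?thesis using XS by (auto simp: S_def)
      qed
      have "phase n d (\<lambda>l. u l - c) v (\<pi> \<circ> P \<circ> iperm \<pi>) = (\<Prod>x\<in>?X. \<omega> ((u (fst (\<pi> x)) - c) * v (fst (\<pi> (P x)))))"
        by (rule phase_conj[OF pX])
      also have "\<dots> = (\<Prod>x\<in>S. \<omega> ((u (fst (\<pi> x)) - c) * v (fst (\<pi> (P x)))))"
        using zero XS(1) by (intro prod.mono_neutral_right) (auto simp: fS fY chi_0)
      also have "\<dots> = (\<Prod>x\<in>S. \<omega> ((u (fst x) - c) * v (fst (\<pi> (P x)))))"
        by (intro prod.cong) (auto simp: fix_S)
      finally show ?thesis .
    qed
    have "(\<Sum>v\<in>words n. norm (avg (perms Y) (\<lambda>\<pi>. phase n d (\<lambda>l. u l - c) v (\<pi> \<circ> P \<circ> iperm \<pi>)))) =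
       (\<Sum>v\<in>words n. norm (avg (perms Y) (\<lambda>\<pi>. \<Prod>x\<in>S. \<omega> ((u (fst x) - c) * v (fst (\<pi> (P x)))))))"
      by (intro sum.cong refl arg_cong[where f = norm] avg_cong eq) simp
    also have "\<dots> \<le> real CARD('a) ^ card {..<n} * sqrt ((4 * exp 1 * j P / card L) ^ j P)"
      unfolding j_def Y_def
    proof (rule sum_words_near_constant)
      show "card {x \<in> S. P x \<in> L \<times> {..<d}} \<le> card L" using jk cL2(2) unfolding j_def Y_def by linarith
      have "P ` S \<subseteq> ?X"
      proof (rule image_subsetI)
        fix x assume "x \<in> S"
        then show "P x \<in> ?X" unfolding D(4) by (simp add: S_def)
      qed
      then show "P ` S \<subseteq> {..<n} \<times> {..<d}" by (simp only: points_eq)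
      show "inj_on P S" by (simp add: inj_on_def D)
    qed (use d fS in \<open>auto simp: L_def S_def\<close>)
    also have "\<dots> \<le> real CARD('a) ^ n * sqrt (z ^ j P)"
    proof -
      have "4 * exp 1 * j P / card L \<le> z"
      proof -
        have "4 * exp 1 * j P / card L \<le> 4 * exp 1 * real (?k * d) / (real n / 2)"
          using jk cL2(1) n by (intro frac_le mult_left_mono of_nat_mono) auto
        then show ?thesis by (simp add: z_def)
      qed
      then have "(4 * exp 1 * j P / card L) ^ j P \<le> z ^ j P" by (intro power_mono) auto
      then show ?thesis unfolding card_lessThan by (intro mult_left_mono real_sqrt_le_mono) auto
    qed
    also have "sqrt (z ^ j P) = sqrt z ^ (?k * d) * (1 / sqrt z) ^ card {x \<in> S. P x \<in> S}"
      unfolding jS using z by (simp add: real_sqrt_power power_add power_divide)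
    finally show ?thesis .
  qed
  have m: "0 < real (?k * d)"
  proof -
    have "0 < ?k" using u(1) by linarith
    moreover have "0 < d" using d by linarith
    ultimately show ?thesis by (simp only: of_nat_0_less_iff mult_pos_pos)
  qed
  \<comment> \<open>Applied with y = 1 / sqrt z, which is admissible because \<open>card S\<close> /
    z equals n / (8 e).\<close>
  have internal: "avg ?M (\<lambda>P. (1 / sqrt z) ^ card {x \<in> S. P x \<in> S}) \<le> exp (2 * card S)"
  proof (rule avg_internal_pairs_le[OF finite_points])
    show "S \<noteq> {}" using m unfolding cS[symmetric] by auto
    have "(1 / sqrt z)\<^sup>2 * card S = n / (8 * exp 1)"
    proof -
      have "(1 / sqrt z)\<^sup>2 * card S = real (?k * d) / z" using z unfolding cS by (simp add: power_divide)
      also have "\<dots> = n / (8 * exp 1)"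
      proof -
        have "t / (8 * exp 1 * t / real n) = n / (8 * exp 1)" if "0 < t" for t :: real using that by simp
        then show ?thesis unfolding z_def using m by blast
      qed
      finally show ?thesis .
    qed
    also have "\<dots> \<le> n / 1"
    proof (rule divide_left_mono)
      show "(1 :: real) \<le> 8 * exp 1" using exp_ge_add_one_self[of 1] by linarith
    qed auto
    also have "\<dots> \<le> real (2 * card ?X)"
    proof -
      have "n * 1 \<le> n * d" using d by (intro mult_le_mono2) simp
      then have "n \<le> 2 * card ?X" unfolding card_points by linarith
      then show ?thesis by simp
    qed
    finally show "(1 / sqrt z)\<^sup>2 * card S \<le> 2 * card ?X" .
  qed (use z in \<open>auto simp: S_def\<close>)
  have "(\<Sum>v\<in>words n. norm (corr ?M n d u v)) = (\<Sum>v\<in>words n. norm (corr ?M n d (\<lambda>l. u l - c) v))"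
    by (intro sum.cong refl norm_corr_shift[symmetric]) (rule matchingsD)
  also have "\<dots> \<le> (\<Sum>v\<in>words n. avg ?M (\<lambda>P. norm (avg (perms Y) (\<lambda>\<pi>. phase n d (\<lambda>l. u l - c) v (\<pi> \<circ> P \<circ> iperm \<pi>)))))"
  proof (rule sum_mono)
    fix v :: "nat \<Rightarrow> 'a"
    have "corr ?M n d (\<lambda>l. u l - c) v = avg ?M (\<lambda>P. avg (perms Y) (\<lambda>\<pi>. phase n d (\<lambda>l. u l - c) v (\<pi> \<circ> P \<circ> iperm \<pi>)))"
      unfolding corr_def using XS(1) by (intro avg_matchings_conj finite_points) blast
    then show "norm (corr ?M n d (\<lambda>l. u l - c) v) \<le> avg ?M (\<lambda>P. norm (avg (perms Y) (\<lambda>\<pi>. phase n d (\<lambda>l. u l - c) v (\<pi> \<circ> P \<circ> iperm \<pi>))))"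
      by (simp only: norm_avg_le)
  qed
  also have "\<dots> = avg ?M (\<lambda>P. \<Sum>v\<in>words n. norm (avg (perms Y) (\<lambda>\<pi>. phase n d (\<lambda>l. u l - c) v (\<pi> \<circ> P \<circ> iperm \<pi>))))"
    by (rule sum_avg)
  also have "\<dots> \<le> avg ?M (\<lambda>P. real CARD('a) ^ n * (sqrt z ^ (?k * d) * (1 / sqrt z) ^ card {x \<in> S. P x \<in> S}))"
    by (intro avg_mono near)
  also have "\<dots> = real CARD('a) ^ n * (sqrt z ^ (?k * d) * avg ?M (\<lambda>P. (1 / sqrt z) ^ card {x \<in> S. P x \<in> S}))"
    by (simp only: avg_mult_left)
  also have "\<dots> \<le> real CARD('a) ^ n * (sqrt z ^ (?k * d) * exp (2 * card S))"
    using internal z by (intro mult_left_mono) auto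
  \<comment> \<open>The cost exp 2 per point of S multiplies sqrt z by exp 2, hence z by exp 4, and
    turns 8 e into \<open>8 * exp 5\<close>.\<close>
  also have "\<dots> = real CARD('a) ^ n * sqrt (8 * exp 5 * d * ?k / n) ^ (d * ?k)"
  proof -
    have "exp (2 * real (card S)) = exp 2 ^ (?k * d)"
      using exp_of_nat_mult[of "card S" "2 :: real"] by (simp only: cS mult.commute)
    then have "sqrt z ^ (?k * d) * exp (2 * card S) = (sqrt z * exp 2) ^ (?k * d)" by (simp only: power_mult_distrib of_nat_mult of_nat_numeral)
    also have "sqrt z * exp 2 = sqrt (z * (exp 2)\<^sup>2)" by (simp add: real_sqrt_mult)
    also have "z * (exp 2)\<^sup>2 = 8 * (exp 1 * (exp 2)\<^sup>2) * d * ?k / n"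
      by (simp add: z_def)
    also have "exp 1 * (exp 2)\<^sup>2 = exp (5 :: real)"
      by (simp add: power2_eq_square flip: exp_add)
    finally have "sqrt z ^ (?k * d) * exp (2 * card S) = sqrt (8 * exp 5 * d * ?k / n) ^ (?k * d)" .
    then show ?thesis by (simp only: mult.commute[of d])
  qed
  finally show ?thesis .
qed

end

section \<open>Pairs far from constant in the undirected model\<close>

context additive_character
begin

text \<open>The word u provides a popular difference of letter pairs with nonzero first coordinate,
  and v one with nonzero second coordinate. If one of them has both coordinates x, y nonzero, the
  symmetric form of it with itself is 2xy, nonzero in odd characteristic. Otherwise they are (x, 0)
  and (0, y), and their mixed value is xy.\<close>

lemma popular_pairing:
  fixes u v :: "nat \<Rightarrow> 'a" and \<delta> :: real
  assumes two: "(2 :: 'a) \<noteq> 0" and \<delta>: "0 < \<delta>" "\<delta> \<le> 1" and n: "0 < n"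
    and u: "\<And>a. \<delta> * n < deviation n a u" and v: "\<And>a. \<delta> * n < deviation n a v"
  obtains p p' r r' where
    "(fst p - fst p') * (snd r - snd r') + (fst r - fst r') * (snd p - snd p') \<noteq> 0"
    "\<forall>e\<in>{p, p', r, r'}. \<delta> / CARD('a \<times> 'a) * n \<le> card {l. l < n \<and> (u l, v l) = e}"
proof -
  have u': "\<delta> * n < deviation n a (\<lambda>l. fst (u l, v l))" for a using u by simp
  have v': "\<delta> * n < deviation n a (\<lambda>l. snd (u l, v l))" for a using v by simp
  obtain e e' where e: "fst e \<noteq> fst e'" "\<delta> / CARD('a \<times> 'a) * n \<le> card {l. l < n \<and> (u l, v l) = e}"
      "\<delta> / CARD('a \<times> 'a) * n \<le> card {l. l < n \<and> (u l, v l) = e'}"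
    by (rule popular_values[where f = fst and w = "\<lambda>l. (u l, v l)", OF \<delta> n u'])
  obtain g g' where g: "snd g \<noteq> snd g'" "\<delta> / CARD('a \<times> 'a) * n \<le> card {l. l < n \<and> (u l, v l) = g}"
      "\<delta> / CARD('a \<times> 'a) * n \<le> card {l. l < n \<and> (u l, v l) = g'}"
    by (rule popular_values[where f = snd and w = "\<lambda>l. (u l, v l)", OF \<delta> n v'])
  have double: "x * y + x * y \<noteq> 0" if "x \<noteq> 0" "y \<noteq> 0" for x y :: 'a
  proof -
    have "2 * (x * y) \<noteq> 0" using that two by simp
    then show ?thesis by (metis mult_2)
  qed
  show ?thesis
  proof (cases "snd e = snd e'")
    case False
    then have "(fst e - fst e') * (snd e - snd e') + (fst e - fst e') * (snd e - snd e') \<noteq> 0"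
      using e(1) by (intro double) simp_all
    then show ?thesis by (rule that) (use e in auto)
  next
    case eT: True
    show ?thesis
    proof (cases "fst g = fst g'")
      case False
      then have "(fst g - fst g') * (snd g - snd g') + (fst g - fst g') * (snd g - snd g') \<noteq> 0"
        using g(1) by (intro double) simp_all
      then show ?thesis by (rule that) (use g in auto)
    next
      case True
      then have "(fst e - fst e') * (snd g - snd g') + (fst g - fst g') * (snd e - snd e') \<noteq> 0"
        using e(1) g(1) by simp
      then show ?thesis by (rule that) (use e g in auto)
    qed
  qed
qed

text \<open>For a fixed matching, exchanging the labels at the partners of a and a' re-pairs two
  edges and changes the exponent by minus a form as in \<open>popular_pairing\<close>. Each swap
  involves four points, hence the fourth power of \<gamma>.\<close>

lemma undirected_corr_far:
  fixes \<delta> :: real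
  assumes two: "(2 :: 'a) \<noteq> 0" and \<delta>: "0 < \<delta>" and d: "1 \<le> d"
  shows "\<exists>c>0::real. \<forall>\<^sub>F n in sequentially. \<forall>u\<in>words n. \<forall>v\<in>words n.
    (\<forall>a. \<delta> * real n < real (deviation n a u)) \<longrightarrow> (\<forall>a. \<delta> * real n < real (deviation n a v)) \<longrightarrow>
    norm (corr (matchings (points n d)) n d u v) \<le> exp (- c * real n)"
proof -
  obtain \<rho> where \<rho>: "0 \<le> \<rho>" "\<rho> < 1" and half: "\<And>x. x \<noteq> 0 \<Longrightarrow> norm ((1 + \<omega> x) / 2) \<le> \<rho>"
    using ex_half_angle_bound by blast
  define \<delta>' where "\<delta>' = min \<delta> 1"
  define \<gamma> where "\<gamma> = \<delta>' / CARD('a \<times> 'a)"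
  define c0 where "c0 = (1 - \<rho>) * \<gamma> ^ 4"
  have \<delta>': "0 < \<delta>'" "\<delta>' \<le> 1" "\<delta>' \<le> \<delta>" using \<delta> by (auto simp: \<delta>'_def)
  have c1: "1 \<le> real CARD('a \<times> 'a)"
    by (metis One_nat_def Suc_leI of_nat_1 of_nat_le_iff zero_less_card_finite)
  have "\<gamma> \<le> \<delta>' / 1"
    unfolding \<gamma>_def by (rule divide_left_mono[OF c1]) (use \<delta>' c1 in simp_all)
  then have "\<gamma> \<le> 1" using \<delta>'(2) by linarith
  moreover have "0 < \<gamma>" unfolding \<gamma>_def using \<delta>'(1) c1 by (intro divide_pos_pos) linarith+
  ultimately have \<gamma>: "0 < \<gamma>" "\<gamma> \<le> 1" by blast+
  have c0: "0 < c0" using \<gamma> \<rho> by (simp add: c0_def)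
  have c01: "c0 \<le> 1" unfolding c0_def using \<gamma> \<rho> by (intro mult_le_one power_le_one) auto
  have main: "norm (corr (matchings (points n d)) n d u v) \<le> exp (- c0 * Q / 2)"
    if n: "0 < n" and u: "\<And>a. \<delta> * real n < real (deviation n a u)" and v: "\<And>a. \<delta> * real n < real (deviation n a v)"
      and Q: "real Q \<le> c0 * real (n * d) / 64" for n u v and Q :: nat
  proof (rule matching_corr_le)
    let ?X = "points n d"
    fix P assume P: "P \<in> matchings ?X"
    note D = matchingsD[OF P]
    have fX: "finite ?X" by (rule finite_points)
    obtain H where H: "H \<subseteq> ?X" "H \<inter> P ` H = {}" "?X = H \<union> P ` H" "card ?X = 2 * card H"
      by (rule half_of_matching[OF fX P])
    have fH: "finite H" using H(1) fX finite_subset by blast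
    have \<delta>n: "\<delta>' * n \<le> \<delta> * n" using \<delta>' by (simp add: mult_right_mono)
    have dev_u: "\<delta>' * n < deviation n a u" for a using u[of a] \<delta>n by linarith
    have dev_v: "\<delta>' * n < deviation n a v" for a using v[of a] \<delta>n by linarith
    obtain p p' r r' where ne: "(fst p - fst p') * (snd r - snd r') + (fst r - fst r') * (snd p - snd p') \<noteq> 0"
      and pop: "\<forall>e\<in>{p, p', r, r'}. \<gamma> * n \<le> card {l. l < n \<and> (u l, v l) = e}"
      unfolding \<gamma>_def by (rule popular_pairing[OF two \<delta>'(1,2) n dev_u dev_v])
    define U where "U x = u (fst x)" for x :: "nat \<times> nat"
    define V where "V x = v (fst x)" for x :: "nat \<times> nat"
    define cls where "cls e = {x \<in> ?X. (U x, V x) = e}" for e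
    have big: "\<gamma> * card ?X \<le> card (cls e)" if "e \<in> {p, p', r, r'}" for e
      using mult_right_mono[OF bspec[OF pop that], of d] card_points_fst[of n d "\<lambda>l. (u l, v l) = e"]
      by (simp add: card_points mult.assoc cls_def U_def V_def)
    have "real (2 * Q) \<le> card H"
    proof -
      have "c0 * real (n * d) \<le> 1 * real (n * d)" using c01 by (intro mult_right_mono) auto
      then have "real (2 * Q) \<le> real (n * d) / 2" using Q by simp
      also have "real (n * d) / 2 = card H" using H(4) by (simp add: card_points)
      finally show ?thesis .
    qed
    then have "2 * Q \<le> card H" by (simp only: of_nat_le_iff)
    then obtain i where i: "inj_on i {..<2 * Q}" "i ` {..<2 * Q} \<subseteq> H" by (rule obtain_injection)
    \<comment> \<open>The two families are the first and the second Q of 2 Q distinct points of H,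
      so that all these points and their partners are distinct.\<close>
    define a where "a q = i q" for q
    define a' where "a' q = i (Q + q)" for q
    have aH: "a q \<in> H" "a' q \<in> H" if "q < Q" for q using i(2) that by (auto simp: a_def a'_def)
    have aX: "a q \<in> ?X" "a' q \<in> ?X" if "q < Q" for q using aH[OF that] H(1) by auto
    have aa': "a q \<noteq> a' s" if "q < Q" "s < Q" for q s
      using inj_onD[OF i(1), of q "Q + s"] that by (auto simp: a_def a'_def)
    have neq: "a q \<noteq> a s" "a' q \<noteq> a' s" if "q < Q" "s < Q" "q \<noteq> s" for q s
      using inj_onD[OF i(1), of q s] inj_onD[OF i(1), of "Q + q" "Q + s"] that by (auto simp: a_def a'_def)
    have PH: "P x \<noteq> y" if "x \<in> H" "y \<in> H" for x y using that H(2) by blast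
    define Z where "Z \<sigma> = (\<Prod>y\<in>H. pairing (U (\<sigma> y), V (\<sigma> y)) (U (\<sigma> (P y)), V (\<sigma> (P y))))" for \<sigma> :: "nat \<times> nat \<Rightarrow> nat \<times> nat"
    define z where "z q \<sigma> = \<omega> (- ((U (\<sigma> (a q)) - U (\<sigma> (a' q))) * (V (\<sigma> (P (a q))) - V (\<sigma> (P (a' q)))) +
       (U (\<sigma> (P (a q))) - U (\<sigma> (P (a' q)))) * (V (\<sigma> (a q)) - V (\<sigma> (a' q)))))" for q and \<sigma> :: "nat \<times> nat \<Rightarrow> nat \<times> nat"
    let ?t = "\<lambda>q. Transposition.transpose (P (a q)) (P (a' q))"
    have tH: "?t q y = y" if "q < Q" "y \<in> H" for q y
      using PH[OF aH(1)[OF that(1)] that(2)] PH[OF aH(2)[OF that(1)] that(2)] by (auto simp: transpose_def)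
    have tP: "?t q (P y) = P y" if "y \<noteq> a q" "y \<noteq> a' q" for q y
      using that by (simp add: transpose_def D)
    \<comment> \<open>Targets p, p' for the two points of a swap and r, r' for their partners. The
      last case also serves points outside all blocks, where the lower bound on the size of a target
      must hold as well.\<close>
    define T where "T b = (if b \<in> a ` {..<Q} then cls p else if b \<in> a' ` {..<Q} then cls p'
       else if b \<in> (\<lambda>q. P (a q)) ` {..<Q} then cls r else cls r')" for b
    have Ta: "T (a q) = cls p" "T (a' q) = cls p'" "T (P (a q)) = cls r" "T (P (a' q)) = cls r'" if q: "q < Q" for q
    proof -
      have "a' q \<notin> a ` {..<Q}" using aa'[OF _ q] by (metis imageE lessThan_iff)
      moreover have "P (a q) \<notin> a ` {..<Q}" "P (a q) \<notin> a' ` {..<Q}" "P (a' q) \<notin> a ` {..<Q}" "P (a' q) \<notin> a' ` {..<Q}"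
        using PH aH q by (metis imageE lessThan_iff)+
      moreover have "P (a' q) \<notin> (\<lambda>q. P (a q)) ` {..<Q}" using aa'[OF _ q] D(5) by (metis imageE lessThan_iff)
      ultimately show "T (a q) = cls p" "T (a' q) = cls p'" "T (P (a q)) = cls r" "T (P (a' q)) = cls r'"
        using q by (simp_all add: T_def)
    qed
    have "avg (perms ?X) (\<lambda>\<sigma>. phase n d u v (\<sigma> \<circ> P \<circ> iperm \<sigma>)) = avg (perms ?X) Z"
      unfolding Z_def U_def V_def by (intro avg_cong phase_conj_half[OF _ P H(2,3)]) simp
    also have "norm \<dots> \<le> exp (- c0 * Q / 2)"
    proof (rule norm_avg_swap_le[where X = ?X and t = ?t and z = z and r = 4 and \<gamma> = \<gamma> and \<rho> = \<rho>
          and B = "\<lambda>q. {a q, a' q, P (a q), P (a' q)}" and T = T])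
      show "?t q permutes ?X" if "q < Q" for q
        using aX[OF that] by (intro permutes_swap_id) (simp_all add: D)
      show "Z (\<sigma> \<circ> ?t q) = Z \<sigma> * z q \<sigma>" if q: "q < Q" for q \<sigma>
      proof -
        let ?f = "\<lambda>\<sigma> y. pairing (U (\<sigma> y), V (\<sigma> y)) (U (\<sigma> (P y)), V (\<sigma> (P y)))"
        have split: "Z \<tau> = ?f \<tau> (a q) * ?f \<tau> (a' q) * prod (?f \<tau>) (H - {a q, a' q})" for \<tau>
          unfolding Z_def by (rule prod_remove2[OF fH aH[OF q] aa'[OF q q]])
        have rest: "prod (?f (\<sigma> \<circ> ?t q)) (H - {a q, a' q}) = prod (?f \<sigma>) (H - {a q, a' q})"
          using tH[OF q] tP by (intro prod.cong) auto
        have "?f (\<sigma> \<circ> ?t q) (a q) * ?f (\<sigma> \<circ> ?t q) (a' q) = ?f \<sigma> (a q) * ?f \<sigma> (a' q) * z q \<sigma>"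
          unfolding comp_apply tH[OF q aH(1)[OF q]] tH[OF q aH(2)[OF q]] transpose_apply_first transpose_apply_second
            pairing_def z_def chi_add[symmetric] by (rule arg_cong[where f = \<omega>]) (simp add: algebra_simps)
        then show ?thesis unfolding split[of \<sigma>] split[of "\<sigma> \<circ> ?t q"] rest by simp
      qed
      show "z s (\<sigma> \<circ> ?t q) = z s \<sigma>" if q: "q < Q" and s: "s < q" for q s \<sigma>
      proof -
        have s': "s < Q" "s \<noteq> q" using q s by auto
        have "?t q (P (a s)) = P (a s)" "?t q (P (a' s)) = P (a' s)"
          using neq[OF s'(1) q s'(2)] aa'[OF s'(1) q] aa'[OF q s'(1)] by (auto intro!: tP)
        then show ?thesis unfolding z_def comp_apply by (simp add: tH[OF q] aH[OF s'(1)])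
      qed
      show "norm ((1 + z q \<sigma>) / 2) \<le> \<rho>"
        if q: "q < Q" and good: "\<forall>b\<in>{a q, a' q, P (a q), P (a' q)}. \<sigma> b \<in> T b" for q \<sigma>
      proof -
        have "(U (\<sigma> (a q)), V (\<sigma> (a q))) = p" "(U (\<sigma> (a' q)), V (\<sigma> (a' q))) = p'"
          "(U (\<sigma> (P (a q))), V (\<sigma> (P (a q)))) = r" "(U (\<sigma> (P (a' q))), V (\<sigma> (P (a' q)))) = r'"
          using good unfolding ball_simps insert_iff by (simp_all add: Ta[OF q] cls_def)
        then have e: "U (\<sigma> (a q)) = fst p" "V (\<sigma> (a q)) = snd p" "U (\<sigma> (a' q)) = fst p'" "V (\<sigma> (a' q)) = snd p'"
          "U (\<sigma> (P (a q))) = fst r" "V (\<sigma> (P (a q))) = snd r" "U (\<sigma> (P (a' q))) = fst r'" "V (\<sigma> (P (a' q))) = snd r'"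
          by auto
        show ?thesis unfolding z_def e by (rule half) (use ne in \<open>simp only: neg_equal_0_iff_equal not_False_eq_True\<close>)
      qed
      show "disjoint_family_on (\<lambda>q. {a q, a' q, P (a q), P (a' q)}) {..<Q}"
        unfolding disjoint_family_on_def
      proof (intro ballI impI)
        fix q s assume "q \<in> {..<Q}" "s \<in> {..<Q}" "q \<noteq> s"
        then have qs: "q < Q" "s < Q" "q \<noteq> s" by auto
        have "P x \<noteq> y" "y \<noteq> P x" if "x \<in> {a q, a' q, a s, a' s}" "y \<in> {a q, a' q, a s, a' s}" for x y
          using that PH[of x y] aH[OF qs(1)] aH[OF qs(2)] by auto
        then show "{a q, a' q, P (a q), P (a' q)} \<inter> {a s, a' s, P (a s), P (a' s)} = {}"
          using aa'[OF qs(1,2)] aa'[OF qs(2,1)] neq[OF qs] by (simp add: D)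
      qed
      show "card {a q, a' q, P (a q), P (a' q)} = 4" if q: "q < Q" for q
      proof -
        have "P (a q) \<noteq> a q" "P (a q) \<noteq> a' q" "P (a' q) \<noteq> a q" "P (a' q) \<noteq> a' q" by (intro PH aH q)+
        then show ?thesis using aa'[OF q q] by (simp add: D eq_commute)
      qed
      show "\<gamma> * card ?X \<le> card (T b)" for b
        unfolding T_def using big by (simp split: if_split)
      show "T b \<subseteq> ?X" for b unfolding T_def cls_def by auto
      show "{a q, a' q, P (a q), P (a' q)} \<subseteq> ?X" if "q < Q" for q using aX[OF that] by (simp add: D)
      show "0 < card ?X" using n d by (simp add: card_points)
      show "real Q \<le> c0 * card ?X / 64" using Q by (simp add: card_points)
      show "norm (Z \<sigma>) = 1" for \<sigma> by (simp add: Z_def norm_pairing flip: prod_norm)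
    qed (use \<gamma> \<rho> fX in \<open>simp_all add: c0_def z_def norm_chi\<close>)
    finally show "norm (avg (perms ?X) (\<lambda>\<sigma>. phase n d u v (\<sigma> \<circ> P \<circ> iperm \<sigma>))) \<le> exp (- c0 * Q / 2)" .
  qed simp
  have "\<forall>\<^sub>F n in sequentially. 128 / c0 \<le> real n \<and> 0 < n"
    by (intro eventually_conj eventually_gt_at_top filterlim_real_sequentially[unfolded filterlim_at_top, rule_format])
  then have ev: "\<forall>\<^sub>F n in sequentially. \<forall>u\<in>words n. \<forall>v\<in>words n.
    (\<forall>a. \<delta> * real n < real (deviation n a u)) \<longrightarrow> (\<forall>a. \<delta> * real n < real (deviation n a v)) \<longrightarrow>
    norm (corr (matchings (points n d)) n d u v) \<le> exp (- (c0\<^sup>2 / 256) * real n)"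
  proof (eventually_elim, intro ballI impI)
    fix n and u v :: "nat \<Rightarrow> 'a"
    assume n: "128 / c0 \<le> real n \<and> 0 < n" and uv: "\<forall>a. \<delta> * real n < real (deviation n a u)" "\<forall>a. \<delta> * real n < real (deviation n a v)"
    have nd: "real n \<le> real (n * d)" using d by (simp add: mult_le_cancel_left1)
    have N: "128 / c0 \<le> real (n * d)" using n nd by linarith
    have "norm (corr (matchings (points n d)) n d u v) \<le> exp (- (c0\<^sup>2 / 256) * real (n * d))"
      by (rule exp_floor_le[OF c0 N]) (use n uv main in blast)
    also have "\<dots> \<le> exp (- (c0\<^sup>2 / 256) * real n)"
      using nd by (simp add: mult_left_mono)
    finally show "norm (corr (matchings (points n d)) n d u v) \<le> exp (- (c0\<^sup>2 / 256) * real n)" .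
  qed
  show ?thesis by (rule exI[of _ "c0\<^sup>2 / 256"]) (use ev c0 in simp)
qed

text \<open>The joint word determines u and v, so the sum runs over distinct words on the alphabet
  of pairs.\<close>

lemma sum_type_weight_joint:
  "(\<Sum>u\<in>words n. \<Sum>v\<in>words n. type_weight {..<n} (\<lambda>l. (u l :: 'a, v l :: 'a))) \<le> (real n + 1) ^ (CARD('a) ^ 2)"
proof -
  let ?h = "\<lambda>z. \<lambda>l\<in>{..<n}. (fst z l, snd z l)"
  let ?W = "words n :: (nat \<Rightarrow> 'a) set"
  have inj: "inj_on ?h (?W \<times> ?W)"
  proof (rule inj_onI)
    fix z z' assume z: "z \<in> ?W \<times> ?W" "z' \<in> ?W \<times> ?W" and eq: "?h z = ?h z'"
    have "fst z l = fst z' l \<and> snd z l = snd z' l" if "l < n" for l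
      using fun_cong[OF eq, of l] that by simp
    then have "fst z = fst z'" "snd z = snd z'"
      using z by (auto intro!: PiE_ext[of _ "{..<n}" "\<lambda>_. UNIV"])
    then show "z = z'" by (rule prod_eqI)
  qed
  have "(\<Sum>u\<in>?W. \<Sum>v\<in>?W. type_weight {..<n} (\<lambda>l. (u l, v l))) = (\<Sum>z\<in>?W \<times> ?W. type_weight {..<n} (?h z))"
    unfolding sum.cartesian_product split_def by (intro sum.cong refl type_weight_cong) simp
  also have "\<dots> = (\<Sum>w\<in>?h ` (?W \<times> ?W). type_weight {..<n} w)"
    by (simp only: sum.reindex[OF inj] o_def)
  also have "\<dots> \<le> (\<Sum>w\<in>{..<n} \<rightarrow>\<^sub>E (UNIV :: ('a \<times> 'a) set). type_weight {..<n} w)"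
  proof (rule sum_mono2)
    show "?h ` (?W \<times> ?W) \<subseteq> {..<n} \<rightarrow>\<^sub>E (UNIV :: ('a \<times> 'a) set)"
      by (rule image_subsetI) (rule restrict_PiE_iff[THEN iffD2], simp)
  qed simp_all
  also have "\<dots> \<le> (real (card {..<n}) + 1) ^ CARD('a \<times> 'a)"
    by (rule sum_type_weight_le) simp
  finally show ?thesis by (simp add: power2_eq_square)
qed

theorem undirected_corr_sum_tendsto_0:
  assumes two: "(2 :: 'a) \<noteq> 0" and d: "3 \<le> d"
  shows "(\<lambda>n. (\<Sum>u\<in>nonconst_words n. \<Sum>v\<in>nonconst_words n. norm (corr (matchings (points n d)) n d u v)) /
    real CARD('a) ^ n) \<longlonglongrightarrow> 0"
proof (rule nonconst_sum_tendsto_0[OF d, where B = "8 * exp 5 * d" and \<eta> = "1 / (2 * real d)" and b = "CARD('a) ^ 2" and a = "CARD('a) ^ 2"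
    and s = "\<lambda>n u v. type_weight {..<n} (\<lambda>l. (u l, v l))"])
  have comm: "corr (matchings (points n d)) n d u v = corr (matchings (points n d)) n d v u" for n u v
  proof (rule corr_commute)
    fix P assume P: "P \<in> matchings (points n d)"
    show "P permutes points n d" by (rule matchingsD(1)[OF P])
    show "iperm P \<in> matchings (points n d)" using P by (simp only: inv_matching[OF P])
  qed
  fix n :: nat and c :: 'a
  show left: "(\<Sum>v\<in>words n. norm (corr (matchings (points n d)) n d u v)) \<le>
     real CARD('a) ^ n * sqrt (8 * exp 5 * d * deviation n c u / n) ^ (d * deviation n c u)"
    if "1 \<le> deviation n c u" "deviation n c u \<le> (1 / (2 * real d)) * n" for u
    by (rule undirected_corr_near[OF that]) (use d in simp)
  show "(\<Sum>u\<in>words n. norm (corr (matchings (points n d)) n d u v)) \<le>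
     real CARD('a) ^ n * sqrt (8 * exp 5 * d * deviation n c v / n) ^ (d * deviation n c v)"
    if "1 \<le> deviation n c v" "deviation n c v \<le> (1 / (2 * real d)) * n" for v
    using left[OF that] by (simp only: comm[of n v])
next
  fix n and u v :: "nat \<Rightarrow> 'a"
  show "norm (corr (matchings (points n d)) n d u v) \<le>
    (real d * real n + 1) ^ (CARD('a) ^ 2) * sqrt (real CARD('a) ^ n * type_weight {..<n} (\<lambda>l. (u l, v l))) ^ d"
    by (rule undirected_corr_uncertainty)
  show "(\<Sum>u\<in>words n. \<Sum>v\<in>words n. type_weight {..<n} (\<lambda>l. (u l :: 'a, v l :: 'a))) \<le> (real n + 1) ^ (CARD('a) ^ 2)"
    by (rule sum_type_weight_joint)
next
  fix \<delta> :: real assume "0 < \<delta>"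
  then show "\<exists>c>0::real. \<forall>\<^sub>F n in sequentially. \<forall>u\<in>words n. \<forall>v\<in>words n.
    (\<forall>a. \<delta> * real n < real (deviation n a u)) \<longrightarrow> (\<forall>a. \<delta> * real n < real (deviation n a v)) \<longrightarrow>
    norm (corr (matchings (points n d)) n d u v) \<le> exp (- c * real n)"
    by (rule undirected_corr_far[OF two]) (use d in simp)
qed (use d in simp_all)

end

section \<open>Singularity of the random matrices\<close>

definition root_char :: "'p::prime_card mod_ring \<Rightarrow> complex" where
  "root_char x = cis (2 * pi * (real_of_int (to_int_mod_ring x) / real CARD('p)))"

lemma additive_character_root_char: "additive_character (root_char :: 'p::prime_card mod_ring \<Rightarrow> complex)"
proof
  let ?p = "real CARD('p)"
  have p: "0 < ?p" by simp
  fix x y :: "'p mod_ring"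
  let ?t = "\<lambda>x :: 'p mod_ring. real_of_int (to_int_mod_ring x)"
  show "root_char (x + y) = root_char x * root_char y"
  proof -
    \<comment> \<open>The carry of the addition modulo p, which contributes full turns only.\<close>
    define k where "k = (to_int_mod_ring x + to_int_mod_ring y) div int CARD('p)"
    have "to_int_mod_ring x + to_int_mod_ring y = int CARD('p) * k + to_int_mod_ring (x + y)"
      unfolding to_int_mod_ring_add k_def by simp
    then have "?t x + ?t y = ?p * real_of_int k + ?t (x + y)"
      by (metis of_int_add of_int_mult of_int_of_nat_eq)
    then have "(?t x + ?t y) / ?p = real_of_int k + ?t (x + y) / ?p"
      using p by (simp add: add_divide_distrib)
    then have "2 * pi * (?t x / ?p) + 2 * pi * (?t y / ?p) = 2 * pi * (?t (x + y) / ?p) + 2 * pi * real_of_int k"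
      by (simp only: add_divide_distrib distrib_left[symmetric]) simp
    then have "root_char x * root_char y = root_char (x + y) * cis (2 * pi * real_of_int k)"
      by (simp only: root_char_def cis_mult)
    then show ?thesis by simp
  qed
  show "norm (root_char x) = 1" by (simp add: root_char_def)
  show "x = 0" if "root_char x = 1"
  proof -
    have "cos (2 * pi * (?t x / ?p)) = 1" using that by (simp add: root_char_def complex_eq_iff)
    then obtain k :: int where "2 * pi * (?t x / ?p) = real_of_int k * 2 * pi" using cos_one_2pi_int by blast
    then have "?t x = ?p * k" using p by (simp add: field_simps)
    then have k: "to_int_mod_ring x = int CARD('p) * k" by (metis of_int_eq_iff of_int_mult of_int_of_nat_eq)
    have "to_int_mod_ring x \<in> {0..<int CARD('p)}" using range_to_int_mod_ring by blast
    then have "to_int_mod_ring x = to_int_mod_ring x mod int CARD('p)" by simp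
    also have "\<dots> = 0" unfolding k by simp
    finally show ?thesis by simp
  qed
qed

section \<open>From singular matrices to kernel words\<close>

lemma singular_has_kernel:
  fixes A :: "'a::field mat"
  assumes A: "A \<in> carrier_mat n n" and s: "\<not> invertible_mat A"
  shows "\<exists>v \<in> carrier_vec n. v \<noteq> 0\<^sub>v n \<and> A *\<^sub>v v = 0\<^sub>v n"
proof (cases "det A = 0")
  case True
  then show ?thesis using det_0_iff_vec_prod_zero_field[OF A] by blast
next
  case False
  from det_non_zero_imp_unit[OF A False]
  obtain B where "B \<in> carrier_mat n n" "A * B = 1\<^sub>m n" "B * A = 1\<^sub>m n"
    unfolding Units_def ring_mat_def by auto
  then have "invertible_mat A"
    using A unfolding invertible_mat_def inverts_mat_def by (intro conjI exI[of _ B]) auto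
  then show ?thesis using s by contradiction
qed

lemma directed_adj_mult:
  fixes v :: "'p::prime_card mod_ring vec"
  assumes P: "P permutes points n d" and v: "v \<in> carrier_vec n" and k: "k < n"
  shows "(map_mat of_int (directed_adj n d P) *\<^sub>v v) $ k = (\<Sum>j<d. v $ fst (P (k, j)))"
proof -
  have img: "P (k, j) \<in> points n d" if "j < d" for j
    using permutes_in_image[OF P, of "(k, j)"] k that by (simp add: points_eq)
  have fib: "fiber d k = (\<lambda>j. (k, j)) ` {..<d}" by (auto simp: fiber_def)
  have cnt: "card {x \<in> fiber d k. P x \<in> fiber d l} = card {j \<in> {..<d}. fst (P (k, j)) = l}" for l
  proof -
    have "{x \<in> fiber d k. P x \<in> fiber d l} = (\<lambda>j. (k, j)) ` {j \<in> {..<d}. fst (P (k, j)) = l}"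
      using img by (force simp: fiber_def points_eq mem_Times_iff)
    then show ?thesis by (simp add: card_image inj_on_def)
  qed
  have "(map_mat of_int (directed_adj n d P) *\<^sub>v v) $ k =
      (\<Sum>l<n. of_nat (card {x \<in> fiber d k. P x \<in> fiber d l}) * v $ l)"
    using k v by (simp add: directed_adj_def scalar_prod_def atLeast0LessThan)
  also have "\<dots> = (\<Sum>l<n. \<Sum>j | j \<in> {..<d} \<and> fst (P (k, j)) = l. v $ fst (P (k, j)))"
    unfolding cnt by (intro sum.cong) auto
  also have "\<dots> = (\<Sum>j<d. v $ fst (P (k, j)))"
    using img by (intro sum.group) (auto simp: points_eq mem_Times_iff)
  finally show ?thesis .
qed

lemma card_kernel_words_ge:
  assumes P: "P permutes points n d" and s: "singular_mod TYPE('p::prime_card) (directed_adj n d P)"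
  shows "CARD('p) - 1 \<le> card {v \<in> kernel_words n d P. \<exists>l<n. v l \<noteq> (0 :: 'p mod_ring)}"
proof -
  have A: "map_mat of_int (directed_adj n d P) \<in> carrier_mat n n" by (simp add: directed_adj_def)
  obtain v :: "'p mod_ring vec" where v: "v \<in> carrier_vec n" "v \<noteq> 0\<^sub>v n"
      and Av: "map_mat of_int (directed_adj n d P) *\<^sub>v v = 0\<^sub>v n"
    using singular_has_kernel[OF A s[unfolded singular_mod_def]] by blast
  from v obtain i where i: "i < n" "v $ i \<noteq> 0" by (metis carrier_vecD eq_vecI index_zero_vec)
  define w where "w c = (\<lambda>l\<in>{..<n}. c * v $ l)" for c :: "'p mod_ring"
  have row: "(\<Sum>j<d. v $ fst (P (k, j))) = 0" if "k < n" for k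
    using directed_adj_mult[OF P v(1) that] Av that by simp
  have fst_less: "fst (P (k, j)) < n" if "k < n" "j < d" for k j
    using permutes_in_image[OF P, of "(k, j)"] that by (simp add: points_eq mem_Times_iff)
  have "w c \<in> {v \<in> kernel_words n d P. \<exists>l<n. v l \<noteq> 0}" if "c \<noteq> 0" for c
  proof -
    have "(\<Sum>j<d. w c (fst (P (k, j)))) = 0" if "k < n" for k
    proof -
      have "(\<Sum>j<d. w c (fst (P (k, j)))) = c * (\<Sum>j<d. v $ fst (P (k, j)))"
        using fst_less[OF that] by (simp add: w_def sum_distrib_left)
      then show ?thesis by (simp add: row[OF that])
    qed
    moreover have "w c i \<noteq> 0" using i that by (simp add: w_def)
    ultimately show ?thesis using i(1) by (auto simp: kernel_words_def w_def)
  qed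
  then have "w ` (UNIV - {0}) \<subseteq> {v \<in> kernel_words n d P. \<exists>l<n. v l \<noteq> 0}" by blast
  moreover have "finite {v \<in> kernel_words n d P. \<exists>l<n. v l \<noteq> (0 :: 'p mod_ring)}"
    by (rule finite_subset[OF _ finite_words[of n]]) (auto simp: kernel_words_def)
  ultimately have "card (w ` (UNIV - {0})) \<le> card {v \<in> kernel_words n d P. \<exists>l<n. v l \<noteq> (0 :: 'p mod_ring)}"
    by (rule card_mono[rotated])
  moreover have "inj_on w (UNIV - {0})"
  proof (rule inj_onI)
    fix c c' assume "w c = w c'"
    then have "w c i = w c' i" by simp
    then show "c = c'" using i by (simp add: w_def)
  qed
  then have "card (w ` (UNIV - {0})) = CARD('p) - 1" by (simp add: card_image card_Diff_singleton)
  ultimately show ?thesis by simp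
qed

section \<open>Perfect pairings and fixed-point-free involutions\<close>

definition matching_edges :: "'x set \<Rightarrow> ('x \<Rightarrow> 'x) \<Rightarrow> 'x set set" where
  "matching_edges X P = (\<lambda>x. {x, P x}) ` X"

lemma mem_matching_edges:
  assumes P: "P \<in> matchings X" and x: "x \<in> X"
  shows "{x, y} \<in> matching_edges X P \<longleftrightarrow> y = P x"
proof
  assume "{x, y} \<in> matching_edges X P"
  then obtain z where z: "z \<in> X" "{x, y} = {z, P z}" by (auto simp: matching_edges_def)
  then show "y = P x" using matchingsD(3)[OF P, of z] by (auto simp: doubleton_eq_iff)
qed (use x in \<open>auto simp: matching_edges_def\<close>)

lemma matching_edges_perfect:
  assumes P: "P \<in> matchings X"
  shows "matching_edges X P \<in> perfect_pairings X"
proof -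
  note D = matchingsD[OF P]
  have "disjoint (matching_edges X P)"
  proof (rule disjointI)
    fix e f assume ef: "e \<in> matching_edges X P" "f \<in> matching_edges X P" "e \<noteq> f"
    then obtain x y where xy: "x \<in> X" "y \<in> X" "e = {x, P x}" "f = {y, P y}"
      by (auto simp: matching_edges_def)
    then show "e \<inter> f = {}" using ef(3) by (auto simp: D)
  qed
  moreover have "\<Union> (matching_edges X P) = X" by (auto simp: matching_edges_def D)
  moreover have "{} \<notin> matching_edges X P" by (auto simp: matching_edges_def)
  moreover have "card e = 2" if e: "e \<in> matching_edges X P" for e
  proof -
    obtain x where x: "x \<in> X" "e = {x, P x}" using e by (auto simp: matching_edges_def)
    then show ?thesis using D(2)[OF x(1)] by simp
  qed
  ultimately show ?thesis by (simp add: perfect_pairings_def partition_on_def)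
qed

lemma perfect_pairing_from_matching:
  assumes M: "M \<in> perfect_pairings X"
  shows "M \<in> matching_edges X ` matchings X"
proof -
  have M': "\<Union> M = X" "disjoint M" "\<And>e. e \<in> M \<Longrightarrow> card e = 2"
    using M by (auto simp: perfect_pairings_def partition_on_def)
  have uniq: "\<exists>!y. {x, y} \<in> M" if x: "x \<in> X" for x
  proof -
    obtain e where e: "e \<in> M" "x \<in> e" using x M'(1) by blast
    then obtain y where y: "e = {x, y}" "x \<noteq> y" using M'(3)[OF e(1)] by (metis card_2_iff insertE insert_commute singletonD)
    show ?thesis
    proof (rule ex1I[of _ y])
      show "{x, y} \<in> M" using e(1) y by simp
      fix y' assume y': "{x, y'} \<in> M"
      then have "{x, y'} = {x, y}" using disjointD[OF M'(2) y' e(1)] y(1) by blast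
      then show "y' = y" by (auto simp: doubleton_eq_iff)
    qed
  qed
  define P where "P x = (if x \<in> X then THE y. {x, y} \<in> M else x)" for x
  have PM: "{x, P x} \<in> M" if "x \<in> X" for x using theI'[OF uniq[OF that]] that by (simp add: P_def)
  have P_eq: "P x = y" if "{x, y} \<in> M" for x y
  proof -
    have "x \<in> X" using that M'(1) by blast
    then show ?thesis using uniq PM that by blast
  qed
  have inX: "P x \<in> X" if "x \<in> X" for x using PM[OF that] M'(1) by blast
  have invol: "P (P x) = x" for x
  proof (cases "x \<in> X")
    case True
    then have "{P x, x} \<in> M" using PM by (simp add: insert_commute)
    then show ?thesis by (rule P_eq)
  qed (simp add: P_def)
  have "P \<in> matchings X"
    unfolding matchings_def
  proof (intro CollectI conjI ballI allI)
    show "P permutes X"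
      unfolding permutes_def using invol by (metis P_def)
    show "P x \<noteq> x" if "x \<in> X" for x using M'(3)[OF PM[OF that]] by auto
    show "P (P x) = x" for x by (rule invol)
  qed
  moreover have "matching_edges X P = M"
  proof (intro equalityI subsetI)
    fix e assume e: "e \<in> M"
    then obtain x y where xy: "e = {x, y}" using M'(3) by (metis card_2_iff)
    then have "x \<in> X" "P x = y" using e M'(1) P_eq by auto
    then show "e \<in> matching_edges X P" using xy by (auto simp: matching_edges_def)
  qed (auto simp: matching_edges_def PM)
  ultimately show ?thesis by blast
qed

lemma bij_matching_edges: "bij_betw (matching_edges X) (matchings X) (perfect_pairings X)"
proof (rule bij_betw_imageI)
  show "inj_on (matching_edges X) (matchings X)"
  proof (rule inj_onI)
    fix P P' assume P: "P \<in> matchings X" and P': "P' \<in> matchings X" and eq: "matching_edges X P = matching_edges X P'"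
    have "P x = P' x" for x
    proof (cases "x \<in> X")
      case True
      then show ?thesis using mem_matching_edges[OF P True, of "P x"] mem_matching_edges[OF P' True, of "P x"] eq by simp
    next
      case False
      then show ?thesis using permutes_not_in[OF matchingsD(1)[OF P]] permutes_not_in[OF matchingsD(1)[OF P']] by simp
    qed
    then show "P = P'" ..
  qed
  show "matching_edges X ` matchings X = perfect_pairings X"
    using matching_edges_perfect perfect_pairing_from_matching by blast
qed

text \<open>In an ordered pair (x, y) forming an edge, y is \<open>P x\<close>, so counting pairs is
  counting x. A loop is seen from both of its ends in either definition.\<close>

lemma undirected_adj_matching_edges:
  assumes P: "P \<in> matchings (points n d)"
  shows "undirected_adj n d (matching_edges (points n d) P) = directed_adj n d P"
proof -
  have "card {(x, y) \<in> fiber d k \<times> fiber d l. {x, y} \<in> matching_edges (points n d) P} =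
      card {x \<in> fiber d k. P x \<in> fiber d l}" if k: "k < n" for k l
  proof -
    have "{(x, y) \<in> fiber d k \<times> fiber d l. {x, y} \<in> matching_edges (points n d) P} =
        (\<lambda>x. (x, P x)) ` {x \<in> fiber d k. P x \<in> fiber d l}"
    proof -
      have "{x, y} \<in> matching_edges (points n d) P \<longleftrightarrow> y = P x" if "x \<in> fiber d k" for x y
        using that k by (intro mem_matching_edges[OF P]) (auto simp: points_def)
      then show ?thesis by auto
    qed
    then show ?thesis by (simp add: card_image inj_on_def)
  qed
  then show ?thesis unfolding undirected_adj_def directed_adj_def by (intro cong_mat) auto
qed

section \<open>From the first moment to the probability\<close>

lemma prob_map_pmf_of_set:
  assumes "finite \<Omega>" "\<Omega> \<noteq> {}"
  shows "measure_pmf.prob (map_pmf f (pmf_of_set \<Omega>)) {A. R A} = avg \<Omega> (\<lambda>P. of_bool (R (f P)))"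
  using assms by (simp add: measure_map_pmf measure_pmf_of_set avg_def of_bool_def sum.If_cases Int_def vimage_def)

text \<open>Markov's inequality for the number of nonzero kernel words, which is at least p - 1
  whenever the matrix is singular.\<close>

lemma singular_prob_le:
  fixes \<Omega> :: "(nat \<times> nat \<Rightarrow> nat \<times> nat) set"
  assumes fin: "finite \<Omega>" "\<Omega> \<noteq> {}" and P: "\<And>P. P \<in> \<Omega> \<Longrightarrow> P permutes points n d"
    and d: "(of_nat d :: 'p::prime_card mod_ring) \<noteq> 0" and n: "0 < n"
  shows "avg \<Omega> (\<lambda>P. of_bool (singular_mod TYPE('p) (directed_adj n d P))) \<le>
    (1 + (real CARD('p) ^ 2 / real CARD('p) ^ n +
    (\<Sum>u\<in>nonconst_words n. \<Sum>v\<in>nonconst_words n. norm (additive_character.corr (root_char :: 'p mod_ring \<Rightarrow> complex) \<Omega> n d u v)) / real CARD('p) ^ n))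
    / (real CARD('p) - 1)"
proof -
  interpret additive_character "root_char :: 'p mod_ring \<Rightarrow> complex" by (rule additive_character_root_char)
  have p: "1 < real CARD('p)" using prime_gt_1_nat[OF prime_card[where 'a = 'p]] by simp
  have "avg \<Omega> (\<lambda>P. (real CARD('p) - 1) * of_bool (singular_mod TYPE('p) (directed_adj n d P))) \<le>
     avg \<Omega> (\<lambda>P. real (card {v \<in> kernel_words n d P. \<exists>l<n. v l \<noteq> (0 :: 'p mod_ring)}))"
  proof (rule avg_mono)
    fix Q assume "Q \<in> \<Omega>"
    then have "CARD('p) - 1 \<le> card {v \<in> kernel_words n d Q. \<exists>l<n. v l \<noteq> (0 :: 'p mod_ring)}"
      if "singular_mod TYPE('p) (directed_adj n d Q)" using card_kernel_words_ge[OF P that] by blast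
    then show "(real CARD('p) - 1) * of_bool (singular_mod TYPE('p) (directed_adj n d Q)) \<le>
        real (card {v \<in> kernel_words n d Q. \<exists>l<n. v l \<noteq> (0 :: 'p mod_ring)})"
      using p by (cases "singular_mod TYPE('p) (directed_adj n d Q)") (auto simp: of_nat_diff)
  qed
  also have "\<dots> \<le> 1 + (real CARD('p) ^ 2 / real CARD('p) ^ n +
    (\<Sum>u\<in>nonconst_words n. \<Sum>v\<in>nonconst_words n. norm (corr \<Omega> n d u v)) / real CARD('p) ^ n)"
    using first_moment[OF fin P d n] by simp
  finally show ?thesis using p by (simp add: avg_mult_left pos_le_divide_eq mult.commute)
qed

theorem theorem1p2:
  fixes d p :: nat
  assumes "d \<ge> 3"
    and "p = CARD('p::prime_card)"
    and "odd p"
    and "gcd p d = 1"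
  shows "(\<exists>\<epsilon> :: nat \<Rightarrow> real. \<epsilon> \<longlonglongrightarrow> 0 \<and>
           (\<forall>\<^sub>F n in sequentially.
              measure_pmf.prob (directed_model n d) {A. singular_mod TYPE('p) A}
                \<le> (1 + \<epsilon> n) / (real p - 1)))
       \<and> (\<exists>\<epsilon> :: nat \<Rightarrow> real. \<epsilon> \<longlonglongrightarrow> 0 \<and>
           (\<forall>\<^sub>F n in sequentially. even (n * d) \<longrightarrow>
              measure_pmf.prob (undirected_model n d) {A. singular_mod TYPE('p) A}
                \<le> (1 + \<epsilon> n) / (real p - 1)))"
proof -
  interpret additive_character "root_char :: 'p mod_ring \<Rightarrow> complex" by (rule additive_character_root_char)
  have prime: "prime p" using prime_card[where 'a = 'p] assms(2) by simp
  have d: "(of_nat d :: 'p mod_ring) \<noteq> 0"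
  proof
    assume "(of_nat d :: 'p mod_ring) = 0"
    then have "p dvd d" unfolding assms(2) by (rule of_nat_0_mod_ring_dvd)
    then have "p dvd gcd p d" by simp
    then show False using assms(4) prime by simp
  qed
  \<comment> \<open>Oddness of p enters here, for the swap estimate in the undirected model.\<close>
  have two: "(2 :: 'p mod_ring) \<noteq> 0"
  proof
    assume "(2 :: 'p mod_ring) = 0"
    then have "(of_nat 2 :: 'p mod_ring) = 0" by simp
    then have "p dvd 2" unfolding assms(2) by (rule of_nat_0_mod_ring_dvd)
    then have "p \<le> 2" by (rule dvd_imp_le) simp
    then have "p = 2" using prime_gt_1_nat[OF prime] by linarith
    then show False using assms(3) by simp
  qed
  \<comment> \<open>The error term for a family of sets \<open>\<Omega>\<close>, so that
    \<open>lim\<close> and \<open>bound\<close> serve both models.\<close>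
  define T where "T \<Omega> n = real p ^ 2 / real p ^ n +
    (\<Sum>u\<in>nonconst_words n. \<Sum>v\<in>nonconst_words n. norm (corr (\<Omega> n) n d u v)) / real p ^ n" for \<Omega> n
  have p1: "1 < real p" using prime_gt_1_nat[OF prime] by simp
  have geo: "(\<lambda>n. real p ^ 2 / real p ^ n) \<longlonglongrightarrow> 0"
    using p1 by (intro LIMSEQ_divide_realpow_zero)
  have lim: "T \<Omega> \<longlonglongrightarrow> 0" if "(\<lambda>n. (\<Sum>u\<in>nonconst_words n. \<Sum>v\<in>nonconst_words n. norm (corr (\<Omega> n) n d u v)) / real CARD('p mod_ring) ^ n) \<longlonglongrightarrow> 0" for \<Omega>
    using tendsto_add[OF geo that] by (simp add: T_def[abs_def] assms(2))
  have bound: "avg (\<Omega> n) (\<lambda>P. of_bool (singular_mod TYPE('p) (directed_adj n d P))) \<le> (1 + T \<Omega> n) / (real p - 1)"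
    if "finite (\<Omega> n)" "\<Omega> n \<noteq> {}" "\<And>P. P \<in> \<Omega> n \<Longrightarrow> P permutes points n d" "0 < n" for \<Omega> n
    using singular_prob_le[OF that(1,2,3) d that(4)] by (simp add: T_def assms(2))
  let ?D = "\<lambda>n. (perms (points n d))" and ?U = "\<lambda>n. matchings (points n d)"
  have "measure_pmf.prob (directed_model n d) {A. singular_mod TYPE('p) A} \<le> (1 + T ?D n) / (real p - 1)" if "0 < n" for n
    unfolding directed_model_def
    by (subst prob_map_pmf_of_set[OF finite_permutations_points permutations_points_nonempty])
      (rule bound[OF finite_permutations_points permutations_points_nonempty _ that], simp)
  moreover have "measure_pmf.prob (undirected_model n d) {A. singular_mod TYPE('p) A} \<le> (1 + T ?U n) / (real p - 1)"
    if n: "0 < n" and ev: "even (n * d)" for n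
  proof -
    let ?X = "points n d"
    have fX: "finite ?X" by (rule finite_points)
    have "measure_pmf.prob (undirected_model n d) {A. singular_mod TYPE('p) A} =
        avg (perfect_pairings ?X) (\<lambda>M. of_bool (singular_mod TYPE('p) (undirected_adj n d M)))"
      unfolding undirected_model_def
      by (rule prob_map_pmf_of_set[OF finite_perfect_pairings[OF fX] perfect_pairings_points_nonempty[OF ev]])
    also have "\<dots> = avg (?U n) (\<lambda>P. of_bool (singular_mod TYPE('p) (undirected_adj n d (matching_edges ?X P))))"
      by (rule avg_reindex[OF bij_matching_edges, symmetric])
    also have "\<dots> = avg (?U n) (\<lambda>P. of_bool (singular_mod TYPE('p) (directed_adj n d P)))"
      by (intro avg_cong) (simp only: undirected_adj_matching_edges)
    also have "\<dots> \<le> (1 + T ?U n) / (real p - 1)"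
    proof (rule bound[where \<Omega> = ?U, OF finite_matchings[OF fX] _ _ n])
      \<comment> \<open>Evenness of \<open>n * d\<close> yields a perfect pairing, and the bijection
        turns it into a matching.\<close>
      show "?U n \<noteq> {}"
        using bij_betw_imp_surj_on[OF bij_matching_edges[of ?X]] perfect_pairings_points_nonempty[OF ev] by auto
    qed (rule matchingsD(1))
    finally show ?thesis .
  qed
  moreover have "T ?D \<longlonglongrightarrow> 0" by (rule lim[OF directed_corr_sum_tendsto_0[OF assms(1)]])
  moreover have "T ?U \<longlonglongrightarrow> 0" by (rule lim[OF undirected_corr_sum_tendsto_0[OF two assms(1)]])
  ultimately show ?thesis
    by (intro conjI exI[of _ "T ?D"] exI[of _ "T ?U"] eventually_mono[OF eventually_gt_at_top[of 0]]) auto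
qed

end
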